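(* Let $(X,T)$ be a minimal Cantor system given by a proper and stable Bratteli-Vershik representation $B=(V,E,\preceq)$ of exact finite rank $d$ for the ergodic probability measure $\mu$ (so $I_\mu=\{1,\dots,d\}$). Let $\lambda=\exp(2i\pi\alpha)$ with $\alpha\in\mathbb{R}$. Then $\lambda$ is an eigenvalue of $(X,T)$ for $\mu$ if and only if there exist functions $\rho_n:V_n\to\mathbb{R}$, $n\ge1$, such that $$\sum_{n\ge1}\frac{1}{M_{n+1}(u_n,u_{n+1})}\sum_{s\in S_n(u_n,u_{n+1})}\bigl|\lambda^{\langle s,h_n\rangle-\rho_{n+1}(u_{n+1})+\rho_n(u_n)}-1\bigr|^2<+\infty$$ for any sequence $(u_n;n\ge1)$ in $I_\mu$.
   Context: For real $t$, $\lambda^t=\exp(2i\pi\alpha t)$. $\langle\cdot,\cdot\rangle$ is the Euclidean inner product. Systems. A minimal Cantor system $(X,T)$ is a homeomorphism $T$ of a Cantor set $X$ all of whose orbits are dense. For a $T$-invariant Borel probability measure $\mu$, $\lambda\in\mathbb{C}$ is an eigenvalue of $(X,T)$ for $\mu$ if there is $f\in L^2(X,\mu)$, $f\ne0$, with $f\circ T=\lambda f$. Bratteli diagrams. A Bratteli diagram $(V,E)$ is an infinite graph with finite pairwise disjoint vertex levels $V_0=\{v_0\},V_1,V_2,\dots$ and finite edge levels $E_1,E_2,\dots$; each $e\in E_n$ goes from a source $\mathsf{s}(e)\in V_{n-1}$ to a range $\mathsf{r}(e)\in V_n$; every vertex is the source of some edge and every vertex other than $v_0$ is the range of some edge. $M_n$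 is the $V_{n-1}\times V_n$ matrix whose $(u,v)$ entry is the number of edges from $u$ to $v$; $P_{m,n}=M_{m+1}\cdots M_n$, with entries $P_{m,n}(u,v)$; $h_n=(h_n(u);u\in V_n)$ is the row vector with $h_n(u)$ the number of paths from $v_0$ to $u$. $E_{m,n}$ is the set of paths from $V_m$ to $V_n$. The diagram is simple if for every $m\ge1$ there is $n>m$ with all entries of $P_{m,n}$ positive. Orders. An ordered Bratteli diagram $B=(V,E,\preceq)$ carries a partial order on $E$ in which two edges are comparable iff they have the same range. It induces a partial order on each $E_{m,n}$: two distinct paths with the same range vertex are compared by the last edge at which they differ. $X_B$ is the space of infinite paths $(x_1,x_2,\dots)$ starting at $v_0$, with the cylinder topology. $B$ is properly ordered if there is a unique $x_{\max}\in X_B$ with all edges maximal and a unique $x_{\min}\in X_B$ with all edges minimal. The Vershik map $V_B$ sends $x_{\max}$ to $x_{\min}$, and sends $x\ne x_{\max}$ to the path obtained by taking the smallest $n$ with $x_n$ not maximal, replacing $x_n$ by its successor $y_n$, replacing $(x_1,\dots,x_{n-1})$ by the minimal path from $v_0$ to $\mathsf{s}(y_n)$, and leaving $x_{n+1},x_{n+2},\dots$ unchanged. $B$ is a Bratteli-Vershik representation of $(X,T)$ if $B$ is properly ordered, $(V,E)$ is simple and $(X,T)$ is topologically conjugate to $(X_B,V_B)$; one identifies $(X,T)=(X_B,V_B)$. A proper representation of finite rank $d$ is one such that: all entries of $h_1$ equal $1$; for all $n\ge2$ all entries of $M_n$ are positive; $\#V_n=d$ for all $n\geq 1$, and $V_n$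 is identified with $\{1,\dots,d\}$; for all $n\ge2$ all maximal edges of $E_n$ start at vertex $d$ of $V_{n-1}$. Suffix vectors. For $x\in X$ let $\tau_n(x)=\mathsf{r}(x_n)\in V_n$. The suffix vector $s_n(x)\in\mathbb{N}^{V_n}$ has $u$-th coordinate $\#\{e\in E_{n+1}:x_{n+1}\prec e,\ \mathsf{s}(e)=u\}$. For $u\in V_n,v\in V_{n+1}$, $S_n(u,v)=\{s_n(x):x\in X,\ \tau_n(x)=u,\ \tau_{n+1}(x)=v\}$. Clean, stable, exact rank. A proper representation of finite rank $d$ is clean if there is $\delta_0>0$ such that for each ergodic measure $\mu$ there is $I_\mu\subseteq\{1,\dots,d\}$ with $\mu(\tau_n=v)\ge\delta_0$ for all $v\in I_\mu$, $n\ge1$, and $\lim_{n\to\infty}\mu(\tau_n=v)=0$ for all $v\notin I_\mu$; and $I_\mu\cap I_\nu=\emptyset$ for distinct ergodic measures $\mu,\nu$. A clean representation is stable if $\frac{h_m(u)}{h_n(v)}P_{m,n}(u,v)>\delta_0/2$ for all $1\le m<n$ and $u,v\in I_\mu$, where $\delta_0$ is the constant of the clean property. It is of exact finite rank $d$ for $\mu$ if $I_\mu=\{1,\dots,d\}$ (then $\mu$ is the unique invariant probability measure). *)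

theory Defs
  imports "HOL-Probability.Probability"
begin

section \<open>Cantor systems, invariant measures and eigenvalues\<close>

definition cantor_space :: "'a topology \<Rightarrow> bool" where
  "cantor_space X \<longleftrightarrow>
     X homeomorphic_space
       (product_topology (\<lambda>_::nat. discrete_topology (UNIV :: bool set)) UNIV)"

text \<open>The two-sided orbit of a point; backward iterates are expressed without an inverse of \<open>T\<close>.\<close>
definition orbit_of :: "'a topology \<Rightarrow> ('a \<Rightarrow> 'a) \<Rightarrow> 'a \<Rightarrow> 'a set" where
  "orbit_of X T x = {y \<in> topspace X. \<exists>k::nat. y = (T ^^ k) x \<or> x = (T ^^ k) y}"

definition minimal_cantor_system :: "'a topology \<Rightarrow> ('a \<Rightarrow> 'a) \<Rightarrow> bool" where
  "minimal_cantor_system X T \<longleftrightarrow>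
     cantor_space X \<and> homeomorphic_map X X T \<and>
     (\<forall>x \<in> topspace X. X closure_of (orbit_of X T x) = topspace X)"

definition topologically_conjugate_via ::
    "'a topology \<Rightarrow> ('a \<Rightarrow> 'a) \<Rightarrow> 'b topology \<Rightarrow> ('b \<Rightarrow> 'b) \<Rightarrow> ('a \<Rightarrow> 'b) \<Rightarrow> bool" where
  "topologically_conjugate_via X T Y S \<phi> \<longleftrightarrow>
     homeomorphic_map X Y \<phi> \<and> (\<forall>x \<in> topspace X. \<phi> (T x) = S (\<phi> x))"

definition borel_of :: "'a topology \<Rightarrow> 'a measure" where
  "borel_of X = sigma (topspace X) {U. openin X U}"

definition invariant_measure :: "'a topology \<Rightarrow> ('a \<Rightarrow> 'a) \<Rightarrow> 'a measure \<Rightarrow> bool" where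
  "invariant_measure X T \<mu> \<longleftrightarrow>
     prob_space \<mu> \<and> sets \<mu> = sets (borel_of X) \<and> T \<in> measurable \<mu> \<mu> \<and> distr \<mu> \<mu> T = \<mu>"

definition ergodic_measure :: "'a topology \<Rightarrow> ('a \<Rightarrow> 'a) \<Rightarrow> 'a measure \<Rightarrow> bool" where
  "ergodic_measure X T \<mu> \<longleftrightarrow>
     invariant_measure X T \<mu> \<and>
     (\<forall>A \<in> sets \<mu>. T -` A \<inter> space \<mu> = A \<longrightarrow> measure \<mu> A = 0 \<or> measure \<mu> A = 1)"

text \<open>
  Elements of $L^2$ are represented by measurable functions; equality and \<open>f \<noteq> 0\<close> are
  understood almost everywhere.
\<close>
definition eigenvalue_for :: "('a \<Rightarrow> 'a) \<Rightarrow> 'a measure \<Rightarrow> complex \<Rightarrow> bool" where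
  "eigenvalue_for T \<mu> c \<longleftrightarrow>
     (\<exists>f :: 'a \<Rightarrow> complex.
        f \<in> borel_measurable \<mu> \<and> integrable \<mu> (\<lambda>x. (cmod (f x))\<^sup>2) \<and>
        \<not> (AE x in \<mu>. f x = 0) \<and> (AE x in \<mu>. f (T x) = c * f x))"

text \<open>The power $\lambda^t$ for $\lambda = \exp(2 i \pi \alpha)$ and real $t$.\<close>
definition lam_pow :: "real \<Rightarrow> real \<Rightarrow> complex" where
  "lam_pow \<alpha> t = exp (2 * \<i> * of_real pi * of_real \<alpha> * of_real t)"


section \<open>Bratteli diagrams\<close>

text \<open>Only \<open>edges B n\<close> for \<open>n \<ge> 1\<close> is meaningful; \<open>edges B 0\<close> is never used.\<close>
record ('v, 'e) bratteli =
  verts :: "nat \<Rightarrow> 'v set"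
  edges :: "nat \<Rightarrow> 'e set"
  src :: "'e \<Rightarrow> 'v"
  rng :: "'e \<Rightarrow> 'v"

definition bratteli_diagram :: "('v, 'e, 'z) bratteli_scheme \<Rightarrow> bool" where
  "bratteli_diagram B \<longleftrightarrow>
     (\<exists>v0. verts B 0 = {v0}) \<and>
     (\<forall>n. finite (verts B n)) \<and>
     (\<forall>m n. m \<noteq> n \<longrightarrow> verts B m \<inter> verts B n = {}) \<and>
     (\<forall>n\<ge>1. finite (edges B n)) \<and>
     (\<forall>n\<ge>1. \<forall>e \<in> edges B n. src B e \<in> verts B (n - 1) \<and> rng B e \<in> verts B n) \<and>
     (\<forall>n. \<forall>v \<in> verts B n. \<exists>e \<in> edges B (Suc n). src B e = v) \<and>
     (\<forall>n\<ge>1. \<forall>v \<in> verts B n. \<exists>e \<in> edges B n. rng B e = v)"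

definition all_edges :: "('v, 'e, 'z) bratteli_scheme \<Rightarrow> 'e set" where
  "all_edges B = (\<Union>n \<in> {1..}. edges B n)"

definition inc_mat :: "('v, 'e, 'z) bratteli_scheme \<Rightarrow> nat \<Rightarrow> 'v \<Rightarrow> 'v \<Rightarrow> nat" where
  "inc_mat B n u v = card {e \<in> edges B n. src B e = u \<and> rng B e = v}"

text \<open>\<open>mat_prod_len B m k\<close> is the product $M_{m+1} \cdots M_{m+k}$.\<close>
primrec mat_prod_len ::
    "('v, 'e, 'z) bratteli_scheme \<Rightarrow> nat \<Rightarrow> nat \<Rightarrow> 'v \<Rightarrow> 'v \<Rightarrow> nat" where
  "mat_prod_len B m 0 u v = (if u = v then 1 else 0)"
| "mat_prod_len B m (Suc k) u v =
     (\<Sum>w \<in> verts B (m + k). mat_prod_len B m k u w * inc_mat B (Suc (m + k)) w v)"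

definition mat_prod :: "('v, 'e, 'z) bratteli_scheme \<Rightarrow> nat \<Rightarrow> nat \<Rightarrow> 'v \<Rightarrow> 'v \<Rightarrow> nat" where
  "mat_prod B m n = mat_prod_len B m (n - m)"

text \<open>
  A path from level \<open>m\<close> to level \<open>n\<close> is the family of its edges, indexed by \<open>m + 1, \<dots>, n\<close>
  (and \<open>undefined\<close> at all other indices).
\<close>
definition fin_paths :: "('v, 'e, 'z) bratteli_scheme \<Rightarrow> nat \<Rightarrow> nat \<Rightarrow> (nat \<Rightarrow> 'e) set" where
  "fin_paths B m n =
     {p \<in> (\<Pi>\<^sub>E i \<in> {m<..n}. edges B i). \<forall>i \<in> {m<..<n}. rng B (p i) = src B (p (Suc i))}"

text \<open>Paths from the top vertex to \<open>v\<close> at level \<open>n\<close>; for \<open>n = 0\<close> this is the empty path.\<close>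
definition paths_to :: "('v, 'e, 'z) bratteli_scheme \<Rightarrow> nat \<Rightarrow> 'v \<Rightarrow> (nat \<Rightarrow> 'e) set" where
  "paths_to B n v =
     {p \<in> fin_paths B 0 n. if n = 0 then v \<in> verts B 0 else rng B (p n) = v}"

definition height :: "('v, 'e, 'z) bratteli_scheme \<Rightarrow> nat \<Rightarrow> 'v \<Rightarrow> nat" where
  "height B n v = card (paths_to B n v)"

definition simple_diagram :: "('v, 'e, 'z) bratteli_scheme \<Rightarrow> bool" where
  "simple_diagram B \<longleftrightarrow>
     (\<forall>m\<ge>1. \<exists>n>m. \<forall>u \<in> verts B m. \<forall>v \<in> verts B n. mat_prod B m n u v > 0)"

definition inf_paths :: "('v, 'e, 'z) bratteli_scheme \<Rightarrow> (nat \<Rightarrow> 'e) set" where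
  "inf_paths B =
     {x \<in> (\<Pi>\<^sub>E i \<in> {1..}. edges B i). \<forall>i\<ge>1. rng B (x i) = src B (x (Suc i))}"

definition path_space :: "('v, 'e, 'z) bratteli_scheme \<Rightarrow> (nat \<Rightarrow> 'e) topology" where
  "path_space B =
     subtopology (product_topology (\<lambda>i. discrete_topology (edges B i)) {1..}) (inf_paths B)"


section \<open>Ordered diagrams and the Vershik map\<close>

text \<open>\<open>(e, f) \<in> edge_ord B\<close> means $e \preceq f$.\<close>
record ('v, 'e) ordered_bratteli = "('v, 'e) bratteli" +
  edge_ord :: "('e \<times> 'e) set"

definition ordered_diagram :: "('v, 'e) ordered_bratteli \<Rightarrow> bool" where
  "ordered_diagram B \<longleftrightarrow>
     bratteli_diagram B \<and>
     partial_order_on (all_edges B) (edge_ord B) \<and>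
     (\<forall>e \<in> all_edges B. \<forall>f \<in> all_edges B.
        (e, f) \<in> edge_ord B \<or> (f, e) \<in> edge_ord B \<longleftrightarrow> rng B e = rng B f)"

definition edge_less :: "('v, 'e) ordered_bratteli \<Rightarrow> 'e \<Rightarrow> 'e \<Rightarrow> bool" where
  "edge_less B e f \<longleftrightarrow> (e, f) \<in> edge_ord B \<and> e \<noteq> f"

definition max_edge :: "('v, 'e) ordered_bratteli \<Rightarrow> 'e \<Rightarrow> bool" where
  "max_edge B e \<longleftrightarrow> e \<in> all_edges B \<and> (\<forall>f. \<not> edge_less B e f)"

definition min_edge :: "('v, 'e) ordered_bratteli \<Rightarrow> 'e \<Rightarrow> bool" where
  "min_edge B e \<longleftrightarrow> e \<in> all_edges B \<and> (\<forall>f. \<not> edge_less B f e)"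

definition edge_succ :: "('v, 'e) ordered_bratteli \<Rightarrow> 'e \<Rightarrow> 'e" where
  "edge_succ B e = (THE f. edge_less B e f \<and> (\<forall>g. edge_less B e g \<longrightarrow> (f, g) \<in> edge_ord B))"

text \<open>
  The strict order on $E_{m,n}$. Comparability of the last distinct edges already forces
  the two paths to have the same range.
\<close>
definition path_less ::
    "('v, 'e) ordered_bratteli \<Rightarrow> nat \<Rightarrow> nat \<Rightarrow> (nat \<Rightarrow> 'e) \<Rightarrow> (nat \<Rightarrow> 'e) \<Rightarrow> bool" where
  "path_less B m n p q \<longleftrightarrow>
     p \<in> fin_paths B m n \<and> q \<in> fin_paths B m n \<and>
     (\<exists>i \<in> {m<..n}. edge_less B (p i) (q i) \<and> (\<forall>j \<in> {i<..n}. p j = q j))"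

definition min_path_to :: "('v, 'e) ordered_bratteli \<Rightarrow> nat \<Rightarrow> 'v \<Rightarrow> (nat \<Rightarrow> 'e)" where
  "min_path_to B n v =
     (THE p. p \<in> paths_to B n v \<and> (\<forall>q \<in> paths_to B n v. \<not> path_less B 0 n q p))"

definition all_max :: "('v, 'e) ordered_bratteli \<Rightarrow> (nat \<Rightarrow> 'e) \<Rightarrow> bool" where
  "all_max B x \<longleftrightarrow> x \<in> inf_paths B \<and> (\<forall>i\<ge>1. max_edge B (x i))"

definition all_min :: "('v, 'e) ordered_bratteli \<Rightarrow> (nat \<Rightarrow> 'e) \<Rightarrow> bool" where
  "all_min B x \<longleftrightarrow> x \<in> inf_paths B \<and> (\<forall>i\<ge>1. min_edge B (x i))"

definition properly_ordered :: "('v, 'e) ordered_bratteli \<Rightarrow> bool" where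
  "properly_ordered B \<longleftrightarrow> ordered_diagram B \<and> (\<exists>!x. all_max B x) \<and> (\<exists>!x. all_min B x)"

definition x_max :: "('v, 'e) ordered_bratteli \<Rightarrow> (nat \<Rightarrow> 'e)" where
  "x_max B = (THE x. all_max B x)"

definition x_min :: "('v, 'e) ordered_bratteli \<Rightarrow> (nat \<Rightarrow> 'e)" where
  "x_min B = (THE x. all_min B x)"

definition vershik :: "('v, 'e) ordered_bratteli \<Rightarrow> (nat \<Rightarrow> 'e) \<Rightarrow> (nat \<Rightarrow> 'e)" where
  "vershik B x =
     (if x = x_max B then x_min B
      else
        let n = (LEAST n. n \<ge> 1 \<and> \<not> max_edge B (x n));
            y = edge_succ B (x n)
        in (\<lambda>i. if i < n then min_path_to B (n - 1) (src B y) i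
                else if i = n then y
                else x i))"

text \<open>The conjugacy \<open>\<phi>\<close> is the map along which \<open>(X, T)\<close> is identified with the path system.\<close>
definition bv_representation ::
    "('v, 'e) ordered_bratteli \<Rightarrow> 'a topology \<Rightarrow> ('a \<Rightarrow> 'a) \<Rightarrow> ('a \<Rightarrow> nat \<Rightarrow> 'e) \<Rightarrow> bool" where
  "bv_representation B X T \<phi> \<longleftrightarrow>
     properly_ordered B \<and> simple_diagram B \<and>
     topologically_conjugate_via X T (path_space B) (vershik B) \<phi>"

text \<open>The bijections \<open>vtx n\<close> identify \<open>{1..d}\<close> with the \<open>n\<close>-th level of vertices.\<close>
definition proper_finite_rank ::
    "('v, 'e) ordered_bratteli \<Rightarrow> nat \<Rightarrow> (nat \<Rightarrow> nat \<Rightarrow> 'v) \<Rightarrow> bool" where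
  "proper_finite_rank B d vtx \<longleftrightarrow>
     (\<forall>v \<in> verts B 1. height B 1 v = 1) \<and>
     (\<forall>n\<ge>2. \<forall>u \<in> verts B (n - 1). \<forall>v \<in> verts B n. inc_mat B n u v > 0) \<and>
     (\<forall>n\<ge>1. bij_betw (vtx n) {1..d} (verts B n)) \<and>
     (\<forall>n\<ge>2. \<forall>e \<in> edges B n. max_edge B e \<longrightarrow> src B e = vtx (n - 1) d)"


section \<open>Suffix vectors\<close>

definition tau :: "('v, 'e, 'z) bratteli_scheme \<Rightarrow> nat \<Rightarrow> (nat \<Rightarrow> 'e) \<Rightarrow> 'v" where
  "tau B n x = rng B (x n)"

definition suffix_vec :: "('v, 'e) ordered_bratteli \<Rightarrow> nat \<Rightarrow> (nat \<Rightarrow> 'e) \<Rightarrow> 'v \<Rightarrow> nat" where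
  "suffix_vec B n x u =
     card {e \<in> edges B (Suc n). edge_less B (x (Suc n)) e \<and> src B e = u}"

definition suffix_set :: "('v, 'e) ordered_bratteli \<Rightarrow> nat \<Rightarrow> 'v \<Rightarrow> 'v \<Rightarrow> ('v \<Rightarrow> nat) set" where
  "suffix_set B n u v =
     {suffix_vec B n x | x. x \<in> inf_paths B \<and> tau B n x = u \<and> tau B (Suc n) x = v}"

text \<open>The inner product of a vector indexed by level \<open>n\<close> with the height vector $h_n$.\<close>
definition inner_height :: "('v, 'e, 'z) bratteli_scheme \<Rightarrow> nat \<Rightarrow> ('v \<Rightarrow> nat) \<Rightarrow> real" where
  "inner_height B n s = (\<Sum>w \<in> verts B n. real (s w) * real (height B n w))"


section \<open>Clean and stable representations\<close>

text \<open>
  \<open>\<delta>\<close> is the constant $\delta_0$ and \<open>I \<mu>\<close> the set $I_\mu$ attached to the ergodic measure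
  \<open>\<mu>\<close> of the path system.
\<close>
definition clean_rep ::
    "('v, 'e) ordered_bratteli \<Rightarrow> nat \<Rightarrow> (nat \<Rightarrow> nat \<Rightarrow> 'v) \<Rightarrow> real
       \<Rightarrow> ((nat \<Rightarrow> 'e) measure \<Rightarrow> nat set) \<Rightarrow> bool" where
  "clean_rep B d vtx \<delta> I \<longleftrightarrow>
     \<delta> > 0 \<and>
     (\<forall>\<mu>. ergodic_measure (path_space B) (vershik B) \<mu> \<longrightarrow>
        I \<mu> \<subseteq> {1..d} \<and>
        (\<forall>v \<in> I \<mu>. \<forall>n\<ge>1. measure \<mu> {x \<in> space \<mu>. tau B n x = vtx n v} \<ge> \<delta>) \<and>
        (\<forall>v \<in> {1..d} - I \<mu>.
           (\<lambda>n. measure \<mu> {x \<in> space \<mu>. tau B n x = vtx n v}) \<longlonglongrightarrow> 0)) \<and>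
     (\<forall>\<mu> \<nu>. ergodic_measure (path_space B) (vershik B) \<mu> \<longrightarrow>
        ergodic_measure (path_space B) (vershik B) \<nu> \<longrightarrow> \<mu> \<noteq> \<nu> \<longrightarrow> I \<mu> \<inter> I \<nu> = {})"

definition stable_rep ::
    "('v, 'e) ordered_bratteli \<Rightarrow> nat \<Rightarrow> (nat \<Rightarrow> nat \<Rightarrow> 'v) \<Rightarrow> real
       \<Rightarrow> ((nat \<Rightarrow> 'e) measure \<Rightarrow> nat set) \<Rightarrow> bool" where
  "stable_rep B d vtx \<delta> I \<longleftrightarrow>
     clean_rep B d vtx \<delta> I \<and>
     (\<forall>\<mu>. ergodic_measure (path_space B) (vershik B) \<mu> \<longrightarrow>
        (\<forall>m n. 1 \<le> m \<longrightarrow> m < n \<longrightarrow>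
           (\<forall>u \<in> I \<mu>. \<forall>v \<in> I \<mu>.
              real (height B m (vtx m u)) / real (height B n (vtx n v))
                * real (mat_prod B m n (vtx m u) (vtx n v)) > \<delta> / 2)))"

end

theory Submission
  imports Defs "HOL-Complex_Analysis.Great_Picard"
begin

text \<open>
  The path space is cut at level \<open>n\<close> into cells on which both \<open>\<tau>\<^sub>n\<close> and the return time
  \<open>r\<^sub>n = \<Sum>\<^bsub>k<n\<^esub> \<langle>s\<^sub>k, h\<^sub>k\<rangle>\<close> to the top of the tower are constant. The cells of one tower have equal mass, and
  the averages of an eigenfunction over them have the form \<open>\<lambda>\<close> to the power \<open>- r\<^sub>n\<close>, times \<open>b\<^sub>n(\<tau>\<^sub>n)\<close>. Hence eigenfunctions
  correspond to families \<open>b\<^sub>n\<close> with bounded energy that are consistent under the transition operators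
  of the diagram, and the energy increments are the squared martingale differences.

  If \<open>b\<close> is such a family, stability makes \<open>\<bar>b\<^sub>n\<bar>\<close> asymptotically constant on \<open>V\<^sub>n\<close>, and the
  phases of \<open>b\<^sub>n\<close> give \<open>\<rho>\<^sub>n\<close>. Conversely, given \<open>\<rho>\<close>, the constant \<open>1\<close> at a high level \<open>N\<close>
  is pulled back by the twisted transition operators; a Doeblin contraction shows that it loses
  only a summable amount of energy, so a subsequential limit as \<open>N\<close> tends to infinity
  is a nonzero consistent family. No centring of \<open>\<rho>\<close> is needed, as only \<open>L\<^sup>2\<close> convergence of a
  martingale is used.
\<close>


section \<open>Edges and heights of an ordered diagram\<close>

text \<open>The hypothesis bounds phase defects in mean square only. One backward step may turn the
  values by about the square root of a defect, and these roots need not be summable, so values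
  pulled back from different levels cannot be compared one by one. Only quantities quadratic in the
  defect are followed. The energy lost in a step is at most a multiple of the defect plus the
  squared oscillation of the values, and oscillation does not see a common rotation: the centre of
  the disc may drift, its radius is what counts.

  The series of the theorem weighs the edges between two given vertices by \<open>1 / M\<close>, the
  measure by their mass. Exact rank puts mass at least \<delta> on every vertex; with stability
  between consecutive levels this makes the two weights comparable, with constants
  \<open>\<delta>\<^sup>2 / 2\<close> and \<open>1\<close>.

  Signs: \<open>f \<circ> T = \<lambda> f\<close> attaches to an edge the power of \<lambda> with
  exponent minus its inner product with the heights, the negative of what the series contains.
  Conjugate unit numbers are equally far from 1, so both signs give the same defects.\<close>

definition climb :: "('v, 'e) ordered_bratteli \<Rightarrow> nat \<Rightarrow> 'e \<Rightarrow> nat" where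
  "climb B n e = (\<Sum>e' \<in> {e' \<in> edges B (Suc n). edge_less B e e'}. height B n (src B e'))"

locale ordered_bv =
  fixes B :: "('v, 'e) ordered_bratteli"
  assumes ordered: "ordered_diagram B"
begin

lemma
  shows finite_verts: "finite (verts B n)"
    and verts_disjoint: "m \<noteq> n \<Longrightarrow> verts B m \<inter> verts B n = {}"
    and finite_edges: "1 \<le> n \<Longrightarrow> finite (edges B n)"
    and src_verts: "e \<in> edges B (Suc n) \<Longrightarrow> src B e \<in> verts B n"
    and rng_verts: "1 \<le> n \<Longrightarrow> e \<in> edges B n \<Longrightarrow> rng B e \<in> verts B n"
    and ex_in: "1 \<le> n \<Longrightarrow> v \<in> verts B n \<Longrightarrow> \<exists>e \<in> edges B n. rng B e = v"
proof -
  have B: "\<forall>n. finite (verts B n)" "\<forall>m n. m \<noteq> n \<longrightarrow> verts B m \<inter> verts B n = {}"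
     "\<forall>n\<ge>1. finite (edges B n)"
     "\<forall>n\<ge>1. \<forall>e \<in> edges B n. src B e \<in> verts B (n - 1) \<and> rng B e \<in> verts B n"
     "\<forall>n\<ge>1. \<forall>v \<in> verts B n. \<exists>e \<in> edges B n. rng B e = v"
    using ordered unfolding ordered_diagram_def bratteli_diagram_def by - (elim conjE, assumption)+
  show "finite (verts B n)" by (simp add: B(1))
  show "m \<noteq> n \<Longrightarrow> verts B m \<inter> verts B n = {}" by (simp add: B(2))
  show "1 \<le> n \<Longrightarrow> finite (edges B n)" by (simp add: B(3))
  show "e \<in> edges B (Suc n) \<Longrightarrow> src B e \<in> verts B n" using B(4)[rule_format, of "Suc n" e] by simp
  show "1 \<le> n \<Longrightarrow> e \<in> edges B n \<Longrightarrow> rng B e \<in> verts B n" by (simp add: B(4))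
  show "1 \<le> n \<Longrightarrow> v \<in> verts B n \<Longrightarrow> \<exists>e \<in> edges B n. rng B e = v" by (simp add: B(5))
qed

lemma all_edgesI: "1 \<le> n \<Longrightarrow> e \<in> edges B n \<Longrightarrow> e \<in> all_edges B"
  by (auto simp: all_edges_def)

text \<open>Distinct vertex levels are disjoint, so the range of an edge fixes its level. This
  localises the order, a single relation on all edges, to one level at a time.\<close>

lemma edge_level:
  assumes "e \<in> all_edges B" "1 \<le> n" "rng B e \<in> verts B n"
  shows "e \<in> edges B n"
proof -
  obtain m where m: "m \<ge> 1" "e \<in> edges B m" using assms(1) by (auto simp: all_edges_def)
  then have "rng B e \<in> verts B m" by (simp add: rng_verts)
  then have "m = n" using verts_disjoint[of m n] assms(3) by blast
  then show ?thesis using m by simp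
qed

lemma
  shows less_edges: "edge_less B e f \<Longrightarrow> e \<in> all_edges B \<and> f \<in> all_edges B"
    and less_rng: "edge_less B e f \<Longrightarrow> rng B e = rng B f"
    and less_trans: "edge_less B e f \<Longrightarrow> edge_less B f g \<Longrightarrow> edge_less B e g"
    and less_irrefl: "\<not> edge_less B e e"
    and less_asym: "edge_less B e f \<Longrightarrow> \<not> edge_less B f e"
    and less_linear: "e \<in> all_edges B \<Longrightarrow> f \<in> all_edges B \<Longrightarrow> rng B e = rng B f \<Longrightarrow>
           e = f \<or> edge_less B e f \<or> edge_less B f e"
proof -
  have po: "partial_order_on (all_edges B) (edge_ord B)"
    and comp: "\<And>e f. e \<in> all_edges B \<Longrightarrow> f \<in> all_edges B \<Longrightarrow>
        (e, f) \<in> edge_ord B \<or> (f, e) \<in> edge_ord B \<longleftrightarrow> rng B e = rng B f"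
    using ordered unfolding ordered_diagram_def by blast+
  note po' = partial_order_onD[OF po]
  show *: "edge_less B e f \<Longrightarrow> e \<in> all_edges B \<and> f \<in> all_edges B"
    using po'(4) by (auto simp: edge_less_def)
  show "edge_less B e f \<Longrightarrow> rng B e = rng B f"
    using * comp by (auto simp: edge_less_def)
  show "edge_less B e f \<Longrightarrow> edge_less B f g \<Longrightarrow> edge_less B e g"
    using po'(2,3) unfolding edge_less_def by (meson antisymD transD)
  show "edge_less B e f \<Longrightarrow> \<not> edge_less B f e"
    using po'(3) unfolding edge_less_def by (meson antisymD)
  show "e \<in> all_edges B \<Longrightarrow> f \<in> all_edges B \<Longrightarrow> rng B e = rng B f \<Longrightarrow>
           e = f \<or> edge_less B e f \<or> edge_less B f e"
    using comp by (auto simp: edge_less_def)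
qed (simp add: edge_less_def)

lemma less_level:
  assumes "1 \<le> n" "edge_less B e f"
  shows "e \<in> edges B n \<longleftrightarrow> f \<in> edges B n"
  by (metis assms edge_level less_edges less_rng rng_verts)

lemma not_max_edge: "e \<in> all_edges B \<Longrightarrow> \<not> max_edge B e \<longleftrightarrow> (\<exists>f. edge_less B e f)"
  by (auto simp: max_edge_def)

lemma min_edge_less:
  assumes "min_edge B e" "f \<in> all_edges B" "rng B e = rng B f" "e \<noteq> f"
  shows "edge_less B e f"
  using assms less_linear[of e f] by (auto simp: min_edge_def)

lemma ex_min_in_set:
  assumes "finite F" "F \<noteq> {}" "\<And>e. e \<in> F \<Longrightarrow> e \<in> all_edges B \<and> rng B e = v"
  shows "\<exists>e \<in> F. \<forall>f \<in> F. f \<noteq> e \<longrightarrow> edge_less B e f"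
  using assms
proof (induction F rule: finite_ne_induct)
  case (insert x F)
  then obtain e where e: "e \<in> F" "\<forall>f \<in> F. f \<noteq> e \<longrightarrow> edge_less B e f" by auto
  have "x = e \<or> edge_less B x e \<or> edge_less B e x"
    using less_linear[of x e] insert.prems[of x] insert.prems[of e] e(1) by auto
  then show ?case using e less_trans by (metis insert_iff)
qed auto

lemma ex_min_edge:
  assumes "1 \<le> n" "v \<in> verts B n"
  shows "\<exists>e \<in> edges B n. rng B e = v \<and> min_edge B e"
proof -
  let ?F = "{e \<in> edges B n. rng B e = v}"
  obtain e where e: "e \<in> ?F" "\<forall>f \<in> ?F. f \<noteq> e \<longrightarrow> edge_less B e f"
    using ex_min_in_set[of ?F v] finite_edges[OF assms(1)] ex_in[OF assms] all_edgesI[OF assms(1)]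
    by fastforce
  have "\<not> edge_less B f e" for f
    using e less_level[OF assms(1)] less_rng less_asym less_irrefl by (metis (mono_tags, lifting) mem_Collect_eq)
  then show ?thesis using e(1) all_edgesI[OF assms(1)] by (auto simp: min_edge_def)
qed

text \<open>The edges above \<open>e\<close> share its range and form a finite chain. Its least
  element is what the definite description selects; antisymmetry makes it unique.\<close>

lemma edge_succ:
  assumes "e \<in> all_edges B" "\<not> max_edge B e"
  shows "edge_less B e (edge_succ B e)"
    and "edge_less B e g \<Longrightarrow> g = edge_succ B e \<or> edge_less B (edge_succ B e) g"
proof -
  obtain n where n: "n \<ge> 1" "e \<in> edges B n" using assms(1) by (auto simp: all_edges_def)
  let ?F = "{f. edge_less B e f}"
  have "?F \<subseteq> edges B n" using less_level n by blast
  then have fin: "finite ?F" using finite_edges[OF n(1)] finite_subset by blast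
  obtain f where f: "f \<in> ?F" "\<forall>g \<in> ?F. g \<noteq> f \<longrightarrow> edge_less B f g"
    using ex_min_in_set[of ?F "rng B e"] fin less_edges less_rng not_max_edge[OF assms(1)] assms(2)
    by (metis (mono_tags, lifting) empty_Collect_eq mem_Collect_eq)
  have refl: "(h, h) \<in> edge_ord B" if "h \<in> all_edges B" for h
    using ordered that partial_order_onD(1) unfolding ordered_diagram_def refl_on_def by blast
  have "edge_succ B e = f"
    unfolding edge_succ_def
  proof (rule the_equality)
    show "edge_less B e f \<and> (\<forall>g. edge_less B e g \<longrightarrow> (f, g) \<in> edge_ord B)"
      using f refl less_edges by (auto simp: edge_less_def)
  next
    fix h assume h: "edge_less B e h \<and> (\<forall>g. edge_less B e g \<longrightarrow> (h, g) \<in> edge_ord B)"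
    then show "h = f" using f less_asym by (metis edge_less_def mem_Collect_eq)
  qed
  then show "edge_less B e (edge_succ B e)"
    and "edge_less B e g \<Longrightarrow> g = edge_succ B e \<or> edge_less B (edge_succ B e) g"
    using f by auto
qed

section \<open>Finite paths, heights and the tiling of a tower by incoming edges\<close>

lemma finite_fin_paths: "finite (fin_paths B m n)"
proof -
  have "finite (\<Pi>\<^sub>E i \<in> {m<..n}. edges B i)"
    by (intro finite_PiE) (auto intro!: finite_edges)
  then show ?thesis unfolding fin_paths_def by (rule finite_subset[rotated]) auto
qed

lemma finite_paths_to: "finite (paths_to B n v)"
  unfolding paths_to_def using finite_fin_paths by (rule finite_subset[rotated]) auto

lemma paths_to_iff:
  assumes "1 \<le> n"
  shows "p \<in> paths_to B n v \<longleftrightarrow> p \<in> extensional {0<..n} \<and> (\<forall>i \<in> {0<..n}. p i \<in> edges B i) \<and>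
     (\<forall>i \<in> {0<..<n}. rng B (p i) = src B (p (Suc i))) \<and> rng B (p n) = v"
  using assms by (auto simp: paths_to_def fin_paths_def PiE_def Pi_def)

lemma snoc_path:
  assumes "1 \<le> n" "e \<in> edges B (Suc n)" "p \<in> paths_to B n (src B e)"
  shows "p(Suc n := e) \<in> paths_to B (Suc n) (rng B e)"
  using assms by (auto simp: paths_to_iff extensional_def less_Suc_eq)

lemma paths_to_Suc_bij:
  assumes n: "1 \<le> n"
  shows "bij_betw (\<lambda>(e, p). p(Suc n := e))
    (SIGMA e:{e \<in> edges B (Suc n). rng B e = v}. paths_to B n (src B e)) (paths_to B (Suc n) v)"
proof (rule bij_betw_byWitness[where f' = "\<lambda>p. (p (Suc n), p(Suc n := undefined))"])
  show "\<forall>a\<in>SIGMA e:{e \<in> edges B (Suc n). rng B e = v}. paths_to B n (src B e).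
       (((\<lambda>(e, p). p(Suc n := e)) a) (Suc n), ((\<lambda>(e, p). p(Suc n := e)) a)(Suc n := undefined)) = a"
    using n by (auto simp: paths_to_iff extensional_def fun_eq_iff)
  show "(\<lambda>(e, p). p(Suc n := e)) ` (SIGMA e:{e \<in> edges B (Suc n). rng B e = v}. paths_to B n (src B e))
      \<subseteq> paths_to B (Suc n) v"
    using snoc_path[OF n] by auto
  show "(\<lambda>p. (p (Suc n), p(Suc n := undefined))) ` paths_to B (Suc n) v
      \<subseteq> (SIGMA e:{e \<in> edges B (Suc n). rng B e = v}. paths_to B n (src B e))"
    using n by (auto simp: paths_to_iff extensional_def)
qed auto

lemma height_Suc:
  assumes "1 \<le> n"
  shows "height B (Suc n) v = (\<Sum>e \<in> {e \<in> edges B (Suc n). rng B e = v}. height B n (src B e))"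
  unfolding height_def
  using bij_betw_same_card[OF paths_to_Suc_bij[OF assms, of v]] finite_paths_to finite_edges[of "Suc n"]
  by (simp add: card_SigmaI)

text \<open>Grouping the later edges by source turns the inner product with the heights into a sum
  over edges. Thus \<open>climb\<close> counts, for \<open>n \<ge> 1\<close>, the paths from the top
  vertex whose last edge comes after the given one.\<close>

lemma inner_height_suffix_vec:
  "inner_height B n (suffix_vec B n x) = real (climb B n (x (Suc n)))"
proof -
  let ?F = "{e' \<in> edges B (Suc n). edge_less B (x (Suc n)) e'}"
  have "finite ?F" using finite_edges[of "Suc n"] by auto
  then have "climb B n (x (Suc n)) = (\<Sum>w \<in> verts B n. \<Sum>e' \<in> {e' \<in> ?F. src B e' = w}. height B n (src B e'))"
    unfolding climb_def
    by (intro sum.group[symmetric] finite_verts) (auto intro: src_verts)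
  also have "\<dots> = (\<Sum>w \<in> verts B n. suffix_vec B n x w * height B n w)"
    by (intro sum.cong refl) (simp add: suffix_vec_def conj_assoc)
  finally show ?thesis by (simp add: inner_height_def)
qed

lemma climb_max: "max_edge B e \<Longrightarrow> climb B n e = 0"
  by (simp add: climb_def max_edge_def)

lemma climb_less:
  assumes "edge_less B e f" "e \<in> edges B (Suc n)"
  shows "climb B n f + height B n (src B f) \<le> climb B n e"
proof -
  have f: "f \<in> edges B (Suc n)" using less_level[OF _ assms(1), of "Suc n"] assms(2) by simp
  have "climb B n f + height B n (src B f) =
     (\<Sum>e' \<in> insert f {e' \<in> edges B (Suc n). edge_less B f e'}. height B n (src B e'))"
    unfolding climb_def using finite_edges[of "Suc n"] less_irrefl by (subst sum.insert) auto
  also have "\<dots> \<le> climb B n e"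
    unfolding climb_def using finite_edges[of "Suc n"] f assms(1) less_trans
    by (intro sum_mono2) auto
  finally show ?thesis .
qed

lemma climb_succ:
  assumes "e \<in> edges B (Suc n)" "\<not> max_edge B e"
  shows "climb B n e = climb B n (edge_succ B e) + height B n (src B (edge_succ B e))"
proof -
  let ?f = "edge_succ B e"
  have e: "e \<in> all_edges B" using assms(1) all_edgesI[of "Suc n"] by simp
  note s = edge_succ[OF e assms(2)]
  have f: "?f \<in> edges B (Suc n)" using less_level[OF _ s(1), of "Suc n"] assms(1) by simp
  have "{e' \<in> edges B (Suc n). edge_less B e e'} = insert ?f {e' \<in> edges B (Suc n). edge_less B ?f e'}"
    using s f less_trans by auto
  then show ?thesis
    unfolding climb_def using finite_edges[of "Suc n"] less_irrefl by (simp add: sum.insert)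
qed

text \<open>For edges with a common range, the intervals that start at \<open>climb B n e\<close>
  and have length \<open>height B n (src B e)\<close> tile the numbers below the height of the
  range. They appear in reverse order, the minimal edge occupying the last one.\<close>

lemma climb_height:
  assumes "1 \<le> n" "e \<in> edges B (Suc n)"
  shows "climb B n e + height B n (src B e) \<le> height B (Suc n) (rng B e)"
    and "min_edge B e \<Longrightarrow> climb B n e + height B n (src B e) = height B (Suc n) (rng B e)"
proof -
  let ?F = "insert e {e' \<in> edges B (Suc n). edge_less B e e'}"
  have eq: "climb B n e + height B n (src B e) = (\<Sum>e' \<in> ?F. height B n (src B e'))"
    unfolding climb_def using finite_edges[of "Suc n"] less_irrefl by (subst sum.insert) auto
  have sub: "?F \<subseteq> {e' \<in> edges B (Suc n). rng B e' = rng B e}"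
    using assms(2) less_rng by auto
  show "climb B n e + height B n (src B e) \<le> height B (Suc n) (rng B e)"
    unfolding eq height_Suc[OF assms(1)] using finite_edges[of "Suc n"]
    by (intro sum_mono2 sub) auto
  assume "min_edge B e"
  then have "e' \<in> ?F" if "e' \<in> edges B (Suc n)" "rng B e' = rng B e" for e'
    using min_edge_less[of e e'] that all_edgesI[of "Suc n" e'] by auto
  then have "?F = {e' \<in> edges B (Suc n). rng B e' = rng B e}"
    using sub by blast
  then show "climb B n e + height B n (src B e) = height B (Suc n) (rng B e)"
    unfolding eq height_Suc[OF assms(1)] by simp
qed

text \<open>
  Digits of a mixed radix expansion: the edge is recovered from \<open>climb\<close> plus a remainder.
\<close>
lemma climb_digit:
  assumes "e \<in> edges B (Suc n)" "f \<in> edges B (Suc n)" "rng B e = rng B f"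
    and "i < height B n (src B e)" "j < height B n (src B f)" "climb B n e + i = climb B n f + j"
  shows "e = f"
  using less_linear[of e f] climb_less[of e f n] climb_less[of f e n] assms all_edgesI[of "Suc n"]
  by fastforce

end

section \<open>Return times and the Vershik map\<close>

text \<open>
  The number of iterates of the Vershik map that lead from \<open>x\<close> to the top of its tower at level \<open>n\<close>.
\<close>
definition return_time :: "('v, 'e) ordered_bratteli \<Rightarrow> nat \<Rightarrow> (nat \<Rightarrow> 'e) \<Rightarrow> nat" where
  "return_time B n x = (\<Sum>k \<in> {1..<n}. climb B k (x (Suc k)))"

text \<open>A floor of the Kakutani-Rokhlin tower over \<open>v\<close>, numbered from the top:
  floor \<open>0\<close> consists of the paths that are maximal up to level
  \<open>n\<close>.\<close>

definition cell :: "('v, 'e) ordered_bratteli \<Rightarrow> nat \<Rightarrow> 'v \<Rightarrow> nat \<Rightarrow> (nat \<Rightarrow> 'e) set" where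
  "cell B n v j = {x \<in> inf_paths B. tau B n x = v \<and> return_time B n x = j}"

lemma return_time_Suc:
  "1 \<le> n \<Longrightarrow> return_time B (Suc n) x = return_time B n x + climb B n (x (Suc n))"
  by (simp add: return_time_def)

lemma return_time_1: "return_time B (Suc 0) x = 0"
  by (simp add: return_time_def)

text \<open>Invariance of the path space under the Vershik map is taken as an assumption because the
  conjugacy with \<open>T\<close> supplies it.\<close>

locale proper_bv = ordered_bv +
  assumes proper: "properly_ordered B"
    and height_1: "v \<in> verts B 1 \<Longrightarrow> height B 1 v = 1"
    and vershik_inf_paths: "x \<in> inf_paths B \<Longrightarrow> vershik B x \<in> inf_paths B"
begin

lemma
  assumes "x \<in> inf_paths B" "1 \<le> i"
  shows inf_path_edge: "x i \<in> edges B i"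
    and inf_path_all_edges: "x i \<in> all_edges B"
    and inf_path_src: "src B (x (Suc i)) = tau B i x"
    and tau_verts: "tau B i x \<in> verts B i"
proof -
  show 1: "x i \<in> edges B i" using assms by (auto simp: inf_paths_def PiE_def Pi_def)
  then show "x i \<in> all_edges B" using all_edgesI assms(2) by blast
  show "src B (x (Suc i)) = tau B i x" using assms by (auto simp: inf_paths_def tau_def)
  show "tau B i x \<in> verts B i" using rng_verts[OF assms(2) 1] by (simp add: tau_def)
qed

lemma inf_path_edge_Suc: "x \<in> inf_paths B \<Longrightarrow> x (Suc n) \<in> edges B (Suc n)"
  by (simp add: inf_path_edge)

lemma inf_paths_eqI:
  assumes "x \<in> inf_paths B" "y \<in> inf_paths B" "\<And>i. 1 \<le> i \<Longrightarrow> x i = y i"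
  shows "x = y"
proof
  fix i show "x i = y i"
    using assms by (cases "1 \<le> i") (auto simp: inf_paths_def PiE_def extensional_def)
qed

lemma return_time_less:
  assumes "1 \<le> n" "x \<in> inf_paths B"
  shows "return_time B n x < height B n (tau B n x)"
  using assms(1)
proof (induction n rule: nat_induct_at_least)
  case base
  then show ?case using height_1[of "tau B 1 x"] tau_verts[OF assms(2), of 1] by (simp add: return_time_1)
next
  case (Suc n)
  then show ?case
    using climb_height(1)[OF Suc(1) inf_path_edge_Suc[OF assms(2)]] inf_path_src[OF assms(2) Suc(1)]
    by (simp add: return_time_Suc tau_def)
qed

lemma return_time_min:
  assumes "1 \<le> n" "x \<in> inf_paths B" "\<And>i. 1 \<le> i \<Longrightarrow> i \<le> n \<Longrightarrow> min_edge B (x i)"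
  shows "return_time B n x + 1 = height B n (tau B n x)"
  using assms(1,3)
proof (induction n rule: nat_induct_at_least)
  case base
  then show ?case using height_1[of "tau B 1 x"] tau_verts[OF assms(2), of 1] by (simp add: return_time_1)
next
  case (Suc n)
  then show ?case
    using climb_height(2)[OF Suc(1) inf_path_edge_Suc[OF assms(2)]] inf_path_src[OF assms(2) Suc(1)]
    by (simp add: return_time_Suc tau_def)
qed

lemma return_time_max:
  assumes "\<And>i. 1 \<le> i \<Longrightarrow> i \<le> n \<Longrightarrow> max_edge B (x i)"
  shows "return_time B n x = 0"
  using assms climb_max by (simp add: return_time_def)

lemma unique_edge_1:
  assumes "e \<in> edges B 1" "f \<in> edges B 1" "rng B e = rng B f"
  shows "e = f"
proof -
  have path: "(\<lambda>i. undefined)(1 := g) \<in> paths_to B 1 (rng B g)" if "g \<in> edges B 1" for g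
    using that by (auto simp: paths_to_iff extensional_def le_Suc_eq)
  have "card (paths_to B 1 (rng B e)) = 1"
    using height_1[of "rng B e"] rng_verts[of 1 e] assms by (simp add: height_def)
  then have "(\<lambda>i. undefined)(1::nat := e) = (\<lambda>i. undefined)(1 := f)"
    using path[OF assms(1)] path[OF assms(2)] assms(3) by (metis card_1_singletonE singletonD)
  then show ?thesis by (metis fun_upd_same)
qed

lemma
  assumes "e \<in> edges B 1"
  shows max_edge_1: "max_edge B e" and min_edge_1: "min_edge B e"
proof -
  have e: "e \<in> all_edges B" using assms all_edgesI by blast
  have "\<not> edge_less B e f \<and> \<not> edge_less B f e" for f
    using unique_edge_1[OF assms, of f] less_level[of 1 e f] less_level[of 1 f e]
      less_rng[of e f] less_rng[of f e] less_irrefl assms by (metis order_refl)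
  then show "max_edge B e" "min_edge B e" using e by (auto simp: max_edge_def min_edge_def)
qed

section \<open>Minimal paths and the action of the Vershik map on towers\<close>

lemma ex_min_path:
  assumes "1 \<le> n" "v \<in> verts B n"
  shows "\<exists>p \<in> paths_to B n v. \<forall>i \<in> {0<..n}. min_edge B (p i)"
  using assms
proof (induction n arbitrary: v rule: nat_induct_at_least)
  case base
  obtain e where "e \<in> edges B 1" "rng B e = v" using ex_in base by blast
  then show ?case using min_edge_1
    by (intro bexI[of _ "(\<lambda>i. undefined)(1 := e)"]) (auto simp: paths_to_iff extensional_def le_Suc_eq)
next
  case (Suc n)
  obtain e where e: "e \<in> edges B (Suc n)" "rng B e = v" "min_edge B e"
    using ex_min_edge[of "Suc n" v] Suc by auto
  obtain p where "p \<in> paths_to B n (src B e)" "\<forall>i \<in> {0<..n}. min_edge B (p i)"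
    using Suc.IH[OF src_verts[OF e(1)]] by blast
  then show ?case using snoc_path[OF Suc(1) e(1)] e
    by (intro bexI[of _ "p(Suc n := e)"]) auto
qed

text \<open>The edgewise minimal path lies below every other path to \<open>v\<close>, since the
  last edges at which they differ are comparable. Hence no other path fits the definite
  description.\<close>

lemma min_path_to:
  assumes "1 \<le> n" "v \<in> verts B n"
  shows "min_path_to B n v \<in> paths_to B n v"
    and "i \<in> {0<..n} \<Longrightarrow> min_edge B (min_path_to B n v i)"
proof -
  obtain p where p: "p \<in> paths_to B n v" "\<forall>i \<in> {0<..n}. min_edge B (p i)"
    using ex_min_path[OF assms] by blast
  have no_less: "\<not> path_less B 0 n q p" for q
    using p(2) by (auto simp: path_less_def min_edge_def)
  have less: "path_less B 0 n p q" if q: "q \<in> paths_to B n v" "q \<noteq> p" for q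
  proof -
    have "\<exists>i \<in> {0<..n}. p i \<noteq> q i"
      using p(1) q unfolding paths_to_iff[OF assms(1)] by (metis extensionalityI)
    then have ne: "{i \<in> {0<..n}. p i \<noteq> q i} \<noteq> {}" by auto
    define i where "i = Max {i \<in> {0<..n}. p i \<noteq> q i}"
    have i: "i \<in> {0<..n}" "p i \<noteq> q i" using Max_in[OF _ ne] by (auto simp: i_def)
    have above: "p j = q j" if j: "j \<in> {i<..n}" for j
    proof (rule ccontr)
      assume "p j \<noteq> q j"
      then have "j \<le> i" using j i(1) unfolding i_def by (intro Max_ge) auto
      then show False using j by simp
    qed
    have pq: "p \<in> fin_paths B 0 n" "q \<in> fin_paths B 0 n" using p(1) q(1) by (auto simp: paths_to_def)
    \<comment> \<open>Above \<open>i\<close> the paths agree, so their edges at \<open>i\<close> end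
      either in \<open>v\<close> or in the source of a common next edge; only then does minimality
      of \<open>p i\<close> yield a comparison.\<close>
    have "rng B (p i) = rng B (q i)"
    proof (cases "i = n")
      case True
      then show ?thesis using p(1) q(1) assms(1) by (simp add: paths_to_iff)
    next
      case False
      then have "rng B (p i) = src B (p (Suc i))" "rng B (q i) = src B (q (Suc i))" "Suc i \<in> {i<..n}"
        using p(1) q(1) i(1) by (auto simp: paths_to_iff[OF assms(1)])
      then show ?thesis using above by metis
    qed
    moreover have "q i \<in> all_edges B"
      using q(1) i(1) all_edgesI[of i] by (auto simp: paths_to_iff[OF assms(1)])
    ultimately have "edge_less B (p i) (q i)"
      using min_edge_less[of "p i" "q i"] p(2) i by auto
    then show ?thesis using pq i(1) above by (auto simp: path_less_def)
  qed
  have "min_path_to B n v = p"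
    unfolding min_path_to_def using p(1) no_less less by (intro the_equality) blast+
  then show "min_path_to B n v \<in> paths_to B n v"
    and "i \<in> {0<..n} \<Longrightarrow> min_edge B (min_path_to B n v i)"
    using p by auto
qed

lemma all_max_eqD: "all_max B x \<Longrightarrow> x = x_max B"
  and all_max_x_max: "all_max B (x_max B)"
  and all_min_x_min: "all_min B (x_min B)"
  using proper the1_equality[of "all_max B" x] theI'[of "all_max B"] theI'[of "all_min B"]
  unfolding properly_ordered_def x_max_def x_min_def by auto

text \<open>Every edge of level 1 is alone in its range and therefore maximal. So the first
  nonmaximal edge has level \<open>m \<ge> 2\<close>, and the minimal path put below its successor
  reaches a level that is at least 1.\<close>

lemma vershik_not_max:
  assumes "x \<in> inf_paths B" "x \<noteq> x_max B"
  obtains m where "2 \<le> m" "\<not> max_edge B (x m)" "\<And>i. 1 \<le> i \<Longrightarrow> i < m \<Longrightarrow> max_edge B (x i)"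
    "vershik B x m = edge_succ B (x m)" "\<And>i. m < i \<Longrightarrow> vershik B x i = x i"
    "\<And>i. 1 \<le> i \<Longrightarrow> i < m \<Longrightarrow> min_edge B (vershik B x i)"
proof -
  define m where "m = (LEAST n. n \<ge> 1 \<and> \<not> max_edge B (x n))"
  have "\<exists>n. n \<ge> 1 \<and> \<not> max_edge B (x n)"
    using assms all_max_eqD by (auto simp: all_max_def)
  then have m: "m \<ge> 1" "\<not> max_edge B (x m)" unfolding m_def by (metis (mono_tags, lifting) LeastI)+
  have below: "max_edge B (x i)" if "1 \<le> i" "i < m" for i
    using not_less_Least[of i "\<lambda>n. n \<ge> 1 \<and> \<not> max_edge B (x n)"] that by (auto simp: m_def)
  have "m \<noteq> 1" using m max_edge_1 inf_path_edge[OF assms(1)] by metis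
  then have m2: "2 \<le> m" using m by simp
  let ?y = "edge_succ B (x m)"
  have V: "vershik B x i = (if i < m then min_path_to B (m - 1) (src B ?y) i else if i = m then ?y else x i)" for i
    using assms(2) by (simp add: vershik_def Let_def m_def)
  have xm: "x m \<in> all_edges B" "x m \<in> edges B m" using inf_path_edge[OF assms(1) m(1)] all_edgesI m(1) by auto
  have "?y \<in> edges B m" using less_level[OF m(1) edge_succ(1)[OF xm(1) m(2)]] xm(2) by simp
  then have "src B ?y \<in> verts B (m - 1)" using src_verts[of ?y "m - 1"] m(1) by simp
  then have "min_edge B (vershik B x i)" if "1 \<le> i" "i < m" for i
    using min_path_to(2)[of "m - 1" "src B ?y" i] that m2 V by auto
  then show ?thesis using that[of m] m2 m(2) below V by auto
qed

text \<open>Below the changed edge at level \<open>m\<close>, maximal edges (return time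
  \<open>0\<close>) become minimal ones (return time one less than the height). At level
  \<open>m\<close> the successor lowers \<open>climb\<close> by exactly that height, for a net
  change of one. Levels below \<open>m\<close> see a jump from the top of a tower to the bottom of
  one.\<close>

lemma vershik_return_time:
  assumes x: "x \<in> inf_paths B" and n: "1 \<le> n"
  shows "tau B n (vershik B x) = tau B n x \<and> return_time B n x = return_time B n (vershik B x) + 1 \<or>
    return_time B n x = 0 \<and> return_time B n (vershik B x) + 1 = height B n (tau B n (vershik B x)) \<and>
    (\<forall>i \<in> {1..n}. max_edge B (x i))"
proof (cases "x = x_max B")
  case True
  then have "vershik B x = x_min B" by (simp add: vershik_def)
  then show ?thesis
    using all_min_x_min True all_max_x_max return_time_min[OF n, of "x_min B"] return_time_max[of n x]
    by (auto simp: all_max_def all_min_def)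
next
  case False
  note y = vershik_inf_paths[OF x]
  obtain m where m: "2 \<le> m" "\<not> max_edge B (x m)" "\<And>i. 1 \<le> i \<Longrightarrow> i < m \<Longrightarrow> max_edge B (x i)"
    "vershik B x m = edge_succ B (x m)" "\<And>i. m < i \<Longrightarrow> vershik B x i = x i"
    "\<And>i. 1 \<le> i \<Longrightarrow> i < m \<Longrightarrow> min_edge B (vershik B x i)"
    using vershik_not_max[OF x False] by blast
  show ?thesis
  proof (cases "n < m")
    case True
    then show ?thesis
      using m return_time_min[OF n y] return_time_max[of n x] by auto
  next
    case False
    then have "m \<le> n" by simp
    then have "tau B n (vershik B x) = tau B n x \<and> return_time B n x = return_time B n (vershik B x) + 1"
    proof (induction n rule: nat_induct_at_least)
      case base
      obtain k where k: "m = Suc k" "1 \<le> k" using m(1) by (cases m) auto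
      have xm: "x m \<in> edges B (Suc k)" "x m \<in> all_edges B"
        using inf_path_edge[OF x, of m] inf_path_all_edges[OF x, of m] k by auto
      have "return_time B k x = 0" using return_time_max[of k x] m(3) k by auto
      moreover have "return_time B k (vershik B x) + 1 = height B k (tau B k (vershik B x))"
        using return_time_min[OF k(2) y] m(6) k by auto
      moreover have "tau B k (vershik B x) = src B (edge_succ B (x m))"
        using inf_path_src[OF y k(2)] m(4) k by simp
      ultimately have "return_time B m x = return_time B m (vershik B x) + 1"
        using climb_succ[OF xm(1) m(2)] m(4) by (simp add: k(1) return_time_Suc[OF k(2)])
      moreover have "tau B m (vershik B x) = tau B m x"
        using m(4) less_rng[OF edge_succ(1)[OF xm(2) m(2)]] by (simp add: tau_def)
      ultimately show ?case by simp
    next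
      case (Suc k)
      then show ?case using m(5)[of "Suc k"] m(1) by (simp add: return_time_Suc tau_def)
    qed
    then show ?thesis by simp
  qed
qed

text \<open>The condition on \<open>j\<close> keeps the floor off the bottom of its tower, and
  bottom floors are the only ones entered from the tops of towers.\<close>

lemma vershik_vimage_cell:
  assumes "1 \<le> n" "Suc j < height B n v"
  shows "{x \<in> inf_paths B. vershik B x \<in> cell B n v j} = cell B n v (Suc j)"
proof (intro set_eqI)
  fix x
  show "x \<in> {x \<in> inf_paths B. vershik B x \<in> cell B n v j} \<longleftrightarrow> x \<in> cell B n v (Suc j)"
    using vershik_return_time[OF _ assms(1), of x] vershik_inf_paths[of x] assms(2)
    by (cases "x \<in> inf_paths B") (auto simp: cell_def)
qed

lemma vershik_eventually:
  assumes "x \<in> inf_paths B" "x \<noteq> x_max B"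
  shows "\<exists>m. \<forall>n\<ge>m. tau B n (vershik B x) = tau B n x \<and> return_time B n x = return_time B n (vershik B x) + 1"
proof -
  obtain m where m: "2 \<le> m" "\<not> max_edge B (x m)"
    by (rule vershik_not_max[OF assms]) (rule that)
  show ?thesis
  proof (intro exI allI impI)
    fix n assume "m \<le> n"
    then have "1 \<le> n" "m \<in> {1..n}" using m(1) by auto
    then show "tau B n (vershik B x) = tau B n x \<and> return_time B n x = return_time B n (vershik B x) + 1"
      using vershik_return_time[OF assms(1), of n] m(2) by blast
  qed
qed

lemma cell_Suc_edge:
  assumes "1 \<le> n" "e \<in> edges B (Suc n)" "j < height B n (src B e)"
    and x: "x \<in> cell B (Suc n) (rng B e) (climb B n e + j)"
  shows "x (Suc n) = e" "x \<in> cell B n (src B e) j"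
proof -
  have x': "x \<in> inf_paths B" "rng B (x (Suc n)) = rng B e"
    "climb B n (x (Suc n)) + return_time B n x = climb B n e + j"
    using x assms(1) by (auto simp: cell_def tau_def return_time_Suc)
  then show "x (Suc n) = e"
    using climb_digit[OF inf_path_edge_Suc[OF x'(1)] assms(2) x'(2), of "return_time B n x" j]
      return_time_less[OF assms(1) x'(1)] inf_path_src[OF x'(1) assms(1)] assms(3) by simp
  then show "x \<in> cell B n (src B e) j"
    using x' inf_path_src[OF x'(1) assms(1)] by (auto simp: cell_def)
qed

lemma cell_Suc_return:
  assumes "1 \<le> n" "x \<in> cell B n u j"
  shows "x \<in> cell B (Suc n) (rng B (x (Suc n))) (climb B n (x (Suc n)) + j)" "src B (x (Suc n)) = u"
  using assms inf_path_src[of x n] by (auto simp: cell_def return_time_Suc tau_def)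

text \<open>The next edge cuts a floor into floors of the following level. The return time there
  recovers that edge, by uniqueness of digits, so the pieces are disjoint.\<close>

lemma cell_split:
  assumes "1 \<le> n" "j < height B n u"
  shows "cell B n u j = (\<Union>e \<in> {e \<in> edges B (Suc n). src B e = u}. cell B (Suc n) (rng B e) (climb B n e + j))"
    and "disjoint_family_on (\<lambda>e. cell B (Suc n) (rng B e) (climb B n e + j)) {e \<in> edges B (Suc n). src B e = u}"
proof -
  have "x \<in> cell B n u j \<longleftrightarrow>
      (\<exists>e \<in> edges B (Suc n). src B e = u \<and> x \<in> cell B (Suc n) (rng B e) (climb B n e + j))" for x
  proof
    assume x: "x \<in> cell B n u j"
    then have "x (Suc n) \<in> edges B (Suc n)" by (simp add: cell_def inf_path_edge_Suc)
    then show "\<exists>e \<in> edges B (Suc n). src B e = u \<and> x \<in> cell B (Suc n) (rng B e) (climb B n e + j)"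
      using cell_Suc_return[OF assms(1) x] by blast
  next
    assume "\<exists>e \<in> edges B (Suc n). src B e = u \<and> x \<in> cell B (Suc n) (rng B e) (climb B n e + j)"
    then obtain e where e: "e \<in> edges B (Suc n)" "src B e = u"
      "x \<in> cell B (Suc n) (rng B e) (climb B n e + j)" by blast
    then show "x \<in> cell B n u j"
      using cell_Suc_edge(2)[OF assms(1) e(1) _ e(3)] assms(2) by simp
  qed
  then show "cell B n u j = (\<Union>e \<in> {e \<in> edges B (Suc n). src B e = u}. cell B (Suc n) (rng B e) (climb B n e + j))"
    by blast
  show "disjoint_family_on (\<lambda>e. cell B (Suc n) (rng B e) (climb B n e + j)) {e \<in> edges B (Suc n). src B e = u}"
    unfolding disjoint_family_on_def
  proof (intro ballI impI equals0I)
    fix e f x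
    assume "e \<in> {e \<in> edges B (Suc n). src B e = u}" "f \<in> {e \<in> edges B (Suc n). src B e = u}" "e \<noteq> f"
      and "x \<in> cell B (Suc n) (rng B e) (climb B n e + j) \<inter> cell B (Suc n) (rng B f) (climb B n f + j)"
    then show False
      using cell_Suc_edge(1)[OF assms(1), of e j x] cell_Suc_edge(1)[OF assms(1), of f j x] assms(2) by simp
  qed
qed

text \<open>Digits are peeled off from the last one: range and return time give the edge at level
  \<open>Suc n\<close> and leave a floor of level \<open>n\<close>. The induction ends at level 1,
  where only one edge enters each vertex.\<close>

lemma cell_determines:
  assumes "1 \<le> n" "x \<in> cell B n v j" "y \<in> cell B n v j" "1 \<le> i" "i \<le> n"
  shows "x i = y i"
  using assms
proof (induction n arbitrary: v j rule: nat_induct_at_least)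
  case base
  then have "x \<in> inf_paths B" "y \<in> inf_paths B" "rng B (x 1) = rng B (y 1)" "i = 1"
    by (auto simp: cell_def tau_def)
  then show ?case
    using unique_edge_1[of "x 1" "y 1"] inf_path_edge[of x 1] inf_path_edge[of y 1] by simp
next
  case (Suc n)
  define e where "e = x (Suc n)"
  define k where "k = return_time B n x"
  have x: "x \<in> inf_paths B" using Suc.prems by (simp add: cell_def)
  have e: "e \<in> edges B (Suc n)" "v = rng B e" "j = climb B n e + k" "k < height B n (src B e)"
    using Suc.prems Suc.hyps inf_path_edge_Suc[OF x, of n] return_time_less[OF Suc(1) x] inf_path_src[OF x Suc(1)]
    by (auto simp: cell_def return_time_Suc e_def k_def tau_def)
  have y: "y (Suc n) = e" "y \<in> cell B n (src B e) k"
    using cell_Suc_edge[OF Suc.hyps e(1,4)] Suc.prems e by auto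
  have x': "x \<in> cell B n (src B e) k"
    using x inf_path_src[OF x Suc(1)] by (auto simp: cell_def k_def e_def)
  show ?case
  proof (cases "i = Suc n")
    case True
    then show ?thesis using y by (simp add: e_def)
  next
    case False
    then show ?thesis using Suc.IH[OF x' y(2)] Suc.prems by simp
  qed
qed

end

section \<open>Energy of consistent families on a weighted graded graph\<close>

text \<open>
  \<open>h n u * q n u\<close> is the mass of the vertex \<open>u\<close> and \<open>h n (s e) * q (Suc n) (r e)\<close> that of the edge \<open>e\<close>.
  The set \<open>E n\<close> consists of the edges from level \<open>n\<close> to level \<open>n + 1\<close>.
\<close>
locale weighted_graph =
  fixes V :: "nat \<Rightarrow> 'v set" and E :: "nat \<Rightarrow> 'e set" and s r :: "'e \<Rightarrow> 'v"
    and h q :: "nat \<Rightarrow> 'v \<Rightarrow> real" and \<delta> :: real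
  assumes fin_V: "1 \<le> n \<Longrightarrow> finite (V n)" and fin_E: "1 \<le> n \<Longrightarrow> finite (E n)"
    and s_V: "1 \<le> n \<Longrightarrow> e \<in> E n \<Longrightarrow> s e \<in> V n"
    and r_V: "1 \<le> n \<Longrightarrow> e \<in> E n \<Longrightarrow> r e \<in> V (Suc n)"
    and h_pos: "1 \<le> n \<Longrightarrow> u \<in> V n \<Longrightarrow> 0 < h n u"
    and q_pos: "1 \<le> n \<Longrightarrow> u \<in> V n \<Longrightarrow> 0 < q n u"
    and q_split: "1 \<le> n \<Longrightarrow> u \<in> V n \<Longrightarrow> (\<Sum>e \<in> {e \<in> E n. s e = u}. q (Suc n) (r e)) = q n u"
    and h_split: "1 \<le> n \<Longrightarrow> v \<in> V (Suc n) \<Longrightarrow> (\<Sum>e \<in> {e \<in> E n. r e = v}. h n (s e)) = h (Suc n) v"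
    and total_mass: "1 \<le> n \<Longrightarrow> (\<Sum>u \<in> V n. h n u * q n u) = 1"
    and delta_pos: "0 < \<delta>"
    and mass_ge: "1 \<le> n \<Longrightarrow> u \<in> V n \<Longrightarrow> \<delta> \<le> h n u * q n u"
    and stable: "1 \<le> n \<Longrightarrow> u \<in> V n \<Longrightarrow> v \<in> V (Suc n) \<Longrightarrow>
      \<delta> / 2 < h n u / h (Suc n) v * real (card {e \<in> E n. s e = u \<and> r e = v})"
begin

definition weight :: "nat \<Rightarrow> 'e \<Rightarrow> real" where
  "weight n e = h n (s e) * q (Suc n) (r e)"

definition energy :: "nat \<Rightarrow> ('v \<Rightarrow> complex) \<Rightarrow> real" where
  "energy n g = (\<Sum>u \<in> V n. h n u * q n u * (cmod (g u))\<^sup>2)"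

text \<open>The martingale condition, with denominators cleared: \<open>g u\<close> is the mean of
  \<open>z e * g' (r e)\<close> over the edges leaving \<open>u\<close>, under the transition
  probabilities \<open>q (Suc n) (r e) / q n u\<close>.\<close>

definition consistent_step :: "nat \<Rightarrow> ('e \<Rightarrow> complex) \<Rightarrow> ('v \<Rightarrow> complex) \<Rightarrow> ('v \<Rightarrow> complex) \<Rightarrow> bool" where
  "consistent_step n z g g' \<longleftrightarrow> (\<forall>u \<in> V n.
     of_real (q n u) * g u = (\<Sum>e \<in> {e \<in> E n. s e = u}. of_real (q (Suc n) (r e)) * z e * g' (r e)))"

lemma sum_by_src: "1 \<le> n \<Longrightarrow> (\<Sum>e \<in> E n. f e) = (\<Sum>u \<in> V n. \<Sum>e \<in> {e \<in> E n. s e = u}. f e)"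
  and sum_by_rng: "1 \<le> n \<Longrightarrow> (\<Sum>e \<in> E n. f e) = (\<Sum>v \<in> V (Suc n). \<Sum>e \<in> {e \<in> E n. r e = v}. f e)"
  using fin_V[of n] fin_V[of "Suc n"] fin_E[of n] s_V r_V by (auto intro!: sum.group[symmetric])

lemma weight_pos: "1 \<le> n \<Longrightarrow> e \<in> E n \<Longrightarrow> 0 < weight n e"
  using h_pos[of n "s e"] q_pos[of "Suc n" "r e"] s_V[of n e] r_V[of n e] by (simp add: weight_def)

lemma sum_weight_rng:
  assumes "1 \<le> n"
  shows "(\<Sum>e \<in> E n. weight n e * f (r e)) = (\<Sum>v \<in> V (Suc n). h (Suc n) v * q (Suc n) v * f v)"
proof -
  have "(\<Sum>e \<in> E n. weight n e * f (r e)) =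
      (\<Sum>v \<in> V (Suc n). (\<Sum>e \<in> {e \<in> E n. r e = v}. h n (s e)) * (q (Suc n) v * f v))"
    unfolding sum_by_rng[OF assms] sum_distrib_right
    by (intro sum.cong refl) (auto simp: weight_def)
  also have "\<dots> = (\<Sum>v \<in> V (Suc n). h (Suc n) v * q (Suc n) v * f v)"
    using assms by (intro sum.cong refl) (simp add: h_split)
  finally show ?thesis .
qed

lemma sum_weight: "1 \<le> n \<Longrightarrow> (\<Sum>e \<in> E n. weight n e) = 1"
  using sum_weight_rng[of n "\<lambda>_. 1"] total_mass[of "Suc n"] by simp

lemma norm_diff_sq: "(cmod (a - b))\<^sup>2 = (cmod a)\<^sup>2 - 2 * Re (cnj b * a) + (cmod b)\<^sup>2"
  unfolding cmod_power2 by (simp add: power2_eq_square algebra_simps)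

text \<open>The conditional variance identity: under the transition probabilities
  \<open>z e * g' (r e)\<close> has mean \<open>g u\<close>, so the mean square distance to any
  \<beta> splits. Taking \<beta> equal to \<open>g\<close> gives the energy increment exactly; a
  constant \<beta> bounds it from above.\<close>

lemma step_pythagoras:
  assumes n: "1 \<le> n" and step: "consistent_step n z g g'" and z: "\<And>e. e \<in> E n \<Longrightarrow> cmod (z e) = 1"
  shows "(\<Sum>e \<in> E n. weight n e * (cmod (z e * g' (r e) - \<beta> (s e)))\<^sup>2) =
    energy (Suc n) g' - energy n g + (\<Sum>u \<in> V n. h n u * q n u * (cmod (g u - \<beta> u))\<^sup>2)"
proof -
  have one: "(\<Sum>e \<in> {e \<in> E n. s e = u}. weight n e * (cmod (z e * g' (r e) - \<beta> (s e)))\<^sup>2) =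
      (\<Sum>e \<in> {e \<in> E n. s e = u}. weight n e * (cmod (g' (r e)))\<^sup>2) - h n u * q n u * (cmod (g u))\<^sup>2 +
      h n u * q n u * (cmod (g u - \<beta> u))\<^sup>2" if u: "u \<in> V n" for u
  proof -
    let ?S = "{e \<in> E n. s e = u}"
    have cross: "(\<Sum>e \<in> ?S. q (Suc n) (r e) * Re (cnj (\<beta> u) * (z e * g' (r e)))) = q n u * Re (cnj (\<beta> u) * g u)"
    proof -
      have "(\<Sum>e \<in> ?S. q (Suc n) (r e) * Re (cnj (\<beta> u) * (z e * g' (r e)))) =
          Re (cnj (\<beta> u) * (\<Sum>e \<in> ?S. of_real (q (Suc n) (r e)) * z e * g' (r e)))"
        by (simp add: sum_distrib_left Re_sum algebra_simps)
      also have "\<dots> = Re (cnj (\<beta> u) * (of_real (q n u) * g u))"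
        using step u unfolding consistent_step_def by simp
      finally show ?thesis by (simp add: algebra_simps)
    qed
    have "(\<Sum>e \<in> ?S. weight n e * (cmod (z e * g' (r e) - \<beta> (s e)))\<^sup>2) =
        (\<Sum>e \<in> ?S. weight n e * (cmod (g' (r e)))\<^sup>2 - h n u * 2 * (q (Suc n) (r e) * Re (cnj (\<beta> u) * (z e * g' (r e))))
          + h n u * (cmod (\<beta> u))\<^sup>2 * q (Suc n) (r e))"
      by (intro sum.cong refl) (auto simp: weight_def norm_diff_sq norm_mult z algebra_simps)
    also have "\<dots> = (\<Sum>e \<in> ?S. weight n e * (cmod (g' (r e)))\<^sup>2) - h n u * 2 * (q n u * Re (cnj (\<beta> u) * g u))
          + h n u * (cmod (\<beta> u))\<^sup>2 * q n u"
      using q_split[OF n u] cross by (simp add: sum.distrib sum_subtractf flip: sum_distrib_left)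
    also have "\<dots> = (\<Sum>e \<in> ?S. weight n e * (cmod (g' (r e)))\<^sup>2) - h n u * q n u * (cmod (g u))\<^sup>2 +
        h n u * q n u * (cmod (g u - \<beta> u))\<^sup>2"
      by (simp add: norm_diff_sq algebra_simps)
    finally show ?thesis .
  qed
  have "(\<Sum>e \<in> E n. weight n e * (cmod (z e * g' (r e) - \<beta> (s e)))\<^sup>2) =
      (\<Sum>e \<in> E n. weight n e * (cmod (g' (r e)))\<^sup>2) - energy n g + (\<Sum>u \<in> V n. h n u * q n u * (cmod (g u - \<beta> u))\<^sup>2)"
    unfolding sum_by_src[OF n] energy_def
    by (simp only: sum.cong[OF refl one] sum.distrib sum_subtractf)
  then show ?thesis
    using sum_weight_rng[OF n, of "\<lambda>v. (cmod (g' v))\<^sup>2"] by (simp add: energy_def)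
qed

lemma mass_le: "1 \<le> n \<Longrightarrow> u \<in> V n \<Longrightarrow> h n u * q n u \<le> 1"
  using member_le_sum[of u "V n" "\<lambda>u. h n u * q n u"] total_mass[of n] fin_V[of n] h_pos[of n] q_pos[of n]
  by (auto simp: less_imp_le)

text \<open>All edges from \<open>u\<close> to \<open>v\<close> have the same mass, \<open>M\<close>
  in number. Stability times the mass at least \<delta> of \<open>v\<close> bounds their total mass
  from below; from above it is at most the mass of \<open>v\<close>.\<close>

lemma
  assumes n: "1 \<le> n" and uv: "u \<in> V n" "v \<in> V (Suc n)"
  defines "M \<equiv> real (card {e \<in> E n. s e = u \<and> r e = v})"
  shows card_pos: "0 < M"
    and weight_lower: "\<delta>\<^sup>2 / 2 < M * (h n u * q (Suc n) v)"
    and weight_upper: "M * (h n u * q (Suc n) v) \<le> 1"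
proof -
  have pos: "0 < h n u" "0 < h (Suc n) v" "0 < q (Suc n) v"
    using h_pos q_pos n uv by auto
  have st: "\<delta> / 2 < h n u / h (Suc n) v * M" using stable[OF n uv] by (simp add: M_def)
  then have st': "\<delta> / 2 * h (Suc n) v < h n u * M" using pos by (simp add: field_simps)
  then have "0 < h n u * M" using pos delta_pos by (smt (verit) mult_pos_pos half_gt_zero)
  then show "0 < M" using pos by (simp add: zero_less_mult_iff)
  have "\<delta> * \<delta> \<le> h (Suc n) v * q (Suc n) v * \<delta>"
    using mass_ge[of "Suc n" v] n uv delta_pos by (intro mult_right_mono) auto
  moreover have "\<delta> / 2 * h (Suc n) v * q (Suc n) v < h n u * M * q (Suc n) v"
    using st' pos by (intro mult_strict_right_mono) auto
  ultimately show "\<delta>\<^sup>2 / 2 < M * (h n u * q (Suc n) v)"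
    by (simp add: power2_eq_square algebra_simps)
  have "M * h n u = (\<Sum>e \<in> {e \<in> E n. s e = u \<and> r e = v}. h n (s e))"
    by (simp add: M_def)
  also have "\<dots> \<le> (\<Sum>e \<in> {e \<in> E n. r e = v}. h n (s e))"
    using fin_E[OF n] h_pos[OF n s_V[OF n]] by (intro sum_mono2) (auto simp: less_imp_le)
  also have "\<dots> = h (Suc n) v" using h_split n uv by simp
  finally have "M * h n u * q (Suc n) v \<le> h (Suc n) v * q (Suc n) v"
    using pos by (intro mult_right_mono) auto
  then show "M * (h n u * q (Suc n) v) \<le> 1"
    using mass_le[of "Suc n" v] n uv by (simp add: mult.assoc)
qed


section \<open>Phase defects and their relation to energy\<close>

definition total_defect :: "nat \<Rightarrow> ('e \<Rightarrow> complex) \<Rightarrow> real" where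
  "total_defect n z = (\<Sum>e \<in> E n. weight n e * (cmod (z e - 1))\<^sup>2)"

definition mean_defect :: "nat \<Rightarrow> ('e \<Rightarrow> complex) \<Rightarrow> 'v \<Rightarrow> 'v \<Rightarrow> real" where
  "mean_defect n z u v = 1 / real (card {e \<in> E n. s e = u \<and> r e = v}) *
     (\<Sum>e \<in> {e \<in> E n. s e = u \<and> r e = v}. (cmod (z e - 1))\<^sup>2)"

lemma total_defect_nonneg: "1 \<le> n \<Longrightarrow> 0 \<le> total_defect n z"
  unfolding total_defect_def using weight_pos[of n] by (intro sum_nonneg) (auto simp: less_imp_le)

text \<open>A single edge from \<open>u\<close> to \<open>v\<close> has mass at most
  \<open>1 / M\<close>, by \<open>weight_upper\<close>; this compares the masses with the averages
  of the series.\<close>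

lemma total_defect_le:
  assumes n: "1 \<le> n"
  shows "total_defect n z \<le> (\<Sum>u \<in> V n. \<Sum>v \<in> V (Suc n). mean_defect n z u v)"
proof -
  have "(\<Sum>e \<in> {e \<in> E n. s e = u}. weight n e * (cmod (z e - 1))\<^sup>2) \<le> (\<Sum>v \<in> V (Suc n). mean_defect n z u v)"
    if u: "u \<in> V n" for u
  proof -
    let ?S = "{e \<in> E n. s e = u}"
    have "(\<Sum>e \<in> ?S. weight n e * (cmod (z e - 1))\<^sup>2) =
        (\<Sum>v \<in> V (Suc n). \<Sum>e \<in> {e \<in> ?S. r e = v}. weight n e * (cmod (z e - 1))\<^sup>2)"
      using fin_V[of "Suc n"] fin_E[OF n] r_V[OF n] by (intro sum.group[symmetric]) auto
    also have "\<dots> = (\<Sum>v \<in> V (Suc n). h n u * q (Suc n) v * (\<Sum>e \<in> {e \<in> E n. s e = u \<and> r e = v}. (cmod (z e - 1))\<^sup>2))"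
      by (intro sum.cong refl) (auto simp: weight_def sum_distrib_left conj_assoc intro!: sum.cong)
    also have "\<dots> \<le> (\<Sum>v \<in> V (Suc n). mean_defect n z u v)"
    proof (rule sum_mono)
      fix v assume v: "v \<in> V (Suc n)"
      have "h n u * q (Suc n) v \<le> 1 / real (card {e \<in> E n. s e = u \<and> r e = v})"
        using weight_upper[OF n u v] card_pos[OF n u v] by (simp add: field_simps)
      then show "h n u * q (Suc n) v * (\<Sum>e \<in> {e \<in> E n. s e = u \<and> r e = v}. (cmod (z e - 1))\<^sup>2)
          \<le> mean_defect n z u v"
        unfolding mean_defect_def by (intro mult_right_mono sum_nonneg) auto
    qed
    finally show ?thesis .
  qed
  then show ?thesis
    unfolding total_defect_def sum_by_src[OF n] by (intro sum_mono)
qed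

lemma energy_step:
  assumes "1 \<le> n" "consistent_step n z g g'" "\<And>e. e \<in> E n \<Longrightarrow> cmod (z e) = 1"
  shows "(\<Sum>e \<in> E n. weight n e * (cmod (z e * g' (r e) - g (s e)))\<^sup>2) = energy (Suc n) g' - energy n g"
  using step_pythagoras[OF assms, of g] by simp

lemma energy_mono:
  assumes "1 \<le> n" "consistent_step n z g g'" "\<And>e. e \<in> E n \<Longrightarrow> cmod (z e) = 1"
  shows "energy n g \<le> energy (Suc n) g'"
proof -
  have "0 \<le> (\<Sum>e \<in> E n. weight n e * (cmod (z e * g' (r e) - g (s e)))\<^sup>2)"
    using weight_pos[OF assms(1)] by (intro sum_nonneg) (auto simp: less_imp_le)
  then show ?thesis using energy_step[OF assms] by simp
qed

lemma V_nonempty: "1 \<le> n \<Longrightarrow> V n \<noteq> {}"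
  using total_mass[of n] by auto

lemma ex_edge:
  assumes "1 \<le> n" "u \<in> V n" "v \<in> V (Suc n)"
  shows "\<exists>e \<in> E n. s e = u \<and> r e = v"
  using card_pos[OF assms] fin_E[OF assms(1)] by (auto simp: card_gt_0_iff)

text \<open>Multiplied by the modulus of \<open>x\<close>, the difference of the signs becomes
  \<open>x - y\<close> plus a multiple of a unit vector by the difference of the moduli. Each
  summand is at most the distance from \<open>x\<close> to \<open>y\<close>, whence the factor
  2.\<close>

lemma sgn_diff_le:
  fixes x y :: complex
  assumes "0 < k" "k \<le> cmod x" "k \<le> cmod y"
  shows "cmod (sgn x - sgn y) \<le> 2 / k * cmod (x - y)"
proof -
  have x: "x \<noteq> 0" and y: "y \<noteq> 0" using assms by auto
  have "of_real (cmod x) * (sgn x - sgn y) = (x - y) + of_real (cmod y - cmod x) * sgn y"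
    using x y by (simp add: sgn_eq algebra_simps)
  then have "cmod x * cmod (sgn x - sgn y) = cmod ((x - y) + of_real (cmod y - cmod x) * sgn y)"
    by (metis norm_mult norm_of_real abs_norm_cancel)
  also have "\<dots> \<le> cmod (x - y) + \<bar>cmod y - cmod x\<bar>"
    using y by (intro order_trans[OF norm_triangle_ineq] add_left_mono) (simp add: norm_mult norm_sgn del: of_real_diff)
  also have "\<dots> \<le> 2 * cmod (x - y)"
    using norm_triangle_ineq3[of y x] by (simp add: norm_minus_commute)
  finally have "k * cmod (sgn x - sgn y) \<le> 2 * cmod (x - y)"
    using mult_right_mono[OF assms(2), of "cmod (sgn x - sgn y)"] by simp
  then show ?thesis using assms(1) by (simp add: field_simps)
qed

text \<open>
  The energy increments are summable and control the oscillation of \<open>b n\<close>; since the energy is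
  positive, \<open>\<bar>b n\<bar>\<close> is eventually bounded below on all vertices, so that \<open>b n\<close> may be normalised.
\<close>
theorem consistent_imp_defects:
  fixes b :: "nat \<Rightarrow> 'v \<Rightarrow> complex"
  assumes step: "\<And>n. 1 \<le> n \<Longrightarrow> consistent_step n (z n) (b n) (b (Suc n))"
    and z: "\<And>n e. 1 \<le> n \<Longrightarrow> e \<in> E n \<Longrightarrow> cmod (z n e) = 1"
    and bound: "\<And>n. 1 \<le> n \<Longrightarrow> energy n (b n) \<le> K"
    and nz: "1 \<le> m" "w \<in> V m" "b m w \<noteq> 0"
  shows "\<exists>N\<ge>1. \<exists>D. summable D \<and> (\<forall>n\<ge>N. \<forall>u \<in> V n. b n u \<noteq> 0 \<and> (\<forall>v \<in> V (Suc n).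
    mean_defect n (\<lambda>e. z n e * sgn (b (Suc n) (r e)) / sgn (b n (s e))) u v \<le> D n))"
proof -
  define L where "L n = energy n (b n)" for n
  have inc: "L n \<le> L (Suc n)" if "1 \<le> n" for n
    unfolding L_def by (rule energy_mono[OF that step[OF that] z[OF that]])
  have mono: "L n \<le> L k" if "1 \<le> n" "n \<le> k" for n k
    using that(2)
  proof (induction k rule: dec_induct)
    case (step k)
    then show ?case using inc[of k] that(1) by simp
  qed simp
  have Lm: "0 < L m"
  proof -
    have "0 < h m w * q m w * (cmod (b m w))\<^sup>2" using h_pos q_pos nz by simp
    also have "\<dots> \<le> L m"
      unfolding L_def energy_def using nz fin_V h_pos[OF nz(1)] q_pos[OF nz(1)]
      by (intro member_le_sum) (auto simp: less_imp_le)
    finally show ?thesis .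
  qed
  \<comment> \<open>Levels start at 1, so the energies are shifted by one before facts on sequences
    indexed from 0 are applied.\<close>
  define D where "D n = L (Suc (Suc n)) - L (Suc n)" for n
  have "incseq (\<lambda>n. L (Suc n))" by (rule incseq_SucI) (simp add: inc)
  then obtain l where "(\<lambda>n. L (Suc n)) \<longlonglongrightarrow> l"
    by (rule incseq_convergent[where B = K]) (use bound in \<open>auto simp: L_def\<close>)
  then have "summable D" unfolding D_def by (rule telescope_summable)
  then have D0: "D \<longlonglongrightarrow> 0" by (rule summable_LIMSEQ_zero)
  define \<kappa> where "\<kappa> = \<delta>\<^sup>2 / 2"
  have \<kappa>: "0 < \<kappa>" using delta_pos by (simp add: \<kappa>_def)
  \<comment> \<open>The energy increment is a sum of nonnegative terms over all edges. The edges
    from \<open>u\<close> to \<open>v\<close> contribute only part of it, and each of them has mass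
    at least \<open>\<kappa> / M\<close>.\<close>
  have main: "1 / real (card {e \<in> E n. s e = u \<and> r e = v}) *
      (\<Sum>e \<in> {e \<in> E n. s e = u \<and> r e = v}. (cmod (z n e * b (Suc n) v - b n u))\<^sup>2) \<le> (L (Suc n) - L n) / \<kappa>"
    (is "1 / ?M * ?X \<le> _") if n: "1 \<le> n" and u: "u \<in> V n" and v: "v \<in> V (Suc n)" for n u v
  proof -
    have X: "0 \<le> ?X" by (intro sum_nonneg) auto
    have "\<kappa> / ?M * ?X \<le> h n u * q (Suc n) v * ?X"
      using weight_lower[OF n u v] card_pos[OF n u v] X by (intro mult_right_mono) (auto simp: \<kappa>_def field_simps)
    also have "\<dots> = (\<Sum>e \<in> {e \<in> E n. s e = u \<and> r e = v}. weight n e * (cmod (z n e * b (Suc n) (r e) - b n (s e)))\<^sup>2)"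
      unfolding sum_distrib_left by (intro sum.cong refl) (auto simp: weight_def)
    also have "\<dots> \<le> (\<Sum>e \<in> E n. weight n e * (cmod (z n e * b (Suc n) (r e) - b n (s e)))\<^sup>2)"
      using fin_E[OF n] weight_pos[OF n] by (intro sum_mono2) (auto simp: less_imp_le)
    also have "\<dots> = L (Suc n) - L n"
      unfolding L_def by (rule energy_step[OF n step[OF n] z[OF n]])
    finally show ?thesis using \<kappa> by (simp add: field_simps)
  qed
  have osc: "\<bar>cmod (b (Suc n) v) - cmod (b n u)\<bar> \<le> sqrt ((L (Suc n) - L n) / \<kappa>)"
    if n: "1 \<le> n" and u: "u \<in> V n" and v: "v \<in> V (Suc n)" for n u v
  proof -
    let ?S = "{e \<in> E n. s e = u \<and> r e = v}"
    have "(cmod (b (Suc n) v) - cmod (b n u))\<^sup>2 \<le> (cmod (z n e * b (Suc n) v - b n u))\<^sup>2" if "e \<in> ?S" for e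
    proof -
      have "\<bar>cmod (z n e * b (Suc n) v) - cmod (b n u)\<bar> \<le> cmod (z n e * b (Suc n) v - b n u)"
        by (rule norm_triangle_ineq3)
      then show ?thesis using z[OF n] that by (simp add: norm_mult flip: abs_le_square_iff)
    qed
    then have "real (card ?S) * (cmod (b (Suc n) v) - cmod (b n u))\<^sup>2 \<le> (\<Sum>e \<in> ?S. (cmod (z n e * b (Suc n) v - b n u))\<^sup>2)"
      by (intro sum_bounded_below)
    then have "(cmod (b (Suc n) v) - cmod (b n u))\<^sup>2 \<le> 1 / real (card ?S) * (\<Sum>e \<in> ?S. (cmod (z n e * b (Suc n) v - b n u))\<^sup>2)"
      using card_pos[OF n u v] by (simp add: field_simps)
    also have "\<dots> \<le> (L (Suc n) - L n) / \<kappa>" by (rule main[OF n u v])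
    finally have "(cmod (b (Suc n) v) - cmod (b n u))\<^sup>2 \<le> (L (Suc n) - L n) / \<kappa>" .
    then show ?thesis by (simp add: real_le_rsqrt)
  qed
  \<comment> \<open>Chosen so that \<open>(2 * k)\<^sup>2 = L m\<close>. If one modulus at a late
    level were below \<open>k\<close>, comparison through a common vertex of the next level would
    put all moduli of that level below \<open>2 * k\<close>, and the energy below
    \<open>L m\<close>, against monotonicity.\<close>
  define k where "k = sqrt (L m) / 2"
  have k: "0 < k" using Lm by (simp add: k_def)
  have "(\<lambda>n. sqrt (D n / \<kappa>)) \<longlonglongrightarrow> 0"
    using tendsto_real_sqrt[OF tendsto_divide[OF D0 tendsto_const[of \<kappa>]]] \<kappa> by simp
  then have "\<forall>\<^sub>F n in sequentially. sqrt (D n / \<kappa>) < k / 2"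
    using k by (intro order_tendstoD) auto
  then obtain N0 where N0: "\<And>n. N0 \<le> n \<Longrightarrow> sqrt (D n / \<kappa>) < k / 2"
    unfolding eventually_sequentially by blast
  define N where "N = max (Suc N0) m"
  have low: "k \<le> cmod (b n u)" if n: "N \<le> n" and u: "u \<in> V n" for n u
  proof (rule ccontr)
    assume "\<not> k \<le> cmod (b n u)"
    then have lt: "cmod (b n u) < k" by simp
    have n1: "1 \<le> n" "m \<le> n" "N0 \<le> n - 1" using n by (auto simp: N_def)
    obtain v where v: "v \<in> V (Suc n)" using V_nonempty[of "Suc n"] by auto
    have small: "sqrt ((L (Suc n) - L n) / \<kappa>) < k / 2"
      using N0[OF n1(3)] n1(1) by (simp add: D_def)
    have "cmod (b n u') \<le> 2 * k" if u': "u' \<in> V n" for u'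
      using osc[OF n1(1) u v] osc[OF n1(1) u' v] small lt by linarith
    moreover have "cmod (b n u) < 2 * k" using lt k by simp
    ultimately have "L n < (\<Sum>u \<in> V n. h n u * q n u * (2 * k)\<^sup>2)"
      unfolding L_def energy_def using h_pos[OF n1(1)] q_pos[OF n1(1)] fin_V[OF n1(1)] u
      by (intro sum_strict_mono_ex1 ballI mult_left_mono bexI[of _ u] mult_strict_left_mono power_mono power_strict_mono)
         (auto simp: less_imp_le)
    also have "\<dots> = L m" using total_mass[OF n1(1)] Lm by (simp add: k_def flip: sum_distrib_right)
    finally show False using mono[OF nz(1) n1(2)] by simp
  qed
  define D' where "D' n = (2 / k)\<^sup>2 * ((L (Suc n) - L n) / \<kappa>)" for n
  have "summable (\<lambda>n. D' (Suc n))"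
    using summable_mult[OF summable_divide[OF \<open>summable D\<close>, of \<kappa>], of "(2 / k)\<^sup>2"] by (simp add: D'_def D_def)
  then have "summable D'" by (simp add: summable_Suc_iff)
  moreover have "b n u \<noteq> 0 \<and> (\<forall>v \<in> V (Suc n).
      mean_defect n (\<lambda>e. z n e * sgn (b (Suc n) (r e)) / sgn (b n (s e))) u v \<le> D' n)"
    if n: "N \<le> n" and u: "u \<in> V n" for n u
  proof (intro conjI ballI)
    show bu: "b n u \<noteq> 0" using low[OF that] k by auto
    fix v assume v: "v \<in> V (Suc n)"
    let ?S = "{e \<in> E n. s e = u \<and> r e = v}"
    have n1: "1 \<le> n" using n by (auto simp: N_def)
    have "(cmod (z n e * sgn (b (Suc n) (r e)) / sgn (b n (s e)) - 1))\<^sup>2 \<le> (2 / k)\<^sup>2 * (cmod (z n e * b (Suc n) v - b n u))\<^sup>2"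
      if e: "e \<in> ?S" for e
    proof -
      have ze: "cmod (z n e) = 1" using z[OF n1] e by simp
      then have sz: "sgn (z n e) = z n e" by (simp add: sgn_eq)
      have "cmod (z n e * sgn (b (Suc n) v) / sgn (b n u) - 1) =
          cmod ((z n e * sgn (b (Suc n) v) - sgn (b n u)) / sgn (b n u))"
        using bu by (simp add: diff_divide_distrib sgn_zero_iff)
      also have "\<dots> = cmod (sgn (z n e * b (Suc n) v) - sgn (b n u))"
        using bu by (simp add: norm_divide norm_sgn sgn_mult sz)
      also have "\<dots> \<le> 2 / k * cmod (z n e * b (Suc n) v - b n u)"
        using low[OF n u] low[of "Suc n" v] n v k ze by (intro sgn_diff_le) (auto simp: norm_mult)
      finally show ?thesis using e k by (auto simp flip: power_mult_distrib intro!: power_mono)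
    qed
    then have "(\<Sum>e \<in> ?S. (cmod (z n e * sgn (b (Suc n) (r e)) / sgn (b n (s e)) - 1))\<^sup>2) \<le>
        (2 / k)\<^sup>2 * (\<Sum>e \<in> ?S. (cmod (z n e * b (Suc n) v - b n u))\<^sup>2)"
      unfolding sum_distrib_left by (rule sum_mono)
    then have "mean_defect n (\<lambda>e. z n e * sgn (b (Suc n) (r e)) / sgn (b n (s e))) u v \<le>
        1 / real (card ?S) * ((2 / k)\<^sup>2 * (\<Sum>e \<in> ?S. (cmod (z n e * b (Suc n) v - b n u))\<^sup>2))"
      unfolding mean_defect_def by (rule mult_left_mono) simp
    also have "\<dots> = (2 / k)\<^sup>2 * (1 / real (card ?S) * (\<Sum>e \<in> ?S. (cmod (z n e * b (Suc n) v - b n u))\<^sup>2))"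
      by simp
    also have "\<dots> \<le> D' n"
      unfolding D'_def using main[OF n1 u v] by (rule mult_left_mono) simp
    finally show "mean_defect n (\<lambda>e. z n e * sgn (b (Suc n) (r e)) / sgn (b n (s e))) u v \<le> D' n" .
  qed
  moreover have "1 \<le> N" by (auto simp: N_def)
  ultimately show ?thesis by blast
qed


text \<open>
  One backward step of the transfer operators. The values of \<open>g'\<close> lie in a disc of radius \<open>R\<close>;
  by the Doeblin bound \<open>\<delta>\<^sup>2 / 2\<close> on the transition probabilities those of \<open>g\<close> lie in
  a disc of a radius smaller by a constant factor, up to an error that is controlled by the defect.
  Subtracting a multiple of the squared radius makes the energy loss summable.
\<close>
lemma backward_step:
  assumes n: "1 \<le> n" and step: "consistent_step n z g g'" and z: "\<And>e. e \<in> E n \<Longrightarrow> cmod (z e) = 1"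
    and g': "\<And>v. v \<in> V (Suc n) \<Longrightarrow> cmod (g' v) \<le> 1"
    and disc: "\<And>v. v \<in> V (Suc n) \<Longrightarrow> cmod (g' v - \<gamma>) \<le> R" and R: "0 \<le> R"
  defines "\<kappa> \<equiv> \<delta>\<^sup>2 / 2"
  shows "(\<forall>u \<in> V n. cmod (g u) \<le> 1) \<and> (\<exists>\<gamma>' R'. 0 \<le> R' \<and> (\<forall>u \<in> V n. cmod (g u - \<gamma>') \<le> R') \<and>
    energy (Suc n) g' - 2 / \<kappa> * R\<^sup>2 - (2 + 2 / (\<delta> * \<kappa>\<^sup>2)) * total_defect n z \<le> energy n g - 2 / \<kappa> * R'\<^sup>2)"
proof -
  have \<kappa>: "0 < \<kappa>" using delta_pos by (simp add: \<kappa>_def)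
  define A where "A = total_defect n z"
  have A: "0 \<le> A" unfolding A_def by (rule total_defect_nonneg[OF n])
  define p where "p u e = q (Suc n) (r e) / q n u" for u e
  define S where "S u = {e \<in> E n. s e = u}" for u
  have fin: "finite (S u)" for u using fin_E[OF n] by (simp add: S_def)
  have p_nonneg: "0 \<le> p u e" if "u \<in> V n" "e \<in> S u" for u e
    using that q_pos[OF n] q_pos[of "Suc n" "r e"] r_V[OF n] by (auto simp: p_def S_def less_imp_le)
  have p_sum: "(\<Sum>e \<in> S u. p u e) = 1" if "u \<in> V n" for u
    using q_split[OF n that] q_pos[OF n that] by (simp add: p_def S_def flip: sum_divide_distrib)
  have g_eq: "g u = (\<Sum>e \<in> S u. of_real (p u e) * z e * g' (r e))" if u: "u \<in> V n" for u
  proof -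
    have "of_real (q n u) * g u = of_real (q n u) * (\<Sum>e \<in> S u. of_real (p u e) * z e * g' (r e))"
      using step u q_pos[OF n u] unfolding consistent_step_def S_def p_def sum_distrib_left by simp
    then show ?thesis using q_pos[OF n u] by simp
  qed
  have bound: "cmod (g u) \<le> 1" if u: "u \<in> V n" for u
  proof -
    have "cmod (g u) \<le> (\<Sum>e \<in> S u. cmod (of_real (p u e) * z e * g' (r e)))"
      unfolding g_eq[OF u] by (rule norm_sum)
    also have "\<dots> \<le> (\<Sum>e \<in> S u. p u e)"
    proof (rule sum_mono)
      fix e assume e: "e \<in> S u"
      then have "cmod (g' (r e)) \<le> 1" "cmod (z e) = 1" using g' r_V[OF n] z by (auto simp: S_def)
      then show "cmod (of_real (p u e) * z e * g' (r e)) \<le> p u e"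
        using p_nonneg[OF u e] by (simp add: norm_mult mult_left_le)
    qed
    finally show ?thesis using p_sum[OF u] by simp
  qed
  \<comment> \<open>Jensen bounds the mean of the distances from \<open>z e\<close> to 1 by the root
    of their mean square. The factor \<open>1 / \<delta>\<close> appears because \<open>A\<close> is
    weighted by masses, and the vertex \<open>u\<close> has mass at least \<delta>.\<close>
  define a where "a = sqrt (A / \<delta>)"
  have err: "cmod (g u - (\<Sum>e \<in> S u. of_real (p u e) * g' (r e))) \<le> a" if u: "u \<in> V n" for u
  proof -
    define m where "m = (\<Sum>e \<in> S u. p u e * cmod (z e - 1))"
    have "cmod (g u - (\<Sum>e \<in> S u. of_real (p u e) * g' (r e))) =
        cmod (\<Sum>e \<in> S u. of_real (p u e) * ((z e - 1) * g' (r e)))"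
      unfolding g_eq[OF u] by (simp add: algebra_simps flip: sum_subtractf)
    also have "\<dots> \<le> (\<Sum>e \<in> S u. cmod (of_real (p u e) * ((z e - 1) * g' (r e))))"
      by (rule norm_sum)
    also have "\<dots> \<le> m"
      unfolding m_def
    proof (rule sum_mono)
      fix e assume e: "e \<in> S u"
      then have "cmod (g' (r e)) \<le> 1" using g' r_V[OF n] by (auto simp: S_def)
      then show "cmod (of_real (p u e) * ((z e - 1) * g' (r e))) \<le> p u e * cmod (z e - 1)"
        using p_nonneg[OF u e] by (simp add: norm_mult mult_left_mono mult_left_le)
    qed
    finally have 1: "cmod (g u - (\<Sum>e \<in> S u. of_real (p u e) * g' (r e))) \<le> m" .
    have "0 \<le> (\<Sum>e \<in> S u. p u e * (cmod (z e - 1) - m)\<^sup>2)"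
      using p_nonneg[OF u] by (intro sum_nonneg) auto
    also have "\<dots> = (\<Sum>e \<in> S u. p u e * (cmod (z e - 1))\<^sup>2 - 2 * m * (p u e * cmod (z e - 1)) + m\<^sup>2 * p u e)"
      by (intro sum.cong refl) (simp add: power2_eq_square algebra_simps)
    also have "\<dots> = (\<Sum>e \<in> S u. p u e * (cmod (z e - 1))\<^sup>2) - 2 * m * m + m\<^sup>2"
      by (simp add: sum.distrib sum_subtractf p_sum[OF u] m_def flip: sum_distrib_left)
    finally have "m\<^sup>2 \<le> (\<Sum>e \<in> S u. p u e * (cmod (z e - 1))\<^sup>2)"
      by (simp add: power2_eq_square)
    also have "\<dots> \<le> A / \<delta>"
    proof -
      have "h n u * q n u * (\<Sum>e \<in> S u. p u e * (cmod (z e - 1))\<^sup>2) = (\<Sum>e \<in> S u. weight n e * (cmod (z e - 1))\<^sup>2)"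
        unfolding sum_distrib_left using q_pos[OF n u]
        by (intro sum.cong refl) (auto simp: p_def S_def weight_def)
      also have "\<dots> \<le> A"
        unfolding A_def total_defect_def S_def using fin_E[OF n] weight_pos[OF n]
        by (intro sum_mono2) (auto simp: less_imp_le)
      finally have "h n u * q n u * (\<Sum>e \<in> S u. p u e * (cmod (z e - 1))\<^sup>2) \<le> A" .
      moreover have "\<delta> * (\<Sum>e \<in> S u. p u e * (cmod (z e - 1))\<^sup>2) \<le> h n u * q n u * (\<Sum>e \<in> S u. p u e * (cmod (z e - 1))\<^sup>2)"
        using mass_ge[OF n u] p_nonneg[OF u] by (intro mult_right_mono sum_nonneg) auto
      ultimately show ?thesis using delta_pos by (simp add: field_simps)
    qed
    finally have "m \<le> a" unfolding a_def by (rule real_le_rsqrt)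
    then show ?thesis using 1 by simp
  qed
  \<comment> \<open>Every vertex \<open>v\<close> is reached from every \<open>u\<close> with
    probability at least \<kappa>. The part \<kappa> of each probability does not depend on
    \<open>u\<close> and goes into the new centre; nonnegative weights of total \<open>c\<close>
    remain.\<close>
  define \<gamma>' where "\<gamma>' = \<gamma> + of_real \<kappa> * (\<Sum>v \<in> V (Suc n). g' v - \<gamma>)"
  define c where "c = 1 - \<kappa> * real (card (V (Suc n)))"
  have contr: "cmod ((\<Sum>e \<in> S u. of_real (p u e) * g' (r e)) - \<gamma>') \<le> c * R" if u: "u \<in> V n" for u
  proof -
    define P where "P v = (\<Sum>e \<in> {e \<in> S u. r e = v}. p u e)" for v
    have P_ge: "\<kappa> \<le> P v" if v: "v \<in> V (Suc n)" for v
    proof -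
      have "P v = real (card {e \<in> E n. s e = u \<and> r e = v}) * (q (Suc n) v / q n u)"
        by (simp add: P_def p_def S_def conj_assoc)
      also have "\<dots> \<ge> real (card {e \<in> E n. s e = u \<and> r e = v}) * (h n u * q (Suc n) v)"
        using mass_le[OF n u] q_pos[OF n u] q_pos[of "Suc n" v] v
        by (intro mult_left_mono) (auto simp: field_simps mult_left_le)
      finally show ?thesis using weight_lower[OF n u v] by (simp add: \<kappa>_def)
    qed
    have grp: "(\<Sum>v \<in> V (Suc n). \<Sum>e \<in> {e \<in> S u. r e = v}. f e) = sum f (S u)" for f :: "'e \<Rightarrow> complex"
      using fin fin_V[of "Suc n"] r_V[OF n] by (intro sum.group) (auto simp: S_def)
    have grp': "(\<Sum>v \<in> V (Suc n). P v) = 1"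
      unfolding P_def p_sum[OF u, symmetric]
      using fin fin_V[of "Suc n"] r_V[OF n] by (intro sum.group) (auto simp: S_def)
    have "(\<Sum>e \<in> S u. of_real (p u e) * g' (r e)) - \<gamma> = (\<Sum>e \<in> S u. of_real (p u e) * (g' (r e) - \<gamma>))"
    proof -
      have "(\<Sum>e \<in> S u. complex_of_real (p u e)) = 1" using p_sum[OF u] by (metis of_real_1 of_real_sum)
      then show ?thesis by (simp add: algebra_simps sum_subtractf flip: sum_distrib_left)
    qed
    also have "\<dots> = (\<Sum>v \<in> V (Suc n). of_real (P v) * (g' v - \<gamma>))"
      unfolding grp[symmetric] P_def of_real_sum sum_distrib_right by (intro sum.cong refl) auto
    finally have eq: "(\<Sum>e \<in> S u. of_real (p u e) * g' (r e)) - \<gamma> = (\<Sum>v \<in> V (Suc n). of_real (P v) * (g' v - \<gamma>))" .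
    have "(\<Sum>e \<in> S u. of_real (p u e) * g' (r e)) - \<gamma>' =
        (\<Sum>v \<in> V (Suc n). of_real (P v) * (g' v - \<gamma>)) - of_real \<kappa> * (\<Sum>v \<in> V (Suc n). g' v - \<gamma>)"
      by (simp only: \<gamma>'_def diff_diff_eq[symmetric] eq)
    also have "\<dots> = (\<Sum>v \<in> V (Suc n). of_real (P v - \<kappa>) * (g' v - \<gamma>))"
      by (simp only: of_real_diff left_diff_distrib sum_subtractf[symmetric] sum_distrib_left)
    finally have "(\<Sum>e \<in> S u. of_real (p u e) * g' (r e)) - \<gamma>' = (\<Sum>v \<in> V (Suc n). of_real (P v - \<kappa>) * (g' v - \<gamma>))" .
    then have "cmod ((\<Sum>e \<in> S u. of_real (p u e) * g' (r e)) - \<gamma>') \<le> (\<Sum>v \<in> V (Suc n). cmod (of_real (P v - \<kappa>) * (g' v - \<gamma>)))"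
      by (simp only: norm_sum)
    also have "\<dots> \<le> (\<Sum>v \<in> V (Suc n). (P v - \<kappa>) * R)"
      using P_ge disc by (intro sum_mono) (auto simp: norm_mult simp del: of_real_diff intro!: mult_left_mono)
    also have "\<dots> = c * R"
      by (simp add: c_def sum_subtractf grp' flip: sum_distrib_right)
    finally show ?thesis .
  qed
  have c: "c \<le> 1 - \<kappa>"
  proof -
    have "1 \<le> card (V (Suc n))" using V_nonempty[of "Suc n"] fin_V[of "Suc n"] by (simp add: Suc_le_eq card_gt_0_iff)
    then have "\<kappa> * 1 \<le> \<kappa> * real (card (V (Suc n)))" using \<kappa> by (intro mult_left_mono) auto
    then show ?thesis by (simp add: c_def)
  qed
  have \<kappa>1: "\<kappa> \<le> 1"
  proof -
    obtain u v where uv: "u \<in> V n" "v \<in> V (Suc n)" using V_nonempty[of n] V_nonempty[of "Suc n"] n by auto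
    then show ?thesis using weight_lower[OF n uv] weight_upper[OF n uv] by (simp add: \<kappa>_def)
  qed
  define R' where "R' = (1 - \<kappa>) * R + a"
  have a: "0 \<le> a" "a\<^sup>2 = A / \<delta>" using A delta_pos by (auto simp: a_def)
  have R': "0 \<le> R'" using \<kappa>1 R a by (simp add: R'_def)
  have disc': "cmod (g u - \<gamma>') \<le> R'" if u: "u \<in> V n" for u
  proof -
    have "cmod (g u - \<gamma>') \<le> cmod (g u - (\<Sum>e \<in> S u. of_real (p u e) * g' (r e))) +
        cmod ((\<Sum>e \<in> S u. of_real (p u e) * g' (r e)) - \<gamma>')"
      using norm_triangle_ineq[of "g u - (\<Sum>e \<in> S u. of_real (p u e) * g' (r e))" "(\<Sum>e \<in> S u. of_real (p u e) * g' (r e)) - \<gamma>'"] by simp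
    also have "\<dots> \<le> a + c * R" using err[OF u] contr[OF u] by simp
    also have "\<dots> \<le> R'" using mult_right_mono[OF c R] by (simp add: R'_def)
    finally show ?thesis .
  qed
  \<comment> \<open>Convexity of the square for
    \<open>R' = (1 - \<kappa>) * R + \<kappa> * (a / \<kappa>)\<close>.\<close>
  have R'2: "R'\<^sup>2 \<le> (1 - \<kappa>) * R\<^sup>2 + a\<^sup>2 / \<kappa>"
  proof -
    have "(1 - \<kappa>) * R\<^sup>2 + a\<^sup>2 / \<kappa> - R'\<^sup>2 = (1 - \<kappa>) / \<kappa> * (\<kappa> * R - a)\<^sup>2"
      using \<kappa> by (simp add: R'_def field_simps power2_eq_square)
    moreover have "0 \<le> (1 - \<kappa>) / \<kappa> * (\<kappa> * R - a)\<^sup>2" using \<kappa> \<kappa>1 by simp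
    ultimately show ?thesis by linarith
  qed
  \<comment> \<open>The variance identity is used with the constant centre \<gamma> of the old disc:
    the edge values differ from it by at most \<open>R\<close> plus the distance from
    \<open>z e\<close> to 1.\<close>
  have loss: "energy (Suc n) g' - 2 * A - 2 * R\<^sup>2 \<le> energy n g"
  proof -
    have "energy (Suc n) g' - energy n g \<le> (\<Sum>e \<in> E n. weight n e * (cmod (z e * g' (r e) - \<gamma>))\<^sup>2)"
      using step_pythagoras[OF n step z, of "\<lambda>_. \<gamma>"] h_pos[OF n] q_pos[OF n]
      by (simp add: sum_nonneg less_imp_le)
    also have "\<dots> \<le> (\<Sum>e \<in> E n. 2 * (weight n e * (cmod (z e - 1))\<^sup>2) + 2 * R\<^sup>2 * weight n e)"
    proof (rule sum_mono)
      fix e assume e: "e \<in> E n"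
      have re: "r e \<in> V (Suc n)" using r_V[OF n e] .
      have "cmod (z e * g' (r e) - \<gamma>) \<le> cmod ((z e - 1) * g' (r e)) + cmod (g' (r e) - \<gamma>)"
        using norm_triangle_ineq[of "(z e - 1) * g' (r e)" "g' (r e) - \<gamma>"] by (simp add: algebra_simps)
      also have "\<dots> \<le> cmod (z e - 1) + R"
        using g'[OF re] disc[OF re] by (intro add_mono) (auto simp: norm_mult mult_left_le)
      finally have "(cmod (z e * g' (r e) - \<gamma>))\<^sup>2 \<le> (cmod (z e - 1) + R)\<^sup>2"
        by (intro power_mono) auto
      also have "\<dots> \<le> 2 * (cmod (z e - 1))\<^sup>2 + 2 * R\<^sup>2"
        using sum_squares_bound[of "cmod (z e - 1)" R] by (simp add: power2_sum)
      finally have "weight n e * (cmod (z e * g' (r e) - \<gamma>))\<^sup>2 \<le> weight n e * (2 * (cmod (z e - 1))\<^sup>2 + 2 * R\<^sup>2)"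
        using weight_pos[OF n e] by (intro mult_left_mono) auto
      then show "weight n e * (cmod (z e * g' (r e) - \<gamma>))\<^sup>2 \<le>
          2 * (weight n e * (cmod (z e - 1))\<^sup>2) + 2 * R\<^sup>2 * weight n e"
        by (simp add: algebra_simps)
    qed
    also have "\<dots> = 2 * A + 2 * R\<^sup>2"
      using sum_weight[OF n] by (simp add: A_def total_defect_def sum.distrib flip: sum_distrib_left)
    finally show ?thesis by simp
  qed
  \<comment> \<open>The coefficient \<open>2 / \<kappa>\<close> is chosen so that the contraction by
    \<open>1 - \<kappa>\<close> releases exactly \<open>2 * R\<^sup>2\<close>, the part of the
    energy loss that comes from the oscillation.\<close>
  have "2 / \<kappa> * R'\<^sup>2 \<le> 2 / \<kappa> * ((1 - \<kappa>) * R\<^sup>2 + a\<^sup>2 / \<kappa>)"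
    using R'2 \<kappa> by (intro mult_left_mono) auto
  also have "\<dots> = 2 / \<kappa> * R\<^sup>2 - 2 * R\<^sup>2 + 2 / (\<delta> * \<kappa>\<^sup>2) * A"
    unfolding a(2) using \<kappa> delta_pos by (simp add: field_simps power2_eq_square)
  finally have "energy (Suc n) g' - 2 / \<kappa> * R\<^sup>2 - (2 + 2 / (\<delta> * \<kappa>\<^sup>2)) * A \<le> energy n g - 2 / \<kappa> * R'\<^sup>2"
    using loss by (simp add: algebra_simps)
  then show ?thesis using bound disc' R' unfolding A_def by blast
qed


section \<open>Pulling back the constant one and passing to a limit\<close>

primrec pull_iter :: "(nat \<Rightarrow> 'e \<Rightarrow> complex) \<Rightarrow> nat \<Rightarrow> nat \<Rightarrow> 'v \<Rightarrow> complex" where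
  "pull_iter z N 0 = (\<lambda>_. 1)"
| "pull_iter z N (Suc j) = (\<lambda>u. (\<Sum>e \<in> {e \<in> E (N - Suc j). s e = u}.
     of_real (q (Suc (N - Suc j)) (r e)) * z (N - Suc j) e * pull_iter z N j (r e)) / of_real (q (N - Suc j) u))"

definition pull :: "(nat \<Rightarrow> 'e \<Rightarrow> complex) \<Rightarrow> nat \<Rightarrow> nat \<Rightarrow> 'v \<Rightarrow> complex" where
  "pull z N n = pull_iter z N (N - n)"

lemma pull_top: "N \<le> n \<Longrightarrow> pull z N n = (\<lambda>_. 1)"
  by (simp add: pull_def)

text \<open>\<open>pull_iter\<close> recurses on the distance below the top level \<open>N\<close>,
  so its \<open>Suc j\<close> belongs to level \<open>N - Suc j\<close>; here the index is turned
  back into the level.\<close>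

lemma pull_step:
  assumes "1 \<le> n" "n < N"
  shows "consistent_step n (z n) (pull z N n) (pull z N (Suc n))"
proof -
  have "N - n = Suc (N - Suc n)" "N - Suc (N - Suc n) = n" using assms(2) by auto
  then have "pull z N n = (\<lambda>u. (\<Sum>e \<in> {e \<in> E n. s e = u}.
      of_real (q (Suc n) (r e)) * z n e * pull z N (Suc n) (r e)) / of_real (q n u))"
    by (simp add: pull_def)
  then show ?thesis using q_pos[OF assms(1)] by (fastforce simp: consistent_step_def)
qed

theorem defects_imp_consistent:
  assumes z: "\<And>n e. 1 \<le> n \<Longrightarrow> e \<in> E n \<Longrightarrow> cmod (z n e) = 1"
    and summ: "summable (\<lambda>n. total_defect n (z n))"
  obtains b where "\<And>n. 1 \<le> n \<Longrightarrow> consistent_step n (z n) (b n) (b (Suc n))"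
    "\<And>n u. 1 \<le> n \<Longrightarrow> u \<in> V n \<Longrightarrow> cmod (b n u) \<le> 1"
    "\<exists>m\<ge>1. \<exists>u \<in> V m. b m u \<noteq> 0"
proof -
  define \<kappa> where "\<kappa> = \<delta>\<^sup>2 / 2"
  define C where "C = 2 + 2 / (\<delta> * \<kappa>\<^sup>2)"
  define T where "T n = total_defect n (z n)" for n
  have C: "0 < C" using delta_pos by (auto simp: C_def \<kappa>_def intro!: add_pos_nonneg)
  \<comment> \<open>At the top the values all equal 1: radius 0 and energy 1. Energy minus the
    multiple of the squared radius then decreases only by the defects passed on the way
    down.\<close>
  have ind: "(\<forall>u \<in> V n. cmod (pull z N n u) \<le> 1) \<and> (\<exists>\<gamma> R. 0 \<le> R \<and> (\<forall>u \<in> V n. cmod (pull z N n u - \<gamma>) \<le> R) \<and>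
      1 - C * sum T {n..<N} \<le> energy n (pull z N n) - 2 / \<kappa> * R\<^sup>2)" if "n \<le> N" "1 \<le> n" for n N
    using that
  proof (induction n rule: inc_induct)
    case base
    then have "energy N (pull z N N) = 1" using total_mass[of N] by (simp add: energy_def pull_top)
    then have "0 \<le> (0::real) \<and> (\<forall>u \<in> V N. cmod (pull z N N u - 1) \<le> 0) \<and>
        1 - C * sum T {N..<N} \<le> energy N (pull z N N) - 2 / \<kappa> * 0\<^sup>2"
      by (simp add: pull_top)
    moreover have "\<forall>u \<in> V N. cmod (pull z N N u) \<le> 1" by (simp add: pull_top)
    ultimately show ?case by blast
  next
    case (step n)
    then obtain \<gamma> R where IH: "\<And>v. v \<in> V (Suc n) \<Longrightarrow> cmod (pull z N (Suc n) v) \<le> 1" "0 \<le> R"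
      "\<And>v. v \<in> V (Suc n) \<Longrightarrow> cmod (pull z N (Suc n) v - \<gamma>) \<le> R"
      "1 - C * sum T {Suc n..<N} \<le> energy (Suc n) (pull z N (Suc n)) - 2 / \<kappa> * R\<^sup>2" by auto
    have "sum T {n..<N} = T n + sum T {Suc n..<N}"
      using step.hyps by (simp add: sum.atLeast_Suc_lessThan)
    then have 1: "1 - C * sum T {n..<N} \<le> energy (Suc n) (pull z N (Suc n)) - 2 / \<kappa> * R\<^sup>2 - C * T n"
      using IH(4) by (simp add: algebra_simps)
    obtain \<gamma>' R' where 2: "\<forall>u \<in> V n. cmod (pull z N n u) \<le> 1" "0 \<le> R'"
      "\<forall>u \<in> V n. cmod (pull z N n u - \<gamma>') \<le> R'"
      "energy (Suc n) (pull z N (Suc n)) - 2 / \<kappa> * R\<^sup>2 - C * T n \<le> energy n (pull z N n) - 2 / \<kappa> * R'\<^sup>2"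
      using backward_step[OF step.prems pull_step[OF step.prems step.hyps(2), of z] z[OF step.prems] IH(1,3,2)]
      unfolding C_def T_def \<kappa>_def by blast
    then show ?case using order_trans[OF 1 2(4)] by blast
  qed
  have bounded: "cmod (pull z N n u) \<le> 1" if "1 \<le> n" "u \<in> V n" for N n u
    using ind[of n N] that by (cases "n \<le> N") (auto simp: pull_top)
  \<comment> \<open>From this level on the remaining defects cost at most half of the initial
    energy, whatever \<open>N\<close> is. This uniformity keeps the limit from vanishing.\<close>
  obtain m' where m': "\<And>k n. m' \<le> k \<Longrightarrow> norm (sum T {k..<n}) < 1 / (2 * C)"
    using summ C unfolding summable_Cauchy T_def[symmetric] by (metis zero_less_divide_1_iff zero_less_mult_iff zero_less_numeral)
  define m where "m = max 1 m'"
  have m: "1 \<le> m" by (simp add: m_def)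
  have low: "1 / 2 \<le> energy m (pull z N m)" if N: "m \<le> N" for N
  proof -
    obtain R where "1 - C * sum T {m..<N} \<le> energy m (pull z N m) - 2 / \<kappa> * R\<^sup>2"
      using ind[OF N m] by blast
    moreover have "0 \<le> 2 / \<kappa> * R\<^sup>2" by (simp add: \<kappa>_def)
    moreover have "C * sum T {m..<N} \<le> 1 / 2"
    proof -
      have "sum T {m..<N} \<le> 1 / (2 * C)"
        using m'[of m N] abs_ge_self[of "sum T {m..<N}"] by (simp add: m_def)
      then have "C * sum T {m..<N} \<le> C * (1 / (2 * C))" using C by (intro mult_left_mono) auto
      then show ?thesis using C by simp
    qed
    ultimately show ?thesis by linarith
  qed
  \<comment> \<open>There are countably many vertices in all and the values are bounded by 1, so a
    diagonal subsequence converges at every vertex.\<close>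
  define S where "S = (SIGMA n:{1..}. V n)"
  have "countable S" unfolding S_def using fin_V by (intro countable_SIGMA) (auto intro: countable_finite)
  moreover have "cmod (pull z N (fst x) (snd x)) \<le> 1" if "x \<in> S" for N x
    using that bounded by (auto simp: S_def)
  ultimately obtain k where k: "strict_mono (k::nat \<Rightarrow> nat)"
    "\<And>x. x \<in> S \<Longrightarrow> \<exists>l. (\<lambda>i. pull z (k i) (fst x) (snd x)) \<longlonglongrightarrow> l"
    using function_convergent_subsequence[of S "\<lambda>N x. pull z N (fst x) (snd x)" 1] by blast
  define b where "b n u = lim (\<lambda>i. pull z (k i) n u)" for n u
  have lim: "(\<lambda>i. pull z (k i) n u) \<longlonglongrightarrow> b n u" if "1 \<le> n" "u \<in> V n" for n u
    using k(2)[of "(n, u)"] that by (auto simp: S_def b_def limI)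
  have large: "eventually (\<lambda>i. n < k i) sequentially" for n
    using filterlim_subseq[OF k(1)] unfolding filterlim_at_top Suc_le_eq[symmetric] by (rule spec)
  show ?thesis
  proof
    fix n :: nat assume n: "1 \<le> n"
    show "consistent_step n (z n) (b n) (b (Suc n))"
      unfolding consistent_step_def
    proof
      fix u assume u: "u \<in> V n"
      have "(\<lambda>i. \<Sum>e \<in> {e \<in> E n. s e = u}. of_real (q (Suc n) (r e)) * z n e * pull z (k i) (Suc n) (r e))
          \<longlonglongrightarrow> (\<Sum>e \<in> {e \<in> E n. s e = u}. of_real (q (Suc n) (r e)) * z n e * b (Suc n) (r e))"
        using r_V[OF n] by (intro tendsto_sum tendsto_mult_left lim) auto
      moreover have "\<forall>\<^sub>F i in sequentially.
          (\<Sum>e \<in> {e \<in> E n. s e = u}. of_real (q (Suc n) (r e)) * z n e * pull z (k i) (Suc n) (r e)) =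
          of_real (q n u) * pull z (k i) n u"
        using large[of n]
      proof (rule eventually_mono)
        fix i assume "n < k i"
        then show "(\<Sum>e \<in> {e \<in> E n. s e = u}. of_real (q (Suc n) (r e)) * z n e * pull z (k i) (Suc n) (r e)) =
            of_real (q n u) * pull z (k i) n u"
          using pull_step[OF n, of "k i" z] u unfolding consistent_step_def by simp
      qed
      ultimately have "(\<lambda>i. of_real (q n u) * pull z (k i) n u)
          \<longlonglongrightarrow> (\<Sum>e \<in> {e \<in> E n. s e = u}. of_real (q (Suc n) (r e)) * z n e * b (Suc n) (r e))"
        by (rule Lim_transform_eventually)
      moreover have "(\<lambda>i. of_real (q n u) * pull z (k i) n u) \<longlonglongrightarrow> of_real (q n u) * b n u"
        by (intro tendsto_mult_left lim n u)
      ultimately show "of_real (q n u) * b n u =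
          (\<Sum>e \<in> {e \<in> E n. s e = u}. of_real (q (Suc n) (r e)) * z n e * b (Suc n) (r e))"
        by (intro LIMSEQ_unique)
    qed
  next
    fix n u assume "1 \<le> n" "u \<in> V n"
    then show "cmod (b n u) \<le> 1"
      using bounded by (intro LIMSEQ_le_const2[OF tendsto_norm[OF lim]]) auto
  next
    have "(\<lambda>i. energy m (pull z (k i) m)) \<longlonglongrightarrow> energy m (b m)"
      unfolding energy_def by (intro tendsto_sum tendsto_mult_left tendsto_power tendsto_norm lim m)
    moreover have "\<forall>\<^sub>F i in sequentially. 1 / 2 \<le> energy m (pull z (k i) m)"
      using large[of m] by (rule eventually_mono) (intro low less_imp_le)
    ultimately have "1 / 2 \<le> energy m (b m)"
      by (rule tendsto_lowerbound) simp
    then have "energy m (b m) \<noteq> 0" by auto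
    then have "\<exists>u \<in> V m. b m u \<noteq> 0" by (rule contrapos_np) (simp add: energy_def)
    then show "\<exists>m\<ge>1. \<exists>u \<in> V m. b m u \<noteq> 0" using m by blast
  qed
qed

end

section \<open>Invariant measures on the path space\<close>

lemma space_borel_of: "space (borel_of X) = topspace X"
  and sets_borel_of: "sets (borel_of X) = sigma_sets (topspace X) {U. openin X U}"
proof -
  have "{U. openin X U} \<subseteq> Pow (topspace X)" using openin_subset by blast
  then show "sets (borel_of X) = sigma_sets (topspace X) {U. openin X U}"
    unfolding borel_of_def by (rule sets_measure_of)
qed (simp add: borel_of_def space_measure_of_conv)

lemma topspace_path_space: "topspace (path_space B) = inf_paths B"
  unfolding path_space_def by (auto simp: inf_paths_def)

text \<open>Exact rank is recorded as a mass bound for all vertices, stability for consecutive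
  levels. Infinitely many paths, inherited from the Cantor space, force the heights to grow and
  single points to be null.\<close>

locale measured_bv = proper_bv + prob_space P for P :: "(nat \<Rightarrow> 'b) measure" +
  fixes \<delta> :: real
  assumes invariant: "invariant_measure (path_space B) (vershik B) P"
    and delta: "0 < \<delta>"
    and level_mass: "1 \<le> n \<Longrightarrow> v \<in> verts B n \<Longrightarrow> \<delta> \<le> measure P {x \<in> space P. tau B n x = v}"
    and stability: "1 \<le> n \<Longrightarrow> u \<in> verts B n \<Longrightarrow> v \<in> verts B (Suc n) \<Longrightarrow>
      \<delta> / 2 < real (height B n u) / real (height B (Suc n) v) * real (inc_mat B (Suc n) u v)"
    and infinite_paths: "infinite (inf_paths B)"
begin

lemma sets_P: "sets P = sigma_sets (inf_paths B) {U. openin (path_space B) U}"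
  using invariant by (simp add: invariant_measure_def sets_borel_of topspace_path_space)

lemma space_P: "space P = inf_paths B"
  using invariant sets_eq_imp_space_eq[of P "borel_of (path_space B)"]
  by (simp add: invariant_measure_def space_borel_of topspace_path_space)

lemma vershik_measurable [measurable]: "vershik B \<in> measurable P P"
  and distr_vershik: "distr P P (vershik B) = P"
  using invariant by (simp_all add: invariant_measure_def)

lemma coord_measurable: "1 \<le> i \<Longrightarrow> (\<lambda>x. x i) \<in> measurable P (count_space (edges B i))"
proof -
  assume i: "1 \<le> i"
  have "continuous_map (path_space B) (discrete_topology (edges B i)) (\<lambda>x. x i)"
    unfolding path_space_def
    using i by (intro continuous_map_from_subtopology continuous_map_product_projection) auto
  then have "openin (path_space B) {x \<in> topspace (path_space B). x i \<in> {e}}" if "e \<in> edges B i" for e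
    using that by (intro openin_continuous_map_preimage[of _ "discrete_topology (edges B i)"]) auto
  then have "(\<lambda>x. x i) -` {e} \<inter> space P \<in> sets P" if "e \<in> edges B i" for e
    using that unfolding sets_P space_P topspace_path_space
    by (intro sigma_sets.Basic) (simp add: vimage_def Int_def conj_commute)
  then show ?thesis
    using finite_edges[OF i] inf_path_edge i by (auto simp: measurable_count_space_eq2 space_P)
qed

lemma tau_measurable: "1 \<le> n \<Longrightarrow> tau B n \<in> measurable P (count_space UNIV)"
  unfolding tau_def[abs_def] by (rule measurable_compose[OF coord_measurable]) auto

lemma return_time_measurable: "return_time B n \<in> measurable P (count_space UNIV)"
proof (induction n)
  case (Suc n)
  show ?case
  proof (cases "1 \<le> n")
    case True
    have "(\<lambda>x. i + climb B n (x (Suc n))) \<in> measurable P (count_space UNIV)" for i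
      by (rule measurable_compose[OF coord_measurable]) auto
    then have "(\<lambda>x. return_time B n x + climb B n (x (Suc n))) \<in> measurable P (count_space UNIV)"
      by (rule measurable_compose_countable[OF _ Suc])
    then show ?thesis using True by (simp add: return_time_Suc cong: measurable_cong)
  qed (auto simp: return_time_def)
qed (simp add: return_time_def)

lemma cell_sets [measurable]: "1 \<le> n \<Longrightarrow> cell B n v j \<in> sets P"
proof -
  assume n: "1 \<le> n"
  have "tau B n -` {v} \<inter> space P \<inter> (return_time B n -` {j} \<inter> space P) \<in> sets P"
    using measurable_sets[OF tau_measurable[OF n], of "{v}"] measurable_sets[OF return_time_measurable, of "{j}" n] by auto
  moreover have "tau B n -` {v} \<inter> space P \<inter> (return_time B n -` {j} \<inter> space P) = cell B n v j"
    by (auto simp: cell_def space_P)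
  ultimately show ?thesis by simp
qed

lemma height_pos: "1 \<le> n \<Longrightarrow> v \<in> verts B n \<Longrightarrow> 0 < height B n v"
  using ex_min_path[of n v] finite_paths_to[of n v] by (auto simp: height_def card_gt_0_iff)

lemma climb_less_height: "1 \<le> n \<Longrightarrow> e \<in> edges B (Suc n) \<Longrightarrow> j < height B n (src B e) \<Longrightarrow>
    climb B n e + j < height B (Suc n) (rng B e)"
  using climb_height(1)[of n e] by simp

definition cell_mass :: "nat \<Rightarrow> 'a \<Rightarrow> real" where
  "cell_mass n v = measure P (cell B n v 0)"

lemma vershik_vimage_cell': "1 \<le> n \<Longrightarrow> Suc j < height B n v \<Longrightarrow>
    vershik B -` cell B n v j \<inter> space P = cell B n v (Suc j)"
  using vershik_vimage_cell[of n j v] by (auto simp: space_P)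

text \<open>Each floor is the preimage of the one above it, and the measure is invariant.\<close>

lemma measure_cell:
  assumes "1 \<le> n" "j < height B n v"
  shows "measure P (cell B n v j) = cell_mass n v"
  using assms(2)
proof (induction j)
  case (Suc j)
  have "measure P (cell B n v j) = measure (distr P P (vershik B)) (cell B n v j)"
    by (simp add: distr_vershik)
  also have "\<dots> = measure P (cell B n v (Suc j))"
    using assms(1) Suc.prems by (subst measure_distr) (auto simp: vershik_vimage_cell' cell_sets)
  finally show ?case using Suc by simp
qed (simp add: cell_mass_def)

lemma cell_empty:
  assumes "1 \<le> n" "\<not> (v \<in> verts B n \<and> j < height B n v)"
  shows "cell B n v j = {}"
  using assms return_time_less[OF assms(1)] tau_verts[OF _ assms(1)] by (auto simp: cell_def)

lemma level_tower: "1 \<le> n \<Longrightarrow> {x \<in> space P. tau B n x = v} = (\<Union>j \<in> {..<height B n v}. cell B n v j)"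
  using return_time_less[of n] by (auto simp: cell_def space_P)

lemma measure_level:
  assumes "1 \<le> n"
  shows "measure P {x \<in> space P. tau B n x = v} = real (height B n v) * cell_mass n v"
proof -
  have "measure P (\<Union>j \<in> {..<height B n v}. cell B n v j) = (\<Sum>j<height B n v. measure P (cell B n v j))"
    using assms by (intro finite_measure_finite_Union) (auto simp: disjoint_family_on_def cell_def intro!: cell_sets[unfolded cell_def])
  then show ?thesis using assms by (simp add: level_tower measure_cell)
qed

lemma sum_level:
  assumes "1 \<le> n"
  shows "(\<Sum>v \<in> verts B n. measure P {x \<in> space P. tau B n x = v}) = 1"
proof -
  have "measure P (\<Union>v \<in> verts B n. {x \<in> space P. tau B n x = v}) = (\<Sum>v \<in> verts B n. measure P {x \<in> space P. tau B n x = v})"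
    using finite_verts measurable_sets[OF tau_measurable[OF assms], of "{_}"]
    by (intro finite_measure_finite_Union) (auto simp: disjoint_family_on_def vimage_def Int_def conj_commute)
  moreover have "(\<Union>v \<in> verts B n. {x \<in> space P. tau B n x = v}) = space P"
    using tau_verts assms by (auto simp: space_P)
  ultimately show ?thesis by (simp add: prob_space)
qed

lemma cell_mass_pos:
  assumes "1 \<le> n" "v \<in> verts B n"
  shows "0 < cell_mass n v"
proof -
  have "0 < real (height B n v) * cell_mass n v"
    using level_mass[OF assms] measure_level[OF assms(1), of v] delta by linarith
  then show ?thesis by (simp add: zero_less_mult_iff)
qed

text \<open>Splitting of \<open>q\<close> is the decomposition of the top floor by the next edge;
  splitting of \<open>h\<close> is the count of paths by their last edge. Edge levels are shifted by
  one, since \<open>edges B (Suc n)\<close> starts at vertices of level \<open>n\<close>.\<close>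

sublocale weighted_graph "verts B" "\<lambda>n. edges B (Suc n)" "src B" "rng B" "\<lambda>n v. real (height B n v)" cell_mass \<delta>
proof
  fix n :: nat and u assume n: "1 \<le> n" and u: "u \<in> verts B n"
  have "cell_mass n u = measure P (\<Union>e \<in> {e \<in> edges B (Suc n). src B e = u}. cell B (Suc n) (rng B e) (climb B n e + 0))"
    using cell_split(1)[OF n height_pos[OF n u]] by (simp add: cell_mass_def)
  also have "\<dots> = (\<Sum>e \<in> {e \<in> edges B (Suc n). src B e = u}. measure P (cell B (Suc n) (rng B e) (climb B n e + 0)))"
    using cell_split(2)[OF n height_pos[OF n u]] finite_edges[of "Suc n"] cell_sets[of "Suc n"]
    by (intro finite_measure_finite_Union) auto
  also have "\<dots> = (\<Sum>e \<in> {e \<in> edges B (Suc n). src B e = u}. cell_mass (Suc n) (rng B e))"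
    using climb_less_height[OF n, of _ 0] height_pos[OF n u] by (intro sum.cong refl measure_cell) auto
  finally show "(\<Sum>e \<in> {e \<in> edges B (Suc n). src B e = u}. cell_mass (Suc n) (rng B e)) = cell_mass n u" by simp
next
  fix n :: nat and v assume n: "1 \<le> n"
  show "(\<Sum>e \<in> {e \<in> edges B (Suc n). rng B e = v}. real (height B n (src B e))) = real (height B (Suc n) v)"
    using height_Suc[OF n, of v] by simp
next
  fix n :: nat assume "1 \<le> n"
  then show "(\<Sum>u \<in> verts B n. real (height B n u) * cell_mass n u) = 1"
    using sum_level measure_level by simp
next
  fix n :: nat and u v assume "1 \<le> n" "u \<in> verts B n" "v \<in> verts B (Suc n)"
  then show "\<delta> / 2 < real (height B n u) / real (height B (Suc n) v) *
      real (card {e \<in> edges B (Suc n). src B e = u \<and> rng B e = v})"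
    using stability by (simp add: inc_mat_def)
qed (use finite_verts finite_edges src_verts rng_verts height_pos cell_mass_pos delta level_mass measure_level in auto)

text \<open>Any \<open>k\<close> paths are separated by the floors of a late level, so the heights
  there sum to at least \<open>k\<close>. One level further each vertex receives an edge from every
  vertex, and its height is at least that sum.\<close>

lemma height_unbounded: "\<exists>n\<ge>1. \<forall>v \<in> verts B n. k \<le> height B n v"
proof -
  obtain F where F: "F \<subseteq> inf_paths B" "finite F" "card F = k"
    using infinite_arbitrarily_large[OF infinite_paths] by blast
  have "\<exists>i\<ge>1. x i \<noteq> y i" if "x \<in> F" "y \<in> F" "x \<noteq> y" for x y
    using that F(1) inf_paths_eqI[of x y] by blast
  then obtain i where i: "\<And>x y. x \<in> F \<Longrightarrow> y \<in> F \<Longrightarrow> x \<noteq> y \<Longrightarrow> 1 \<le> i x y \<and> x (i x y) \<noteq> y (i x y)"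
    by metis
  define n where "n = Max (insert 1 ((\<lambda>(x, y). i x y) ` (F \<times> F)))"
  have n: "1 \<le> n" unfolding n_def using F(2) by (intro Max_ge) auto
  have i_le: "i x y \<le> n" if "x \<in> F" "y \<in> F" for x y
    unfolding n_def using F(2) that by (intro Max_ge) auto
  have "inj_on (\<lambda>x. (tau B n x, return_time B n x)) F"
  proof (rule inj_onI, rule ccontr)
    fix x y assume xy: "x \<in> F" "y \<in> F" "(tau B n x, return_time B n x) = (tau B n y, return_time B n y)" "x \<noteq> y"
    then show False
      using cell_determines[OF n, of x "tau B n x" "return_time B n x" y "i x y"] i[of x y] i_le[of x y] F(1)
      by (auto simp: cell_def)
  qed
  moreover have "(\<lambda>x. (tau B n x, return_time B n x)) ` F \<subseteq> (SIGMA u:verts B n. {..<height B n u})"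
    using F(1) return_time_less[OF n] tau_verts[OF _ n] by auto
  ultimately have "card F \<le> card (SIGMA u:verts B n. {..<height B n u})"
    using finite_verts by (intro card_inj_on_le finite_SigmaI) auto
  then have k: "k \<le> (\<Sum>u \<in> verts B n. height B n u)"
    using finite_verts by (simp add: card_SigmaI F(3))
  have "k \<le> height B (Suc n) v" if v: "v \<in> verts B (Suc n)" for v
  proof -
    have im: "src B ` {e \<in> edges B (Suc n). rng B e = v} = verts B n"
      using ex_edge[OF n _ v] src_verts by fastforce
    have "(\<Sum>u \<in> verts B n. height B n u) \<le> height B (Suc n) v"
      unfolding height_Suc[OF n] im[symmetric]
      using finite_edges[of "Suc n"] sum_image_le[of "{e \<in> edges B (Suc n). rng B e = v}" "height B n" "src B"]
      by (simp add: o_def)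
    then show ?thesis using k by simp
  qed
  then show ?thesis by (intro exI[of _ "Suc n"]) auto
qed

text \<open>A floor of a tower of height \<open>h\<close> has mass at most \<open>1 / h\<close>, and
  the point lies in floors of arbitrarily high towers. This disposes of the maximal path, where the
  map never becomes a shift by one floor.\<close>

lemma AE_not_point: "y \<in> inf_paths B \<Longrightarrow> AE x in P. x \<noteq> y"
proof -
  assume y: "y \<in> inf_paths B"
  define N where "N = (\<Inter>n \<in> {1..}. cell B n (tau B n y) (return_time B n y))"
  have N: "N \<in> sets P" unfolding N_def by (intro sets.countable_INT') auto
  have small: "measure P N \<le> 1 / real (Suc k)" for k
  proof -
    obtain n where n: "1 \<le> n" "\<And>v. v \<in> verts B n \<Longrightarrow> Suc k \<le> height B n v"
      using height_unbounded[of "Suc k"] by blast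
    let ?v = "tau B n y"
    have v: "?v \<in> verts B n" using tau_verts[OF y n(1)] .
    have "measure P N \<le> measure P (cell B n ?v (return_time B n y))"
      using n by (intro finite_measure_mono) (auto simp: N_def)
    also have "\<dots> = cell_mass n ?v" by (rule measure_cell[OF n(1) return_time_less[OF n(1) y]])
    also have "\<dots> \<le> 1 / real (height B n ?v)"
      using mass_le[OF n(1) v] height_pos[OF n(1) v] by (simp add: field_simps)
    also have "\<dots> \<le> 1 / real (Suc k)"
      using n(2)[OF v] by (intro divide_left_mono) auto
    finally show ?thesis .
  qed
  have "measure P N \<le> 0"
    using lim_inverse_n' LIMSEQ_Suc[OF lim_inverse_n'] small by (intro LIMSEQ_le_const[of "\<lambda>k. 1 / real (Suc k)"]) auto
  then have "emeasure P N = 0" by (simp add: emeasure_eq_measure measure_le_0_iff)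
  moreover have "{x \<in> space P. \<not> x \<noteq> y} \<subseteq> N" using y by (auto simp: N_def cell_def)
  ultimately show ?thesis using N by (intro AE_I)
qed

end

section \<open>Eigenfunctions and consistent families\<close>

context measured_bv
begin

text \<open>Floors form a base of the topology: a basic open set restricts finitely many
  coordinates, and a floor of late enough level fixes all of these.\<close>

lemma cell_in_open:
  assumes U: "openin (path_space B) U" and x: "x \<in> U"
  shows "\<exists>n\<ge>1. cell B n (tau B n x) (return_time B n x) \<subseteq> U"
proof -
  obtain T where T: "openin (product_topology (\<lambda>i. discrete_topology (edges B i)) {1..}) T" "U = T \<inter> inf_paths B"
    using U unfolding path_space_def openin_subtopology by blast
  obtain W where W: "finite {i \<in> {1..}. W i \<noteq> edges B i}" "x \<in> Pi\<^sub>E {1..} W" "Pi\<^sub>E {1..} W \<subseteq> T"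
    using T x unfolding openin_product_topology_alt by fastforce
  define n where "n = Max (insert 1 {i \<in> {1..}. W i \<noteq> edges B i})"
  have n: "1 \<le> n" unfolding n_def using W(1) by (intro Max_ge) auto
  have "cell B n (tau B n x) (return_time B n x) \<subseteq> U"
  proof
    fix y assume y: "y \<in> cell B n (tau B n x) (return_time B n x)"
    have x': "x \<in> inf_paths B" using x T by simp
    then have xc: "x \<in> cell B n (tau B n x) (return_time B n x)" by (simp add: cell_def)
    have y': "y \<in> inf_paths B" using y by (simp add: cell_def)
    have "y i \<in> W i" if i: "1 \<le> i" for i
    proof (cases "i \<le> n")
      case True
      then have "y i = x i" using cell_determines[OF n y xc i] by simp
      then show ?thesis using W(2) i by auto
    next
      case False
      then have "W i = edges B i"
        using Max_ge[of "insert 1 {i \<in> {1..}. W i \<noteq> edges B i}" i] W(1) i unfolding n_def by auto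
      then show ?thesis using inf_path_edge[OF y' i] by simp
    qed
    then have "y \<in> Pi\<^sub>E {1..} W" using y' by (auto simp: inf_paths_def PiE_def)
    then show "y \<in> U" using W(3) T(2) y' by auto
  qed
  then show ?thesis using n by blast
qed

text \<open>The empty set is added so that the family is closed under intersection: two floors are
  either disjoint or nested.\<close>

definition cells :: "(nat \<Rightarrow> 'b) set set" where
  "cells = insert {} (\<Union>n \<in> {1..}. \<Union>v \<in> verts B n. range (cell B n v))"

lemma cells_cell: "1 \<le> n \<Longrightarrow> cell B n v j \<in> cells"
proof (cases "v \<in> verts B n")
  case False
  assume "1 \<le> n"
  then show ?thesis using cell_empty[of n v j] False by (simp add: cells_def)
qed (auto simp: cells_def)

lemma cells_cases:
  assumes "A \<in> cells"
  obtains "A = {}" | n v j where "1 \<le> n" "A = cell B n v j"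
  using assms by (auto simp: cells_def)

lemma countable_cells: "countable cells"
  unfolding cells_def by (intro countable_insert countable_UN countable_finite[OF finite_verts]) auto

lemma cells_subset: "cells \<subseteq> Pow (inf_paths B)"
  by (auto simp: cells_def cell_def)

lemma sets_P_cells: "sets P \<subseteq> sigma_sets (inf_paths B) cells"
  unfolding sets_P
proof (rule sigma_sets_mono, rule subsetI)
  fix U assume "U \<in> {U. openin (path_space B) U}"
  then have U: "openin (path_space B) U" by simp
  have "U = \<Union> {C \<in> cells. C \<subseteq> U}"
  proof (intro equalityI subsetI)
    fix x assume x: "x \<in> U"
    then have "x \<in> inf_paths B" using openin_subset[OF U] topspace_path_space by blast
    then have "x \<in> cell B n (tau B n x) (return_time B n x)" for n by (simp add: cell_def)
    then show "x \<in> \<Union> {C \<in> cells. C \<subseteq> U}"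
      using cell_in_open[OF U x] cells_cell by blast
  qed blast
  moreover have "\<Union> {C \<in> cells. C \<subseteq> U} \<in> sigma_sets (inf_paths B) cells"
    using countable_cells by (intro sigma_sets_UNION) (auto intro: countable_subset sigma_sets.Basic)
  ultimately show "U \<in> sigma_sets (inf_paths B) cells" by simp
qed

lemma cell_nested:
  assumes "1 \<le> n" "n \<le> m" "x \<in> cell B n v j \<inter> cell B m w k"
  shows "cell B m w k \<subseteq> cell B n v j"
proof
  fix y assume y: "y \<in> cell B m w k"
  have x: "x \<in> cell B m w k" using assms(3) by simp
  have eq: "y i = x i" if "1 \<le> i" "i \<le> n" for i
    using cell_determines[OF _ y x that(1)] assms(1,2) that by simp
  have "tau B n y = tau B n x" using eq assms(1) by (simp add: tau_def)
  moreover have "return_time B n y = return_time B n x"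
    unfolding return_time_def by (intro sum.cong refl) (simp add: eq)
  ultimately show "y \<in> cell B n v j" using assms(3) y by (auto simp: cell_def)
qed

lemma Int_stable_cells: "Int_stable cells"
proof (rule Int_stableI)
  fix a b assume "a \<in> cells" "b \<in> cells"
  show "a \<inter> b \<in> cells"
  proof (cases "a \<inter> b = {}")
    case False
    then obtain x where x: "x \<in> a" "x \<in> b" by blast
    obtain n v j where a: "1 \<le> n" "a = cell B n v j" using \<open>a \<in> cells\<close> x(1) by (auto elim: cells_cases)
    obtain m w k where b: "1 \<le> m" "b = cell B m w k" using \<open>b \<in> cells\<close> x(2) by (auto elim: cells_cases)
    from x a b have "a \<inter> b = a \<or> a \<inter> b = b"
      using cell_nested[of n m x v j w k] cell_nested[of m n x w k v j] by (cases "n \<le> m") auto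
    then show ?thesis using \<open>a \<in> cells\<close> \<open>b \<in> cells\<close> by auto
  qed (simp add: cells_def)
qed

section \<open>Decomposition of integrals along floors\<close>

lemma indicator_cells:
  assumes "1 \<le> n" "x \<in> inf_paths B"
  shows "(\<Sum>v \<in> verts B n. \<Sum>j<height B n v. indicat_real (cell B n v j) x) = 1"
proof -
  have "(\<Sum>v \<in> verts B n. \<Sum>j<height B n v. indicat_real (cell B n v j) x) =
      (\<Sum>v \<in> verts B n. if v = tau B n x then \<Sum>j<height B n v. if j = return_time B n x then 1 else 0 else 0)"
    using assms(2) by (intro sum.cong refl) (auto simp: cell_def indicator_def intro!: sum.cong)
  also have "\<dots> = 1"
    using tau_verts[OF assms(2,1)] return_time_less[OF assms] finite_verts by simp
  finally show ?thesis .
qed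

lemma integrable_cell: "1 \<le> n \<Longrightarrow> integrable P f \<Longrightarrow> set_integrable P (cell B n v j) f"
  for f :: "_ \<Rightarrow> 'c::{banach, second_countable_topology}"
  unfolding set_integrable_def by (intro integrable_mult_indicator) (auto simp: cell_sets)

lemma integral_cells:
  fixes f :: "_ \<Rightarrow> 'c::{banach, second_countable_topology}"
  assumes n: "1 \<le> n" and f: "integrable P f"
  shows "(LINT x|P. f x) = (\<Sum>v \<in> verts B n. \<Sum>j<height B n v. LINT x:cell B n v j|P. f x)"
proof -
  have "(LINT x|P. f x) = (LINT x|P. (\<Sum>v \<in> verts B n. \<Sum>j<height B n v. indicat_real (cell B n v j) x *\<^sub>R f x))"
  proof (rule Bochner_Integration.integral_cong[OF refl])
    fix x assume "x \<in> space P"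
    then have "(\<Sum>v \<in> verts B n. \<Sum>j<height B n v. indicat_real (cell B n v j) x) *\<^sub>R f x = f x"
      using indicator_cells[OF n] by (simp add: space_P)
    then show "f x = (\<Sum>v \<in> verts B n. \<Sum>j<height B n v. indicat_real (cell B n v j) x *\<^sub>R f x)"
      by (simp add: scaleR_sum_left)
  qed
  also have "\<dots> = (\<Sum>v \<in> verts B n. \<Sum>j<height B n v. LINT x:cell B n v j|P. f x)"
    using integrable_cell[OF n f]
    by (simp only: set_lebesgue_integral_def set_integrable_def Bochner_Integration.integral_sum
          Bochner_Integration.integrable_sum)
  finally show ?thesis .
qed

lemma integral_cell_split:
  fixes f :: "_ \<Rightarrow> 'c::{banach, second_countable_topology}"
  assumes n: "1 \<le> n" and j: "j < height B n u" and f: "integrable P f"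
  shows "(LINT x:cell B n u j|P. f x) =
    (\<Sum>e \<in> {e \<in> edges B (Suc n). src B e = u}. LINT x:cell B (Suc n) (rng B e) (climb B n e + j)|P. f x)"
  unfolding cell_split(1)[OF n j]
  using finite_edges[of "Suc n"] cell_split(2)[OF n j] f
  by (intro set_integral_finite_Union integrable_cell cell_sets) auto

text \<open>The sets over which \<open>f\<close> integrates to zero form a Dynkin system that
  contains the floors, an intersection-stable generator; a function with vanishing integrals over
  all measurable sets is zero almost everywhere.\<close>

lemma AE_zero_if_cells:
  fixes f :: "_ \<Rightarrow> complex"
  assumes f: "integrable P f" and zero: "\<And>n v j. 1 \<le> n \<Longrightarrow> (LINT x:cell B n v j|P. f x) = 0"
  shows "AE x in P. f x = 0"
proof (rule density_zero[OF f])
  fix A assume "A \<in> sets P"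
  then have "A \<in> sigma_sets (inf_paths B) cells" using sets_P_cells by blast
  moreover have cells_P: "sigma_sets (inf_paths B) cells \<subseteq> sets P"
  proof -
    have "cells \<subseteq> sets P" by (auto simp: cells_def cell_sets)
    then show ?thesis using sets.sigma_sets_subset[of cells P] by (simp add: space_P)
  qed
  have all: "(LINT x|P. f x) = 0" using integral_cells[OF _ f, of 1] zero[of 1] by simp
  have int: "set_integrable P A f" if "A \<in> sets P" for A
    using f that unfolding set_integrable_def by (intro integrable_mult_indicator)
  from Int_stable_cells cells_subset calculation show "(LINT x:A|P. f x) = 0"
  proof (induction rule: sigma_sets_induct_disjoint)
    case (basic A)
    have "(LINT x:{}|P. f x) = 0" by (simp add: set_lebesgue_integral_def)
    then show ?case using basic by (auto elim: cells_cases simp: zero)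
  next
    case (compl A)
    then have A: "A \<in> sets P" using cells_P by blast
    have "(LINT x:A \<union> (space P - A)|P. f x) = (LINT x:A|P. f x) + (LINT x:space P - A|P. f x)"
      using A by (intro set_integral_Un int) auto
    moreover have "A \<union> (space P - A) = space P" using sets.sets_into_space[OF A] by blast
    ultimately show ?case using compl all by (simp add: space_P[symmetric] set_integral_space[OF f])
  next
    case (union A)
    then have A: "A i \<in> sets P" for i using cells_P by blast
    then have "(LINT x:(\<Union>i. A i)|P. f x) = (\<Sum>i. LINT x:A i|P. f x)"
      using union(1) by (intro lebesgue_integral_countable_add int) (auto simp: disjoint_family_on_def)
    then show ?case using union by simp
  qed (simp add: set_lebesgue_integral_def)
qed


lemma integral_cell_vershik:
  fixes f :: "_ \<Rightarrow> complex"
  assumes f: "f \<in> borel_measurable P" and eig: "AE x in P. f (vershik B x) = c * f x"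
    and n: "1 \<le> n" and j: "Suc j < height B n v"
  shows "(LINT x:cell B n v j|P. f x) = c * (LINT x:cell B n v (Suc j)|P. f x)"
proof -
  let ?g = "\<lambda>x. indicat_real (cell B n v j) x *\<^sub>R f x"
  have [measurable]: "f \<in> borel_measurable P" "cell B n v j \<in> sets P" "cell B n v (Suc j) \<in> sets P"
    using f n by (auto simp: cell_sets)
  have ind: "indicat_real (cell B n v j) (vershik B x) = indicat_real (cell B n v (Suc j)) x" if "x \<in> space P" for x
    using vershik_vimage_cell'[OF n j] that by (auto simp: indicator_def)
  have "(LINT x|P. ?g x) = (LINT x|distr P P (vershik B). ?g x)" by (simp add: distr_vershik)
  also have "\<dots> = (LINT x|P. ?g (vershik B x))" by (rule integral_distr) measurable
  also have "\<dots> = (LINT x|P. c * (indicat_real (cell B n v (Suc j)) x *\<^sub>R f x))"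
  proof (rule integral_cong_AE)
    show "AE x in P. ?g (vershik B x) = c * (indicat_real (cell B n v (Suc j)) x *\<^sub>R f x)"
      using eig AE_space by eventually_elim (simp add: ind)
  qed measurable
  also have "\<dots> = c * (LINT x|P. indicat_real (cell B n v (Suc j)) x *\<^sub>R f x)"
    by (rule integral_mult_right_zero)
  finally show ?thesis by (simp only: set_lebesgue_integral_def)
qed

lemma set_integral_Cauchy_Schwarz:
  fixes f :: "_ \<Rightarrow> complex"
  assumes A: "A \<in> sets P" "0 < measure P A"
    and f: "integrable P f" "integrable P (\<lambda>x. (cmod (f x))\<^sup>2)"
  shows "(cmod (LINT x:A|P. f x))\<^sup>2 \<le> measure P A * (LINT x:A|P. (cmod (f x))\<^sup>2)"
proof -
  define q where "q = measure P A"
  define F where "F = (LINT x:A|P. cmod (f x))"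
  define G where "G = (LINT x:A|P. (cmod (f x))\<^sup>2)"
  have int: "set_integrable P A g" if "integrable P g" for g :: "_ \<Rightarrow> real"
    using that A unfolding set_integrable_def by (intro integrable_mult_indicator)
  have "cmod (LINT x:A|P. f x) \<le> F"
    unfolding F_def set_lebesgue_integral_def
    by (rule order_trans[OF integral_norm_bound]) simp
  then have 1: "(cmod (LINT x:A|P. f x))\<^sup>2 \<le> F\<^sup>2" by (intro power_mono) auto
  \<comment> \<open>Cauchy-Schwarz as nonnegativity of the variance on \<open>A\<close> about the
    mean \<open>F / q\<close>.\<close>
  have "0 \<le> (LINT x:A|P. (cmod (f x) - F / q)\<^sup>2)"
    unfolding set_lebesgue_integral_def by (intro integral_nonneg_AE) auto
  also have "\<dots> = (LINT x:A|P. ((cmod (f x))\<^sup>2 - 2 * (F / q) * cmod (f x)) + (F / q)\<^sup>2)"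
    by (simp add: power2_diff algebra_simps)
  also have "\<dots> = G - 2 * (F / q) * F + (F / q)\<^sup>2 * q"
  proof -
    have i: "set_integrable P A (\<lambda>x. (cmod (f x))\<^sup>2)" "set_integrable P A (\<lambda>x. 2 * (F / q) * cmod (f x))"
      "set_integrable P A (\<lambda>x. (F / q)\<^sup>2)"
      using f by (auto intro!: int)
    have "(LINT x:A|P. (F / q)\<^sup>2) = (F / q)\<^sup>2 * q"
      using A by (simp add: set_integral_const emeasure_eq_measure q_def)
    then show ?thesis
      by (simp only: set_integral_add(2)[OF set_integral_diff(1)[OF i(1,2)] i(3)] set_integral_diff(2)[OF i(1,2)]
            set_integral_mult_right F_def[symmetric] G_def[symmetric])
  qed
  also have "\<dots> = G - F\<^sup>2 / q"
    using A by (simp add: q_def power2_eq_square field_simps)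
  finally have "F\<^sup>2 \<le> q * G" using A by (simp add: q_def field_simps)
  then show ?thesis using 1 by (simp add: q_def G_def)
qed

lemma integrable_if_square:
  fixes f :: "_ \<Rightarrow> complex"
  assumes "f \<in> borel_measurable P" "integrable P (\<lambda>x. (cmod (f x))\<^sup>2)"
  shows "integrable P f"
proof (rule Bochner_Integration.integrable_bound)
  show "integrable P (\<lambda>x. 1 + (cmod (f x))\<^sup>2)" using assms by simp
  have "cmod z \<le> 1 + (cmod z)\<^sup>2" for z :: complex
  proof -
    have "2 * cmod z \<le> 1 + (cmod z)\<^sup>2" using sum_squares_bound[of 1 "cmod z"] by simp
    then show ?thesis using norm_ge_zero[of z] by linarith
  qed
  then show "AE x in P. cmod (f x) \<le> norm (1 + (cmod (f x))\<^sup>2)" by simp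
qed (rule assms)

text \<open>\<open>b n v\<close> is the mean of the eigenfunction over the top floor; one floor
  further down costs a factor \<open>cnj c\<close>. Consistency is the decomposition of the top
  floor by the next edge, the energy bound is Cauchy-Schwarz on each floor, and \<open>b\<close>
  cannot vanish because floors determine \<open>f\<close>.\<close>

theorem eigenfunction_imp_consistent:
  assumes eig: "eigenvalue_for (vershik B) P c" and c: "cmod c = 1"
  obtains b K where "\<And>n. 1 \<le> n \<Longrightarrow> consistent_step n (\<lambda>e. cnj c ^ climb B n e) (b n) (b (Suc n))"
    "\<And>n. 1 \<le> n \<Longrightarrow> energy n (b n) \<le> K" "\<exists>m\<ge>1. \<exists>u \<in> verts B m. b m u \<noteq> 0"
proof -
  obtain f where f: "f \<in> borel_measurable P" "integrable P (\<lambda>x. (cmod (f x))\<^sup>2)"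
    "\<not> (AE x in P. f x = 0)" "AE x in P. f (vershik B x) = c * f x"
    using eig unfolding eigenvalue_for_def by blast
  note int = integrable_if_square[OF f(1,2)]
  have cc: "cnj c * c = 1" using c complex_norm_square[of c] by (simp add: mult.commute)
  have shift: "(LINT x:cell B n v j|P. f x) = cnj c ^ j * (LINT x:cell B n v 0|P. f x)"
    if "1 \<le> n" "j < height B n v" for n v j
    using that(2)
  proof (induction j)
    case (Suc j)
    have "(LINT x:cell B n v (Suc j)|P. f x) = cnj c * (c * (LINT x:cell B n v (Suc j)|P. f x))"
      by (simp add: cc flip: mult.assoc)
    also have "\<dots> = cnj c * (LINT x:cell B n v j|P. f x)"
      using integral_cell_vershik[OF f(1,4) that(1) Suc.prems] by simp
    finally show ?case using Suc by simp
  qed simp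
  define b where "b n v = (LINT x:cell B n v 0|P. f x) / of_real (cell_mass n v)" for n v
  have b: "of_real (cell_mass n v) * b n v = (LINT x:cell B n v 0|P. f x)" if "1 \<le> n" "v \<in> verts B n" for n v
    using cell_mass_pos[OF that] by (simp add: b_def)
  have "consistent_step n (\<lambda>e. cnj c ^ climb B n e) (b n) (b (Suc n))" if n: "1 \<le> n" for n
    unfolding consistent_step_def
  proof
    fix u assume u: "u \<in> verts B n"
    have "(LINT x:cell B n u 0|P. f x) =
        (\<Sum>e \<in> {e \<in> edges B (Suc n). src B e = u}. LINT x:cell B (Suc n) (rng B e) (climb B n e)|P. f x)"
      using integral_cell_split[OF n height_pos[OF n u] int] by simp
    also have "\<dots> = (\<Sum>e \<in> {e \<in> edges B (Suc n). src B e = u}.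
        of_real (cell_mass (Suc n) (rng B e)) * cnj c ^ climb B n e * b (Suc n) (rng B e))"
    proof (rule sum.cong[OF refl])
      fix e assume e: "e \<in> {e \<in> edges B (Suc n). src B e = u}"
      then have "climb B n e < height B (Suc n) (rng B e)"
        using climb_less_height[OF n, of e 0] height_pos[OF n u] by simp
      then have "(LINT x:cell B (Suc n) (rng B e) (climb B n e)|P. f x) =
          cnj c ^ climb B n e * (of_real (cell_mass (Suc n) (rng B e)) * b (Suc n) (rng B e))"
        using shift[of "Suc n" "climb B n e" "rng B e"] b[of "Suc n" "rng B e"] e rng_verts[of "Suc n" e] by simp
      then show "(LINT x:cell B (Suc n) (rng B e) (climb B n e)|P. f x) =
          of_real (cell_mass (Suc n) (rng B e)) * cnj c ^ climb B n e * b (Suc n) (rng B e)"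
        by (simp add: algebra_simps)
    qed
    finally show "of_real (cell_mass n u) * b n u = (\<Sum>e \<in> {e \<in> edges B (Suc n). src B e = u}.
        of_real (cell_mass (Suc n) (rng B e)) * cnj c ^ climb B n e * b (Suc n) (rng B e))"
      using b[OF n u] by simp
  qed
  moreover have "energy n (b n) \<le> (LINT x|P. (cmod (f x))\<^sup>2)" if n: "1 \<le> n" for n
    unfolding energy_def integral_cells[OF n f(2)]
  proof (rule sum_mono)
    fix v assume v: "v \<in> verts B n"
    have "cell_mass n v * (cmod (b n v))\<^sup>2 \<le> (LINT x:cell B n v j|P. (cmod (f x))\<^sup>2)" if j: "j < height B n v" for j
    proof -
      have q: "measure P (cell B n v j) = cell_mass n v" "0 < cell_mass n v"
        using measure_cell[OF n j] cell_mass_pos[OF n v] by auto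
      have "cmod (LINT x:cell B n v j|P. f x) = cell_mass n v * cmod (b n v)"
        using shift[OF n j] b[OF n v, symmetric] c q by (simp add: norm_mult norm_power)
      then have "(cell_mass n v * cmod (b n v))\<^sup>2 \<le> cell_mass n v * (LINT x:cell B n v j|P. (cmod (f x))\<^sup>2)"
        using set_integral_Cauchy_Schwarz[OF cell_sets[OF n] _ int f(2), of v j] q by simp
      then have "cell_mass n v * (cell_mass n v * (cmod (b n v))\<^sup>2) \<le> cell_mass n v * (LINT x:cell B n v j|P. (cmod (f x))\<^sup>2)"
        by (simp add: power2_eq_square algebra_simps)
      then show ?thesis using q(2) by simp
    qed
    then have "(\<Sum>j<height B n v. cell_mass n v * (cmod (b n v))\<^sup>2) \<le> (\<Sum>j<height B n v. LINT x:cell B n v j|P. (cmod (f x))\<^sup>2)"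
      by (intro sum_mono) auto
    then show "real (height B n v) * cell_mass n v * (cmod (b n v))\<^sup>2 \<le> (\<Sum>j<height B n v. LINT x:cell B n v j|P. (cmod (f x))\<^sup>2)"
      by (simp add: mult.assoc)
  qed
  moreover have "\<exists>m\<ge>1. \<exists>u \<in> verts B m. b m u \<noteq> 0"
  proof (rule ccontr)
    assume "\<not> (\<exists>m\<ge>1. \<exists>u \<in> verts B m. b m u \<noteq> 0)"
    then have zero: "b n v = 0" if "1 \<le> n" "v \<in> verts B n" for n v using that by blast
    have "(LINT x:cell B n v j|P. f x) = 0" if n: "1 \<le> n" for n v j
    proof (cases "v \<in> verts B n \<and> j < height B n v")
      case True
      then show ?thesis using shift[OF n, of j v] b[OF n, of v] zero[OF n] by simp
    next
      case False
      then show ?thesis using cell_empty[OF n False] by (simp add: set_lebesgue_integral_def)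
    qed
    then show False using AE_zero_if_cells[OF int] f(3) by blast
  qed
  ultimately show ?thesis using that by blast
qed


theorem consistent_imp_eigenfunction:
  fixes b :: "nat \<Rightarrow> 'a \<Rightarrow> complex"
  assumes c: "cmod c = 1"
    and step: "\<And>n. 1 \<le> n \<Longrightarrow> consistent_step n (\<lambda>e. cnj c ^ climb B n e) (b n) (b (Suc n))"
    and bound: "\<And>n v. 1 \<le> n \<Longrightarrow> v \<in> verts B n \<Longrightarrow> cmod (b n v) \<le> 1"
    and nz: "\<exists>m\<ge>1. \<exists>u \<in> verts B m. b m u \<noteq> 0"
  shows "eigenvalue_for (vershik B) P c"
proof -
  have cc: "cnj c * c = 1" using c complex_norm_square[of c] by (simp add: mult.commute)
  have cpow: "cmod (cnj c ^ k) = 1" for k using c by (simp add: norm_power)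
  \<comment> \<open>An \<open>L\<^sup>2\<close>-bounded martingale; its limit is the eigenfunction.\<close>
  define F where "F n x = cnj c ^ return_time B n x * b n (tau B n x)" for n x
  have F_meas [measurable]: "F n \<in> borel_measurable P" if "1 \<le> n" for n
  proof -
    have "(\<lambda>x. cnj c ^ return_time B n x) \<in> borel_measurable P" "(\<lambda>x. b n (tau B n x)) \<in> borel_measurable P"
      by (rule measurable_compose[OF return_time_measurable] measurable_compose[OF tau_measurable[OF that]]; simp)+
    then show ?thesis unfolding F_def[abs_def] by simp
  qed
  have F_bound: "cmod (F n x) \<le> 1" if "1 \<le> n" "x \<in> space P" for n x
    using bound[OF that(1) tau_verts[OF _ that(1), of x]] that(2) cpow
    by (simp add: F_def norm_mult space_P)
  have F_int: "integrable P (F n)" if "1 \<le> n" for n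
    using F_bound that by (intro integrable_const_bound[of _ 1]) (auto simp: F_meas)
  have FF_int: "integrable P (\<lambda>x. F n x * cnj (F k x))" if "1 \<le> n" "1 \<le> k" for n k
  proof (rule integrable_const_bound[of _ 1])
    show "AE x in P. cmod (F n x * cnj (F k x)) \<le> 1"
      using F_bound[OF that(1)] F_bound[OF that(2)] by (intro AE_I2) (auto simp: norm_mult intro!: mult_le_one)
    have "cnj \<in> borel_measurable borel" by (intro borel_measurable_continuous_onI continuous_intros)
    then show "(\<lambda>x. F n x * cnj (F k x)) \<in> borel_measurable P"
      using F_meas[OF that(1)] measurable_compose[OF F_meas[OF that(2)], of cnj borel] by simp
  qed
  have F_cell: "(LINT x:cell B n v j|P. F n x) = cnj c ^ j * of_real (cell_mass n v) * b n v"
    if n: "1 \<le> n" and j: "j < height B n v" for n v j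
  proof -
    have "(LINT x:cell B n v j|P. F n x) = (LINT x:cell B n v j|P. cnj c ^ j * b n v)"
      by (intro set_lebesgue_integral_cong cell_sets n) (auto simp: F_def cell_def)
    also have "\<dots> = cnj c ^ j * of_real (cell_mass n v) * b n v"
      using measure_cell[OF n j] cell_sets[OF n] by (simp add: set_integral_const emeasure_eq_measure scaleR_conv_of_real)
    finally show ?thesis .
  qed
  have F_Suc_cell: "(LINT x:cell B n u j|P. F (Suc n) x) = (LINT x:cell B n u j|P. F n x)"
    if n: "1 \<le> n" and u: "u \<in> verts B n" and j: "j < height B n u" for n u j
  proof -
    have "(LINT x:cell B n u j|P. F (Suc n) x) = (\<Sum>e \<in> {e \<in> edges B (Suc n). src B e = u}.
        LINT x:cell B (Suc n) (rng B e) (climb B n e + j)|P. F (Suc n) x)"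
      using integral_cell_split[OF n j F_int[of "Suc n"]] by simp
    also have "\<dots> = (\<Sum>e \<in> {e \<in> edges B (Suc n). src B e = u}.
        cnj c ^ j * (of_real (cell_mass (Suc n) (rng B e)) * cnj c ^ climb B n e * b (Suc n) (rng B e)))"
      using climb_less_height[OF n, of _ j] j
      by (intro sum.cong refl) (auto simp: F_cell power_add)
    also have "\<dots> = cnj c ^ j * (of_real (cell_mass n u) * b n u)"
      using step[OF n] u unfolding consistent_step_def by (simp flip: sum_distrib_left)
    finally show ?thesis using F_cell[OF n j] by simp
  qed
  have F_const: "F k x = F k y" if "1 \<le> k" "k \<le> n" "x \<in> cell B n v j" "y \<in> cell B n v j" for k n v j x y
  proof -
    have eq: "x i = y i" if "1 \<le> i" "i \<le> k" for i
      using cell_determines[of n x v j y i] that \<open>1 \<le> k\<close> \<open>k \<le> n\<close> \<open>x \<in> _\<close> \<open>y \<in> _\<close> by simp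
    then have "tau B k x = tau B k y" using that(1) by (simp add: tau_def)
    moreover have "return_time B k x = return_time B k y"
      unfolding return_time_def by (intro sum.cong refl) (simp add: eq)
    ultimately show ?thesis by (simp add: F_def)
  qed
  \<comment> \<open>For \<open>k \<le> n\<close> the function \<open>F k\<close> is constant on
    floors of level \<open>n\<close>, over which \<open>F (Suc n)\<close> and \<open>F n\<close>
    have equal integrals. So martingale increments are orthogonal to the past.\<close>
  have inner_step: "(LINT x|P. F (Suc n) x * cnj (F k x)) = (LINT x|P. F n x * cnj (F k x))"
    if k: "1 \<le> k" "k \<le> n" for n k
  proof -
    have n: "1 \<le> n" using k by simp
    have "(LINT x:cell B n v j|P. F (Suc n) x * cnj (F k x)) = (LINT x:cell B n v j|P. F n x * cnj (F k x))"
      if v: "v \<in> verts B n" "j < height B n v" for v j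
    proof (cases "cell B n v j = {}")
      case False
      then obtain y where y: "y \<in> cell B n v j" by blast
      have "(LINT x:cell B n v j|P. F i x * cnj (F k x)) = (LINT x:cell B n v j|P. F i x) * cnj (F k y)" for i
      proof -
        have "(LINT x:cell B n v j|P. F i x * cnj (F k x)) = (LINT x:cell B n v j|P. F i x * cnj (F k y))"
          using F_const[OF k _ y] by (intro set_lebesgue_integral_cong cell_sets n) auto
        then show ?thesis by simp
      qed
      then show ?thesis using F_Suc_cell[OF n v] by simp
    qed (simp add: set_lebesgue_integral_def)
    then show ?thesis
      using integral_cells[OF n FF_int[of "Suc n" k]] integral_cells[OF n FF_int[of n k]] n k by simp
  qed
  define L where "L n = energy n (b n)" for n
  have norm_F: "(LINT x|P. (cmod (F n x))\<^sup>2) = L n" if n: "1 \<le> n" for n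
  proof -
    have int: "integrable P (\<lambda>x. (cmod (F n x))\<^sup>2)"
      using F_bound[OF n] F_meas[OF n] by (intro integrable_const_bound[of _ 1]) (auto simp: power_le_one)
    have "(LINT x:cell B n v j|P. (cmod (F n x))\<^sup>2) = cell_mass n v * (cmod (b n v))\<^sup>2" if j: "j < height B n v" for v j
    proof -
      have "(LINT x:cell B n v j|P. (cmod (F n x))\<^sup>2) = (LINT x:cell B n v j|P. (cmod (b n v))\<^sup>2)"
        using cpow by (intro set_lebesgue_integral_cong cell_sets n) (auto simp: F_def cell_def norm_mult)
      then show ?thesis
        using measure_cell[OF n j] cell_sets[OF n] by (simp add: set_integral_const emeasure_eq_measure)
    qed
    then show ?thesis unfolding integral_cells[OF n int] L_def energy_def by (simp add: mult.assoc)
  qed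
  have inner: "(LINT x|P. F n x * cnj (F k x)) = of_real (L k)" if "1 \<le> k" "k \<le> n" for n k
    using that(2)
  proof (induction n rule: dec_induct)
    case base
    have "(LINT x|P. F k x * cnj (F k x)) = (LINT x|P. of_real ((cmod (F k x))\<^sup>2))"
      by (simp only: complex_norm_square)
    also have "\<dots> = of_real (L k)" using norm_F[OF that(1)] by (simp del: of_real_power)
    finally show ?case .
  next
    case (step n)
    then show ?case using inner_step[OF that(1) step.hyps(1)] by simp
  qed
  have dist_F: "(LINT x|P. (cmod (F n x - F k x))\<^sup>2) = L n - L k" if k: "1 \<le> k" "k \<le> n" for n k
  proof -
    have n: "1 \<le> n" using k by simp
    have int: "integrable P (\<lambda>x. (cmod (F i x))\<^sup>2)" if "1 \<le> i" for i
      using F_bound[OF that] F_meas[OF that] by (intro integrable_const_bound[of _ 1]) (auto simp: power_le_one)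
    define G where "G x = F n x * cnj (F k x)" for x
    have G: "integrable P G" using FF_int[OF n k(1)] by (simp add: G_def[abs_def])
    have "(LINT x|P. (cmod (F n x - F k x))\<^sup>2) = (LINT x|P. (cmod (F n x))\<^sup>2 - 2 * Re (G x) + (cmod (F k x))\<^sup>2)"
      by (simp only: norm_diff_sq G_def mult.commute)
    also have "\<dots> = L n - 2 * Re (LINT x|P. G x) + L k"
      using int[OF n] int[OF k(1)] G norm_F[OF n] norm_F[OF k(1)] by simp
    finally show ?thesis using inner[OF k] by (simp add: G_def)
  qed
  have mono: "L n \<le> L k" if n: "1 \<le> n" "n \<le> k" for n k
  proof -
    have "0 \<le> (LINT x|P. (cmod (F k x - F n x))\<^sup>2)" by (intro integral_nonneg_AE) auto
    then show ?thesis using dist_F[OF n] by simp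
  qed
  have L1: "L n \<le> 1" if n: "1 \<le> n" for n
    unfolding norm_F[OF n, symmetric]
    using F_bound[OF n] F_meas[OF n] by (intro integral_le_const integrable_const_bound[of _ 1]) (auto simp: power_le_one)
  have "incseq (\<lambda>n. L (Suc n))" by (rule incseq_SucI) (simp add: mono)
  then obtain l where l: "(\<lambda>n. L (Suc n)) \<longlonglongrightarrow> l"
    by (rule incseq_convergent[where B = 1]) (use L1 in auto)
  \<comment> \<open>The almost everywhere convergent subsequence is extracted from a Cauchy property
    in \<open>L\<^sup>1\<close>; nonnegativity of the variance passes to it from the square
    norm.\<close>
  have F_L1: "(LINT x|P. cmod (F i x - F j x))\<^sup>2 \<le> \<bar>L i - L j\<bar>" if ij: "1 \<le> i" "1 \<le> j" for i j
  proof -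
    have int: "integrable P (\<lambda>x. F i x - F j x)" using F_int ij by simp
    have int2: "integrable P (\<lambda>x. (cmod (F i x - F j x))\<^sup>2)"
    proof (rule integrable_const_bound[of _ 4])
      show "AE x in P. norm ((cmod (F i x - F j x))\<^sup>2) \<le> 4"
      proof (rule AE_I2)
        fix x assume x: "x \<in> space P"
        have "cmod (F i x - F j x) \<le> 2"
          using norm_triangle_ineq4[of "F i x" "F j x"] F_bound[OF ij(1) x] F_bound[OF ij(2) x] by linarith
        then have "(cmod (F i x - F j x))\<^sup>2 \<le> 2\<^sup>2" by (intro power_mono) auto
        then show "norm ((cmod (F i x - F j x))\<^sup>2) \<le> 4" by simp
      qed
      show "(\<lambda>x. (cmod (F i x - F j x))\<^sup>2) \<in> borel_measurable P"
        using F_meas[OF ij(1)] F_meas[OF ij(2)] by measurable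
    qed
    have "variance (\<lambda>x. cmod (F i x - F j x)) = (LINT x|P. (cmod (F i x - F j x))\<^sup>2) - (LINT x|P. cmod (F i x - F j x))\<^sup>2"
      using int int2 by (intro variance_eq) auto
    then have "(LINT x|P. cmod (F i x - F j x))\<^sup>2 \<le> (LINT x|P. (cmod (F i x - F j x))\<^sup>2)"
      using variance_positive[of "\<lambda>x. cmod (F i x - F j x)"] by linarith
    also have "\<dots> \<le> \<bar>L i - L j\<bar>"
      using dist_F[of i j] dist_F[of j i] ij by (cases "i \<le> j") (auto simp: norm_minus_commute)
    finally show ?thesis .
  qed
  obtain r where r: "strict_mono r" "AE x in P. Cauchy (\<lambda>i. F (Suc (r i)) x)"
  proof (rule cauchy_L1_AE_cauchy_subseq[of P "\<lambda>i. F (Suc i)"])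
    show "integrable P (F (Suc i))" for i by (simp add: F_int)
    fix e :: real assume e: "0 < e"
    have "Cauchy (\<lambda>n. L (Suc n))" using l by (rule LIMSEQ_imp_Cauchy)
    then obtain M where M: "\<And>i j. M \<le> i \<Longrightarrow> M \<le> j \<Longrightarrow> dist (L (Suc i)) (L (Suc j)) < e\<^sup>2"
      using e unfolding Cauchy_def by (metis zero_less_power)
    have "(LINT x|P. cmod (F (Suc i) x - F (Suc j) x)) < e" if "M \<le> i" "M \<le> j" for i j
    proof (rule power2_less_imp_less)
      show "(LINT x|P. cmod (F (Suc i) x - F (Suc j) x))\<^sup>2 < e\<^sup>2"
        using F_L1[of "Suc i" "Suc j"] M[OF that] by (simp add: dist_real_def)
    qed (use e in simp)
    then show "\<exists>N. \<forall>i\<ge>N. \<forall>j\<ge>N. (LINT x|P. norm (F (Suc i) x - F (Suc j) x)) < e" by blast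
  qed
  define f where "f x = lim (\<lambda>i. F (Suc (r i)) x)" for x
  have f_meas: "f \<in> borel_measurable P"
    unfolding f_def[abs_def] by (intro borel_measurable_lim_metric F_meas) auto
  have conv: "AE x in P. (\<lambda>i. F (Suc (r i)) x) \<longlonglongrightarrow> f x"
    using r(2) by eventually_elim (auto simp: f_def Cauchy_convergent_iff convergent_LIMSEQ_iff)
  have f_bound: "AE x in P. cmod (f x) \<le> 1"
    using conv AE_space
  proof eventually_elim
    case (elim x)
    then show ?case
      using F_bound[of "Suc (r _)" x] by (intro LIMSEQ_le_const2[OF tendsto_norm[OF elim(1)]]) auto
  qed
  have int_f: "integrable P (\<lambda>x. (cmod (f x))\<^sup>2)"
    using f_bound f_meas by (intro integrable_const_bound[of _ 1]) (auto simp: power_le_one elim: AE_mp)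
  have "(\<lambda>i. LINT x|P. (cmod (F (Suc (r i)) x))\<^sup>2) \<longlonglongrightarrow> (LINT x|P. (cmod (f x))\<^sup>2)"
  proof (rule integral_dominated_convergence[where w = "\<lambda>_. 1"])
    show "AE x in P. (\<lambda>i. (cmod (F (Suc (r i)) x))\<^sup>2) \<longlonglongrightarrow> (cmod (f x))\<^sup>2"
      using conv by eventually_elim (intro tendsto_power tendsto_norm)
    show "AE x in P. norm ((cmod (F (Suc (r i)) x))\<^sup>2) \<le> 1" for i
      using F_bound[of "Suc (r i)"] by (intro AE_I2) (auto simp: power_le_one)
    show "(\<lambda>x. (cmod (F (Suc (r i)) x))\<^sup>2) \<in> borel_measurable P" for i
      using F_meas[of "Suc (r i)"] by measurable
  qed (use f_meas in auto)
  then have lim_L: "(\<lambda>i. L (Suc (r i))) \<longlonglongrightarrow> (LINT x|P. (cmod (f x))\<^sup>2)"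
    by (simp add: norm_F)
  obtain m u where m: "1 \<le> m" "u \<in> verts B m" "b m u \<noteq> 0" using nz by blast
  have Lm: "0 < L m"
  proof -
    have "0 < real (height B m u) * cell_mass m u * (cmod (b m u))\<^sup>2" using h_pos[OF m(1,2)] cell_mass_pos[OF m(1,2)] m by simp
    also have "\<dots> \<le> L m"
      unfolding L_def energy_def using m finite_verts cell_mass_pos[OF m(1)]
      by (intro member_le_sum) (auto simp: less_imp_le)
    finally show ?thesis .
  qed
  have "L m \<le> (LINT x|P. (cmod (f x))\<^sup>2)"
  proof (rule LIMSEQ_le_const[OF lim_L])
    have "m \<le> Suc (r i)" if "m \<le> i" for i using seq_suble[OF r(1), of i] that by simp
    then show "\<exists>N. \<forall>i\<ge>N. L m \<le> L (Suc (r i))" using mono[OF m(1)] by blast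
  qed
  then have nonzero: "\<not> (AE x in P. f x = 0)"
  proof (rule contrapos_pn)
    assume "AE x in P. f x = 0"
    then have "(LINT x|P. (cmod (f x))\<^sup>2) = (LINT x|P. 0)"
      using f_meas by (intro integral_cong_AE) auto
    then show "\<not> L m \<le> (LINT x|P. (cmod (f x))\<^sup>2)" using Lm by simp
  qed
  have x_max: "x_max B \<in> inf_paths B" using all_max_x_max by (simp add: all_max_def)
  \<comment> \<open>Convergence at the image point follows from convergence at \<open>x\<close>:
    away from the maximal path, late levels satisfy \<open>F n (vershik B x) = c * F n x\<close>. As
    \<open>f\<close> is defined everywhere by \<open>lim\<close>, this gives its value at the image
    point.\<close>
  have "AE x in P. f (vershik B x) = c * f x"
    using conv AE_space AE_not_point[OF x_max]
  proof eventually_elim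
    case (elim x)
    then obtain k where k: "\<And>n. k \<le> n \<Longrightarrow> tau B n (vershik B x) = tau B n x"
      "\<And>n. k \<le> n \<Longrightarrow> return_time B n x = return_time B n (vershik B x) + 1"
      using vershik_eventually[of x] by (auto simp: space_P)
    have "F n (vershik B x) = c * F n x" if "k \<le> n" for n
      using k[OF that] cc by (simp add: F_def mult.commute)
    moreover have "k \<le> Suc (r i)" if "k \<le> i" for i using seq_suble[OF r(1), of i] that by simp
    ultimately have "\<forall>\<^sub>F i in sequentially. c * F (Suc (r i)) x = F (Suc (r i)) (vershik B x)"
      unfolding eventually_sequentially by (intro exI[of _ k]) simp
    then have "(\<lambda>i. F (Suc (r i)) (vershik B x)) \<longlonglongrightarrow> c * f x"
      using tendsto_mult_left[OF elim(1)] by (rule Lim_transform_eventually[rotated])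
    then show ?case unfolding f_def[of "vershik B x"] by (rule limI)
  qed
  then show ?thesis
    unfolding eigenvalue_for_def using f_meas int_f nonzero by blast
qed

end

section \<open>The summability criterion\<close>

lemma lam_pow_cis: "lam_pow \<alpha> t = cis (2 * pi * \<alpha> * t)"
  unfolding lam_pow_def cis_conv_exp by (simp add: mult_ac)

lemma norm_lam_pow: "cmod (lam_pow \<alpha> t) = 1"
  by (simp add: lam_pow_cis)

lemma cnj_lam_pow_power: "cnj (lam_pow \<alpha> 1) ^ k = lam_pow \<alpha> (- real k)"
  by (simp add: lam_pow_cis cis_cnj Complex.DeMoivre mult_ac)

lemma lam_pow_add: "lam_pow \<alpha> (s + t) = lam_pow \<alpha> s * lam_pow \<alpha> t"
  by (simp add: lam_pow_cis cis_mult distrib_left)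

lemma lam_pow_diff: "lam_pow \<alpha> (s - t) = lam_pow \<alpha> s / lam_pow \<alpha> t"
  by (simp add: lam_pow_cis cis_divide right_diff_distrib)

lemma norm_lam_pow_minus: "cmod (lam_pow \<alpha> (- t) - 1) = cmod (lam_pow \<alpha> t - 1)"
  using complex_mod_cnj[of "lam_pow \<alpha> t - 1"] by (simp add: lam_pow_cis cis_cnj)

context measured_bv
begin

text \<open>Suffix vectors are defined through infinite paths, yet every edge occurs: the paths
  through it include a floor of positive mass, which is nonempty.\<close>

lemma suffix_set_eq:
  assumes n: "1 \<le> n"
  shows "suffix_set B n u v = (\<lambda>e. suffix_vec B n (\<lambda>_. e)) ` {e \<in> edges B (Suc n). src B e = u \<and> rng B e = v}"
proof (intro equalityI subsetI)
  fix s assume "s \<in> suffix_set B n u v"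
  then obtain x where x: "s = suffix_vec B n x" "x \<in> inf_paths B" "tau B n x = u" "tau B (Suc n) x = v"
    by (auto simp: suffix_set_def)
  then have "s = suffix_vec B n (\<lambda>_. x (Suc n))" "x (Suc n) \<in> edges B (Suc n)"
      "src B (x (Suc n)) = u" "rng B (x (Suc n)) = v"
    using inf_path_edge_Suc[OF x(2)] inf_path_src[OF x(2) n] by (auto simp: suffix_vec_def tau_def)
  then show "s \<in> (\<lambda>e. suffix_vec B n (\<lambda>_. e)) ` {e \<in> edges B (Suc n). src B e = u \<and> rng B e = v}"
    by blast
next
  fix s assume "s \<in> (\<lambda>e. suffix_vec B n (\<lambda>_. e)) ` {e \<in> edges B (Suc n). src B e = u \<and> rng B e = v}"
  then obtain e where e: "s = suffix_vec B n (\<lambda>_. e)" "e \<in> edges B (Suc n)" "src B e = u" "rng B e = v" by blast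
  have hp: "0 < height B n (src B e)" using height_pos[OF n src_verts[OF e(2)]] .
  have "measure P (cell B (Suc n) (rng B e) (climb B n e + 0)) = cell_mass (Suc n) (rng B e)"
    using climb_less_height[OF n e(2) hp] by (intro measure_cell) auto
  then have "measure P (cell B (Suc n) (rng B e) (climb B n e + 0)) \<noteq> 0"
    using cell_mass_pos[of "Suc n" "rng B e"] rng_verts[OF _ e(2)] by simp
  then obtain x where x: "x \<in> cell B (Suc n) (rng B e) (climb B n e + 0)" by force
  have "x (Suc n) = e" by (rule cell_Suc_edge(1)[OF n e(2) hp x])
  then show "s \<in> suffix_set B n u v"
    using x e inf_path_src[OF _ n, of x] unfolding suffix_set_def
    by (auto simp: cell_def suffix_vec_def tau_def intro!: exI[of _ x])
qed

text \<open>Sums over suffix vectors run over a set, so two edges with the same vector would be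
  counted once. Equal vectors have equal \<open>climb\<close>, which separates edges of common range
  because heights are positive.\<close>

lemma suffix_vec_inj:
  "inj_on (\<lambda>e. suffix_vec B n (\<lambda>_. e)) {e \<in> edges B (Suc n). src B e = u \<and> rng B e = v}" if n: "1 \<le> n"
proof (rule inj_onI)
  fix e f assume ef: "e \<in> {e \<in> edges B (Suc n). src B e = u \<and> rng B e = v}"
    "f \<in> {e \<in> edges B (Suc n). src B e = u \<and> rng B e = v}" "suffix_vec B n (\<lambda>_. e) = suffix_vec B n (\<lambda>_. f)"
  then have "climb B n e = climb B n f"
    using inner_height_suffix_vec[of n "\<lambda>_. e"] inner_height_suffix_vec[of n "\<lambda>_. f"] by simp
  then show "e = f"
    using climb_digit[of e n f 0 0] ef height_pos[OF n src_verts, of e] height_pos[OF n src_verts, of f] by auto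
qed

definition phase :: "(nat \<Rightarrow> 'a \<Rightarrow> real) \<Rightarrow> nat \<Rightarrow> 'b \<Rightarrow> real" where
  "phase \<rho> n e = real (climb B n e) - \<rho> (Suc n) (rng B e) + \<rho> n (src B e)"

lemma summand_eq_mean_defect:
  assumes n: "1 \<le> n"
  shows "1 / real (inc_mat B (n + 1) u v) * (\<Sum>s \<in> suffix_set B n u v.
      (cmod (lam_pow \<alpha> (inner_height B n s - \<rho> (n + 1) v + \<rho> n u) - 1))\<^sup>2) =
    mean_defect n (\<lambda>e. lam_pow \<alpha> (phase \<rho> n e)) u v"
proof -
  have "(\<Sum>s \<in> suffix_set B n u v. (cmod (lam_pow \<alpha> (inner_height B n s - \<rho> (n + 1) v + \<rho> n u) - 1))\<^sup>2) =
      (\<Sum>e \<in> {e \<in> edges B (Suc n). src B e = u \<and> rng B e = v}. (cmod (lam_pow \<alpha> (phase \<rho> n e) - 1))\<^sup>2)"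
    unfolding suffix_set_eq[OF n] sum.reindex[OF suffix_vec_inj[OF n]]
    by (intro sum.cong refl) (auto simp: phase_def inner_height_suffix_vec)
  then show ?thesis by (simp add: mean_defect_def inc_mat_def)
qed

lemma mean_defect_cong:
  assumes "\<And>e. e \<in> edges B (Suc n) \<Longrightarrow> src B e = u \<Longrightarrow> rng B e = v \<Longrightarrow> cmod (z e - 1) = cmod (z' e - 1)"
  shows "mean_defect n z u v = mean_defect n z' u v"
  unfolding mean_defect_def using assms by (intro arg_cong2[of _ _ _ _ "(*)"] refl sum.cong) auto

lemma mean_defect_nonneg: "0 \<le> mean_defect n z u v"
  unfolding mean_defect_def by (intro mult_nonneg_nonneg sum_nonneg) auto

theorem eigenvalue_imp_summable:
  assumes eig: "eigenvalue_for (vershik B) P (lam_pow \<alpha> 1)"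
  shows "\<exists>\<rho>. \<forall>w. (\<forall>n\<ge>1. w n \<in> verts B n) \<longrightarrow>
    summable (\<lambda>n. mean_defect n (\<lambda>e. lam_pow \<alpha> (phase \<rho> n e)) (w n) (w (Suc n)))"
\<comment> \<open>For \<open>\<alpha> = 0\<close> powers of \<lambda> cannot represent phases, but
  all terms of the series vanish for any \<rho>.\<close>
proof (cases "\<alpha> = 0")
  case True
  then have "mean_defect n (\<lambda>e. lam_pow \<alpha> (phase \<rho> n e)) u v = 0" for n \<rho> u v
    by (simp add: mean_defect_def lam_pow_def)
  then show ?thesis by simp
next
  case False
  obtain b K where b: "\<And>n. 1 \<le> n \<Longrightarrow> consistent_step n (\<lambda>e. cnj (lam_pow \<alpha> 1) ^ climb B n e) (b n) (b (Suc n))"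
    "\<And>n. 1 \<le> n \<Longrightarrow> energy n (b n) \<le> K" "\<exists>m\<ge>1. \<exists>u \<in> verts B m. b m u \<noteq> 0"
    by (rule eigenfunction_imp_consistent[OF eig norm_lam_pow]) (rule that)
  then obtain m u where m: "1 \<le> m" "u \<in> verts B m" "b m u \<noteq> 0" by blast
  have "cmod (cnj (lam_pow \<alpha> 1) ^ climb B n e) = 1" for n e by (simp add: norm_power norm_lam_pow)
  from consistent_imp_defects[OF b(1) this b(2) m]
  obtain N D where N: "1 \<le> N" "summable D"
    "\<And>n u. N \<le> n \<Longrightarrow> u \<in> verts B n \<Longrightarrow> b n u \<noteq> 0"
    "\<And>n u v. N \<le> n \<Longrightarrow> u \<in> verts B n \<Longrightarrow> v \<in> verts B (Suc n) \<Longrightarrow>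
      mean_defect n (\<lambda>e. cnj (lam_pow \<alpha> 1) ^ climb B n e * sgn (b (Suc n) (rng B e)) / sgn (b n (src B e))) u v \<le> D n"
    by blast
  \<comment> \<open>The argument is divided by \<open>2 * pi * \<alpha>\<close> so that the power of
    \<lambda> with exponent \<open>\<rho> n v\<close> is the phase of \<open>b n v\<close>. Below
    level \<open>N\<close> some \<open>b n v\<close> may be zero; this affects finitely many terms
    only.\<close>
  define \<rho> where "\<rho> n v = Arg (b n v) / (2 * pi * \<alpha>)" for n v
  have \<rho>: "lam_pow \<alpha> (\<rho> n v) = sgn (b n v)" if "b n v \<noteq> 0" for n v
    using cis_Arg[OF that] False by (simp add: lam_pow_cis \<rho>_def)
  have le: "mean_defect n (\<lambda>e. lam_pow \<alpha> (phase \<rho> n e)) u v \<le> D n"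
    if n: "N \<le> n" and u: "u \<in> verts B n" and v: "v \<in> verts B (Suc n)" for n u v
  proof -
    have "mean_defect n (\<lambda>e. lam_pow \<alpha> (phase \<rho> n e)) u v =
        mean_defect n (\<lambda>e. cnj (lam_pow \<alpha> 1) ^ climb B n e * sgn (b (Suc n) (rng B e)) / sgn (b n (src B e))) u v"
    proof (rule mean_defect_cong)
      fix e assume e: "src B e = u" "rng B e = v"
      have "cnj (lam_pow \<alpha> 1) ^ climb B n e * sgn (b (Suc n) (rng B e)) / sgn (b n (src B e)) =
          lam_pow \<alpha> (- real (climb B n e) + \<rho> (Suc n) v - \<rho> n u)"
        using \<rho>[OF N(3)[OF n u]] \<rho>[OF N(3)[OF _ v]] n e
        by (simp only: lam_pow_add lam_pow_diff cnj_lam_pow_power le_SucI)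
      also have "- real (climb B n e) + \<rho> (Suc n) v - \<rho> n u = - phase \<rho> n e"
        using e by (simp add: phase_def)
      finally show "cmod (lam_pow \<alpha> (phase \<rho> n e) - 1) =
          cmod (cnj (lam_pow \<alpha> 1) ^ climb B n e * sgn (b (Suc n) (rng B e)) / sgn (b n (src B e)) - 1)"
        by (simp only: norm_lam_pow_minus)
    qed
    then show ?thesis using N(4)[OF n u v] by simp
  qed
  show ?thesis
  proof (intro exI[of _ \<rho>] allI impI)
    fix w :: "nat \<Rightarrow> 'a" assume w: "\<forall>n\<ge>1. w n \<in> verts B n"
    show "summable (\<lambda>n. mean_defect n (\<lambda>e. lam_pow \<alpha> (phase \<rho> n e)) (w n) (w (Suc n)))"
    proof (rule summable_comparison_test'[OF N(2), of N])
      fix n assume n: "N \<le> n"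
      then show "norm (mean_defect n (\<lambda>e. lam_pow \<alpha> (phase \<rho> n e)) (w n) (w (Suc n))) \<le> D n"
        using le[OF n, of "w n" "w (Suc n)"] w N(1) mean_defect_nonneg by simp
    qed
  qed
qed

theorem summable_imp_eigenvalue:
  assumes summ: "summable (\<lambda>n. \<Sum>u \<in> verts B n. \<Sum>v \<in> verts B (Suc n).
    mean_defect n (\<lambda>e. lam_pow \<alpha> (phase \<rho> n e)) u v)"
  shows "eigenvalue_for (vershik B) P (lam_pow \<alpha> 1)"
proof -
  let ?z = "\<lambda>n e. lam_pow \<alpha> (- phase \<rho> n e)"
  have "total_defect n (?z n) = total_defect n (\<lambda>e. lam_pow \<alpha> (phase \<rho> n e))" for n
    by (simp only: total_defect_def norm_lam_pow_minus)
  then have "summable (\<lambda>n. total_defect n (?z n))"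
    using total_defect_le total_defect_nonneg by (intro summable_comparison_test'[OF summ, of 1]) auto
  then obtain b where b: "\<And>n. 1 \<le> n \<Longrightarrow> consistent_step n (?z n) (b n) (b (Suc n))"
    "\<And>n u. 1 \<le> n \<Longrightarrow> u \<in> verts B n \<Longrightarrow> cmod (b n u) \<le> 1" "\<exists>m\<ge>1. \<exists>u \<in> verts B m. b m u \<noteq> 0"
    by (rule defects_imp_consistent[OF norm_lam_pow]) (rule that)
  \<comment> \<open>The pulled-back family is consistent for edge factors twisted by \<rho>.
    Multiplication by this power of \<lambda> removes the twist and leaves the factors of an
    eigenfunction.\<close>
  define b' where "b' n u = lam_pow \<alpha> (\<rho> n u) * b n u" for n u
  show ?thesis
  proof (rule consistent_imp_eigenfunction[of _ b'])
    fix n :: nat assume n: "1 \<le> n"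
    show "consistent_step n (\<lambda>e. cnj (lam_pow \<alpha> 1) ^ climb B n e) (b' n) (b' (Suc n))"
      unfolding consistent_step_def
    proof
      fix u assume u: "u \<in> verts B n"
      have "of_real (cell_mass n u) * b' n u = lam_pow \<alpha> (\<rho> n u) * (of_real (cell_mass n u) * b n u)"
        by (simp add: b'_def)
      also have "\<dots> = (\<Sum>e \<in> {e \<in> edges B (Suc n). src B e = u}.
          lam_pow \<alpha> (\<rho> n u) * (of_real (cell_mass (Suc n) (rng B e)) * ?z n e * b (Suc n) (rng B e)))"
        using b(1)[OF n] u by (simp add: consistent_step_def sum_distrib_left)
      also have "\<dots> = (\<Sum>e \<in> {e \<in> edges B (Suc n). src B e = u}.
          of_real (cell_mass (Suc n) (rng B e)) * cnj (lam_pow \<alpha> 1) ^ climb B n e * b' (Suc n) (rng B e))"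
      proof (rule sum.cong[OF refl])
        fix e assume "e \<in> {e \<in> edges B (Suc n). src B e = u}"
        then have eq: "lam_pow \<alpha> (\<rho> n u) * ?z n e = lam_pow \<alpha> (- real (climb B n e)) * lam_pow \<alpha> (\<rho> (Suc n) (rng B e))"
          unfolding lam_pow_add[symmetric] by (simp add: phase_def algebra_simps)
        have "lam_pow \<alpha> (\<rho> n u) * (of_real (cell_mass (Suc n) (rng B e)) * ?z n e * b (Suc n) (rng B e)) =
            of_real (cell_mass (Suc n) (rng B e)) * (lam_pow \<alpha> (\<rho> n u) * ?z n e) * b (Suc n) (rng B e)"
          by (simp only: mult_ac)
        then show "lam_pow \<alpha> (\<rho> n u) * (of_real (cell_mass (Suc n) (rng B e)) * ?z n e * b (Suc n) (rng B e)) =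
            of_real (cell_mass (Suc n) (rng B e)) * cnj (lam_pow \<alpha> 1) ^ climb B n e * b' (Suc n) (rng B e)"
          by (simp only: eq cnj_lam_pow_power b'_def mult.assoc)
      qed
      finally show "of_real (cell_mass n u) * b' n u = (\<Sum>e \<in> {e \<in> edges B (Suc n). src B e = u}.
          of_real (cell_mass (Suc n) (rng B e)) * cnj (lam_pow \<alpha> 1) ^ climb B n e * b' (Suc n) (rng B e))" .
    qed
  next
    have "b' m u \<noteq> 0" if "b m u \<noteq> 0" for m u
      using that by (simp add: b'_def lam_pow_cis)
    then show "\<exists>m\<ge>1. \<exists>u \<in> verts B m. b' m u \<noteq> 0" using b(3) by blast
  next
    show "cmod (b' n v) \<le> 1" if "1 \<le> n" "v \<in> verts B n" for n v
      using b(2)[OF that] by (simp add: b'_def norm_mult norm_lam_pow)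
  qed (rule norm_lam_pow)
qed

end

section \<open>Transfer to the path system\<close>

lemma continuous_map_borel_of:
  assumes "continuous_map X Y f"
  shows "f \<in> measurable (borel_of X) (borel_of Y)"
  unfolding borel_of_def[of Y]
proof (rule measurable_measure_of)
  show "{U. openin Y U} \<subseteq> Pow (topspace Y)" using openin_subset by blast
  show "f \<in> space (borel_of X) \<rightarrow> topspace Y"
    using continuous_map_image_subset_topspace[OF assms] by (auto simp: space_borel_of)
  fix U assume "U \<in> {U. openin Y U}"
  then have "openin X {x \<in> topspace X. f x \<in> U}" using assms by (auto simp: continuous_map_def)
  moreover have "f -` U \<inter> space (borel_of X) = {x \<in> topspace X. f x \<in> U}"
    by (auto simp: space_borel_of)
  ultimately show "f -` U \<inter> space (borel_of X) \<in> sets (borel_of X)"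
    by (simp add: sets_borel_of sigma_sets.Basic)
qed

lemma infinite_cantor_space:
  assumes "cantor_space X"
  shows "infinite (topspace X)"
proof
  assume fin: "finite (topspace X)"
  obtain f where "homeomorphic_map X (product_topology (\<lambda>_::nat. discrete_topology (UNIV :: bool set)) UNIV) f"
    using assms by (auto simp: cantor_space_def homeomorphic_space)
  then have "f ` topspace X = (UNIV :: (nat \<Rightarrow> bool) set)"
    by (simp add: homeomorphic_imp_surjective_map)
  then have "finite (UNIV :: (nat \<Rightarrow> bool) set)" using fin by (metis finite_imageI)
  then have "finite (UNIV :: nat set)" by (rule finite_fun_UNIVD1) simp
  then show False by simp
qed

text \<open>Eigenfunctions pull back along a factor map. Applied to a conjugacy and to its inverse,
  this gives both directions of the transfer.\<close>

lemma eigenvalue_for_factor: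
  assumes g: "g \<in> measurable M N" and inter: "\<And>x. x \<in> space M \<Longrightarrow> g (T x) = S (g x)"
    and eig: "eigenvalue_for S (distr M N g) c"
  shows "eigenvalue_for T M c"
proof -
  obtain f where f: "f \<in> borel_measurable N" "integrable (distr M N g) (\<lambda>x. (cmod (f x))\<^sup>2)"
    "\<not> (AE x in distr M N g. f x = 0)" "AE x in distr M N g. f (S x) = c * f x"
    using eig by (auto simp: eigenvalue_for_def)
  have "(\<lambda>x. f (g x)) \<in> borel_measurable M" using g f(1) by (rule measurable_compose)
  moreover have "integrable M (\<lambda>x. (cmod (f (g x)))\<^sup>2)"
    using f(1,2) g by (subst (asm) integrable_distr_eq) auto
  moreover have "\<not> (AE x in M. f (g x) = 0)"
  proof -
    have "{x \<in> space N. f x = 0} \<in> sets N" using f(1) by measurable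
    then show ?thesis using f(3) by (simp add: AE_distr_iff[OF g])
  qed
  moreover have "AE x in M. f (g (T x)) = c * f (g x)"
    using AE_distrD[OF g f(4)] AE_space by eventually_elim (simp add: inter)
  ultimately show ?thesis unfolding eigenvalue_for_def by blast
qed

lemma conjugate_ergodic_measure:
  assumes conj: "topologically_conjugate_via X T Y S \<phi>" and T: "T \<in> topspace X \<rightarrow> topspace X"
    and erg: "ergodic_measure X T \<mu>"
  shows "ergodic_measure Y S (distr \<mu> (borel_of Y) \<phi>)"
    and "eigenvalue_for S (distr \<mu> (borel_of Y) \<phi>) c \<longleftrightarrow> eigenvalue_for T \<mu> c"
proof -
  define \<nu> where "\<nu> = distr \<mu> (borel_of Y) \<phi>"
  obtain \<psi> where maps: "homeomorphic_maps X Y \<phi> \<psi>"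
    using conj by (auto simp: topologically_conjugate_via_def homeomorphic_map_maps)
  then have \<phi>: "continuous_map X Y \<phi>" and \<psi>: "continuous_map Y X \<psi>"
    and \<psi>\<phi>: "\<And>x. x \<in> topspace X \<Longrightarrow> \<psi> (\<phi> x) = x" and \<phi>\<psi>: "\<And>y. y \<in> topspace Y \<Longrightarrow> \<phi> (\<psi> y) = y"
    by (auto simp: homeomorphic_maps_def)
  have \<phi>T: "\<And>x. x \<in> topspace X \<Longrightarrow> \<phi> (T x) = S (\<phi> x)"
    using conj by (auto simp: topologically_conjugate_via_def)
  have \<phi>_top: "\<And>x. x \<in> topspace X \<Longrightarrow> \<phi> x \<in> topspace Y" and \<psi>_top: "\<And>y. y \<in> topspace Y \<Longrightarrow> \<psi> y \<in> topspace X"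
    using \<phi> \<psi> by (auto simp: continuous_map_def)
  have inv: "prob_space \<mu>" "sets \<mu> = sets (borel_of X)" "T \<in> measurable \<mu> \<mu>" "distr \<mu> \<mu> T = \<mu>"
    and erg': "\<And>A. A \<in> sets \<mu> \<Longrightarrow> T -` A \<inter> space \<mu> = A \<Longrightarrow> measure \<mu> A = 0 \<or> measure \<mu> A = 1"
    using erg by (auto simp: ergodic_measure_def invariant_measure_def)
  have space_\<mu>: "space \<mu> = topspace X" using sets_eq_imp_space_eq[OF inv(2)] by (simp add: space_borel_of)
  have \<phi>_meas: "\<phi> \<in> measurable \<mu> (borel_of Y)"
    using continuous_map_borel_of[OF \<phi>] measurable_cong_sets[OF inv(2) refl] by blast
  have sets_\<nu>: "sets \<nu> = sets (borel_of Y)" and space_\<nu>: "space \<nu> = topspace Y"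
    by (auto simp: \<nu>_def space_borel_of)
  have \<phi>_meas': "\<phi> \<in> measurable \<mu> \<nu>" using \<phi>_meas measurable_cong_sets[OF refl sets_\<nu>] by blast
  have \<psi>_meas: "\<psi> \<in> measurable \<nu> \<mu>"
    using continuous_map_borel_of[OF \<psi>] measurable_cong_sets[OF sets_\<nu> inv(2)] by blast
  have distr_\<phi>: "distr \<mu> \<nu> \<phi> = \<nu>" unfolding \<nu>_def by (intro distr_cong) auto
  have distr_\<psi>: "distr \<nu> \<mu> \<psi> = \<mu>"
  proof -
    have "distr \<nu> \<mu> \<psi> = distr \<mu> \<mu> (\<psi> \<circ> \<phi>)"
      using distr_distr[OF \<psi>_meas \<phi>_meas'] by (simp add: distr_\<phi>)
    also have "\<dots> = distr \<mu> \<mu> (\<lambda>x. x)" by (intro distr_cong) (auto simp: space_\<mu> \<psi>\<phi>)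
    finally show ?thesis by (simp add: distr_id)
  qed
  have S_eq: "S y = \<phi> (T (\<psi> y))" if "y \<in> topspace Y" for y
    using \<phi>T[OF \<psi>_top[OF that]] \<phi>\<psi>[OF that] by simp
  have "(\<lambda>y. \<phi> (T (\<psi> y))) \<in> measurable \<nu> \<nu>"
    by (rule measurable_compose[OF \<psi>_meas measurable_compose[OF inv(3) \<phi>_meas']])
  then have S_meas: "S \<in> measurable \<nu> \<nu>"
    using measurable_cong[of \<nu> S "\<lambda>y. \<phi> (T (\<psi> y))" \<nu>] S_eq by (simp add: space_\<nu>)
  have "distr \<nu> \<nu> S = distr \<mu> \<nu> (S \<circ> \<phi>)"
    using distr_distr[OF S_meas \<phi>_meas'] by (simp add: distr_\<phi>)
  also have "\<dots> = distr \<mu> \<nu> (\<phi> \<circ> T)" by (intro distr_cong) (auto simp: space_\<mu> \<phi>T)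
  also have "\<dots> = distr (distr \<mu> \<mu> T) \<nu> \<phi>" using distr_distr[OF \<phi>_meas' inv(3)] by simp
  finally have S_inv: "distr \<nu> \<nu> S = \<nu>" by (simp add: inv(4) distr_\<phi>)
  have "prob_space \<nu>" unfolding \<nu>_def using inv(1) \<phi>_meas by (rule prob_space.prob_space_distr)
  moreover have "measure \<nu> A = 0 \<or> measure \<nu> A = 1" if A: "A \<in> sets \<nu>" "S -` A \<inter> space \<nu> = A" for A
  proof -
    have "T -` (\<phi> -` A \<inter> space \<mu>) \<inter> space \<mu> = \<phi> -` A \<inter> space \<mu>"
    proof (intro set_eqI)
      fix x
      have "S (\<phi> x) \<in> A \<longleftrightarrow> \<phi> x \<in> A" if "x \<in> topspace X"
        using A(2) \<phi>_top[OF that] by (auto simp: space_\<nu> set_eq_iff)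
      then show "x \<in> T -` (\<phi> -` A \<inter> space \<mu>) \<inter> space \<mu> \<longleftrightarrow> x \<in> \<phi> -` A \<inter> space \<mu>"
        using T \<phi>T[of x] by (auto simp: space_\<mu>)
    qed
    then have "measure \<mu> (\<phi> -` A \<inter> space \<mu>) = 0 \<or> measure \<mu> (\<phi> -` A \<inter> space \<mu>) = 1"
      by (intro erg' measurable_sets[OF \<phi>_meas' A(1)])
    then show ?thesis using measure_distr[OF \<phi>_meas', of A] A(1) by (simp add: distr_\<phi>)
  qed
  ultimately show "ergodic_measure Y S (distr \<mu> (borel_of Y) \<phi>)"
    using sets_\<nu> S_meas S_inv unfolding \<nu>_def[symmetric] ergodic_measure_def invariant_measure_def by blast
  show "eigenvalue_for S (distr \<mu> (borel_of Y) \<phi>) c \<longleftrightarrow> eigenvalue_for T \<mu> c"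
  proof
    assume "eigenvalue_for S (distr \<mu> (borel_of Y) \<phi>) c"
    then show "eigenvalue_for T \<mu> c"
      by (rule eigenvalue_for_factor[OF \<phi>_meas, rotated]) (simp add: space_\<mu> \<phi>T)
  next
    assume "eigenvalue_for T \<mu> c"
    then have "eigenvalue_for T (distr \<nu> \<mu> \<psi>) c" by (simp add: distr_\<psi>)
    then show "eigenvalue_for S (distr \<mu> (borel_of Y) \<phi>) c"
      unfolding \<nu>_def[symmetric]
    proof (rule eigenvalue_for_factor[OF \<psi>_meas, rotated])
      fix y assume "y \<in> space \<nu>"
      then have y: "y \<in> topspace Y" by (simp add: space_\<nu>)
      then have "T (\<psi> y) \<in> topspace X" using T \<psi>_top by blast
      then show "\<psi> (S y) = T (\<psi> y)" by (simp add: S_eq[OF y] \<psi>\<phi>)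
    qed
  qed
qed

lemma (in measured_bv) eigenvalue_iff_summable:
  assumes vtx: "\<And>n. 1 \<le> n \<Longrightarrow> bij_betw (vtx n) {1..d} (verts B n)"
  shows "eigenvalue_for (vershik B) P (lam_pow \<alpha> 1) \<longleftrightarrow>
    (\<exists>\<rho> :: nat \<Rightarrow> 'a \<Rightarrow> real. \<forall>u :: nat \<Rightarrow> nat. (\<forall>n\<ge>1. u n \<in> {1..d}) \<longrightarrow>
       (\<lambda>n. 1 / real (inc_mat B (n + 1) (vtx n (u n)) (vtx (n + 1) (u (n + 1)))) *
            (\<Sum>s \<in> suffix_set B n (vtx n (u n)) (vtx (n + 1) (u (n + 1))).
               (cmod (lam_pow \<alpha> (inner_height B n s - \<rho> (n + 1) (vtx (n + 1) (u (n + 1)))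
                                     + \<rho> n (vtx n (u n))) - 1))\<^sup>2))
         summable_on {1..})" (is "_ \<longleftrightarrow> (\<exists>\<rho>. \<forall>u. _ \<longrightarrow> ?t \<rho> u summable_on _)")
proof -
  define md where "md \<rho> n u v = mean_defect n (\<lambda>e. lam_pow \<alpha> (phase \<rho> n e)) (vtx n u) (vtx (Suc n) v)" for \<rho> n u v
  have md_nonneg: "0 \<le> md \<rho> n u v" for \<rho> n u v by (simp add: md_def mean_defect_nonneg)
  have on_iff: "?t \<rho> u summable_on {1..} \<longleftrightarrow> summable (\<lambda>n. if 1 \<le> n then md \<rho> n (u n) (u (Suc n)) else 0)" for \<rho> u
  proof -
    have "?t \<rho> u summable_on {1..} \<longleftrightarrow> (\<lambda>n. if 1 \<le> n then md \<rho> n (u n) (u (Suc n)) else 0) summable_on UNIV"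
      using summand_eq_mean_defect by (intro summable_on_cong_neutral) (auto simp: md_def)
    then show ?thesis by (simp add: summable_on_UNIV_nonneg_real_iff md_nonneg)
  qed
  have drop: "summable (\<lambda>n. if 1 \<le> n then f n else 0) \<longleftrightarrow> summable f" for f :: "nat \<Rightarrow> real"
    by (intro summable_cong) (auto simp: eventually_sequentially intro: exI[of _ 1])
  show ?thesis
  proof
    assume "eigenvalue_for (vershik B) P (lam_pow \<alpha> 1)"
    from eigenvalue_imp_summable[OF this] obtain \<rho> where \<rho>: "\<And>w. \<forall>n\<ge>1. w n \<in> verts B n \<Longrightarrow>
        summable (\<lambda>n. mean_defect n (\<lambda>e. lam_pow \<alpha> (phase \<rho> n e)) (w n) (w (Suc n)))"
      by blast
    have "?t \<rho> u summable_on {1..}" if u: "\<forall>n\<ge>1. u n \<in> {1..d}" for u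
      unfolding on_iff drop md_def
    proof (rule \<rho>[of "\<lambda>n. vtx n (u n)"], intro allI impI)
      fix n :: nat assume n: "1 \<le> n"
      then show "vtx n (u n) \<in> verts B n" using bij_betwE[OF vtx[OF n]] u by simp
    qed
    then show "\<exists>\<rho>. \<forall>u. (\<forall>n\<ge>1. u n \<in> {1..d}) \<longrightarrow> ?t \<rho> u summable_on {1..}" by blast
  next
    assume "\<exists>\<rho>. \<forall>u. (\<forall>n\<ge>1. u n \<in> {1..d}) \<longrightarrow> ?t \<rho> u summable_on {1..}"
    then obtain \<rho> where \<rho>: "\<And>u. \<forall>n\<ge>1. u n \<in> {1..d} \<Longrightarrow> summable (\<lambda>n. md \<rho> n (u n) (u (Suc n)))"
      unfolding on_iff drop by blast
    \<comment> \<open>Every pair of consecutive vertices occurs in one of two alternating sequences.\<close>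
    have pair: "summable (\<lambda>n. md \<rho> n i j)" if ij: "i \<in> {1..d}" "j \<in> {1..d}" for i j
    proof -
      define w where "w n = (if even n then i else j)" for n :: nat
      define w' where "w' n = (if even n then j else i)" for n :: nat
      have "summable (\<lambda>n. md \<rho> n (w n) (w (Suc n)) + md \<rho> n (w' n) (w' (Suc n)))"
        using ij by (intro summable_add \<rho>) (auto simp: w_def w'_def)
      then show ?thesis
        by (rule summable_comparison_test'[of _ 0]) (auto simp: w_def w'_def md_nonneg)
    qed
    \<comment> \<open>The hypothesis tests one vertex sequence at a time, but the number of vertex
      pairs is the same on all levels; hence summability for each pair gives that of the full
      sum.\<close>
    have "summable (\<lambda>n. \<Sum>i \<in> {1..d}. \<Sum>j \<in> {1..d}. md \<rho> n i j)"
      by (intro summable_sum pair)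
    then have "summable (\<lambda>n. if 1 \<le> n then \<Sum>i \<in> {1..d}. \<Sum>j \<in> {1..d}. md \<rho> n i j else 0)"
      by (simp only: drop)
    also have "(\<lambda>n. if 1 \<le> n then \<Sum>i \<in> {1..d}. \<Sum>j \<in> {1..d}. md \<rho> n i j else 0) =
        (\<lambda>n. if 1 \<le> n then \<Sum>u \<in> verts B n. \<Sum>v \<in> verts B (Suc n).
          mean_defect n (\<lambda>e. lam_pow \<alpha> (phase \<rho> n e)) u v else 0)"
    proof
      fix n
      show "(if 1 \<le> n then \<Sum>i \<in> {1..d}. \<Sum>j \<in> {1..d}. md \<rho> n i j else 0) =
        (if 1 \<le> n then \<Sum>u \<in> verts B n. \<Sum>v \<in> verts B (Suc n).
          mean_defect n (\<lambda>e. lam_pow \<alpha> (phase \<rho> n e)) u v else 0)"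
        using sum.reindex_bij_betw[OF vtx] by (simp add: md_def flip: sum.reindex_bij_betw[OF vtx])
    qed
    finally have "summable (\<lambda>n. \<Sum>u \<in> verts B n. \<Sum>v \<in> verts B (Suc n).
          mean_defect n (\<lambda>e. lam_pow \<alpha> (phase \<rho> n e)) u v)"
      by (simp only: drop)
    then show "eigenvalue_for (vershik B) P (lam_pow \<alpha> 1)" by (rule summable_imp_eigenvalue)
  qed
qed

theorem theorem17:
  fixes X :: "'a topology" and T :: "'a \<Rightarrow> 'a"
    and B :: "('v, 'e) ordered_bratteli" and \<phi> :: "'a \<Rightarrow> nat \<Rightarrow> 'e"
    and d :: nat and vtx :: "nat \<Rightarrow> nat \<Rightarrow> 'v"
    and \<delta> :: real and I :: "(nat \<Rightarrow> 'e) measure \<Rightarrow> nat set"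
    and \<mu> :: "'a measure" and \<mu>B :: "(nat \<Rightarrow> 'e) measure" and \<alpha> :: real and c :: complex
  assumes "minimal_cantor_system X T"
    and "bv_representation B X T \<phi>"
    and "proper_finite_rank B d vtx"
    and "stable_rep B d vtx \<delta> I"
    and "ergodic_measure X T \<mu>"
    and "\<mu>B = distr \<mu> (borel_of (path_space B)) \<phi>"
    and "I \<mu>B = {1..d}"
    and "c = lam_pow \<alpha> 1"
  shows "eigenvalue_for T \<mu> c \<longleftrightarrow>
    (\<exists>\<rho> :: nat \<Rightarrow> 'v \<Rightarrow> real. \<forall>u :: nat \<Rightarrow> nat. (\<forall>n\<ge>1. u n \<in> I \<mu>B) \<longrightarrow>
       (\<lambda>n. 1 / real (inc_mat B (n + 1) (vtx n (u n)) (vtx (n + 1) (u (n + 1)))) *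
            (\<Sum>s \<in> suffix_set B n (vtx n (u n)) (vtx (n + 1) (u (n + 1))).
               (cmod (lam_pow \<alpha> (inner_height B n s - \<rho> (n + 1) (vtx (n + 1) (u (n + 1)))
                                     + \<rho> n (vtx n (u n))) - 1))\<^sup>2))
         summable_on {1..})"
proof -
  have conj: "topologically_conjugate_via X T (path_space B) (vershik B) \<phi>" and proper: "properly_ordered B"
    using assms(2) by (auto simp: bv_representation_def)
  then have homeo: "homeomorphic_map X (path_space B) \<phi>"
    and \<phi>T: "\<And>x. x \<in> topspace X \<Longrightarrow> \<phi> (T x) = vershik B (\<phi> x)"
    by (auto simp: topologically_conjugate_via_def)
  have img: "\<phi> ` topspace X = inf_paths B" and inj: "inj_on \<phi> (topspace X)"
    using homeomorphic_imp_surjective_map[OF homeo] homeomorphic_imp_injective_map[OF homeo]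
    by (auto simp: topspace_path_space)
  have T: "T \<in> topspace X \<rightarrow> topspace X"
    using assms(1) homeomorphic_imp_surjective_map[of X X T] by (auto simp: minimal_cantor_system_def)
  have erg: "ergodic_measure (path_space B) (vershik B) \<mu>B"
    and eig: "eigenvalue_for (vershik B) \<mu>B c \<longleftrightarrow> eigenvalue_for T \<mu> c"
    unfolding assms(6) by (rule conjugate_ergodic_measure[OF conj T assms(5)])+
  have vtx: "\<And>n. 1 \<le> n \<Longrightarrow> bij_betw (vtx n) {1..d} (verts B n)"
    and height_1: "\<And>v. v \<in> verts B 1 \<Longrightarrow> height B 1 v = 1"
    using assms(3) by (auto simp: proper_finite_rank_def)
  have clean: "0 < \<delta>" "\<And>v n. v \<in> {1..d} \<Longrightarrow> 1 \<le> n \<Longrightarrow> \<delta> \<le> measure \<mu>B {x \<in> space \<mu>B. tau B n x = vtx n v}"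
    and stable: "\<And>m n u v. 1 \<le> m \<Longrightarrow> m < n \<Longrightarrow> u \<in> {1..d} \<Longrightarrow> v \<in> {1..d} \<Longrightarrow>
      \<delta> / 2 < real (height B m (vtx m u)) / real (height B n (vtx n v)) * real (mat_prod B m n (vtx m u) (vtx n v))"
    using assms(4) erg assms(7) unfolding stable_rep_def clean_rep_def by blast+
  interpret ordered_bv B using proper by unfold_locales (simp add: properly_ordered_def)
  \<comment> \<open>Between consecutive levels the product starts from the identity matrix on level
    \<open>n\<close>, whose row at \<open>u\<close> has its entry 1 inside \<open>verts B n\<close>,
    and reduces to the incidence matrix.\<close>
  have mat_prod_Suc: "mat_prod B n (Suc n) u v = inc_mat B (Suc n) u v" if "u \<in> verts B n" for n u v
    using that finite_verts by (simp add: mat_prod_def if_distrib[of "\<lambda>x. x * _"] cong: if_cong)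
  interpret prob_space \<mu>B using erg by (simp add: ergodic_measure_def invariant_measure_def)
  interpret measured_bv B \<mu>B \<delta>
  proof unfold_locales
    show "properly_ordered B" by (rule proper)
    show "height B 1 v = 1" if "v \<in> verts B 1" for v using that by (rule height_1)
    show "vershik B x \<in> inf_paths B" if x: "x \<in> inf_paths B" for x
    proof -
      obtain y where y: "y \<in> topspace X" "x = \<phi> y" using x img by blast
      then have "vershik B x = \<phi> (T y)" "T y \<in> topspace X" using \<phi>T T by auto
      then show ?thesis using img by blast
    qed
    show "invariant_measure (path_space B) (vershik B) \<mu>B" using erg by (simp add: ergodic_measure_def)
    show "0 < \<delta>" by (rule clean)
    show "infinite (inf_paths B)"
      using infinite_cantor_space[of X] assms(1) finite_image_iff[OF inj]
      by (simp add: minimal_cantor_system_def img)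
  next
    fix n :: nat and v assume n: "1 \<le> n" and "v \<in> verts B n"
    then obtain i where "i \<in> {1..d}" "v = vtx n i" using bij_betw_imp_surj_on[OF vtx[OF n]] by blast
    then show "\<delta> \<le> measure \<mu>B {x \<in> space \<mu>B. tau B n x = v}" using clean(2) n by blast
  next
    fix n :: nat and u v assume n: "1 \<le> n" and uv: "u \<in> verts B n" "v \<in> verts B (Suc n)"
    have "vtx (Suc n) ` {1..d} = verts B (Suc n)" using vtx[of "Suc n"] by (simp add: bij_betw_def)
    then obtain i j where "i \<in> {1..d}" "u = vtx n i" "j \<in> {1..d}" "v = vtx (Suc n) j"
      using uv bij_betw_imp_surj_on[OF vtx[OF n]] by blast
    then show "\<delta> / 2 < real (height B n u) / real (height B (Suc n) v) * real (inc_mat B (Suc n) u v)"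
      using stable[OF n lessI, of i j] mat_prod_Suc[OF uv(1), of v] by simp
  qed
  show ?thesis
    unfolding eig[symmetric] unfolding assms(7,8) by (rule eigenvalue_iff_summable[OF vtx])
qed

end
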